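(* The Thue--Morse sequence $\mathbf t$ has level of distribution $1$ (with respect to $\mathcal Q(d)=\mathcal R(d)=\mathbb Z/d\mathbb Z$ for all $d\ge 1$). More precisely, for all $\varepsilon>0$ there exist $\eta>0$ and $C$ such that \[ \sum_{1\leq d\leq D}\;\max_{\substack{y,z\\ 0\leq y\leq z\\ z-y\leq x}}\;\max_{0\leq a<d} \left\lvert A(y,z;d,a) - \frac{z-y}{2d} \right\rvert \leq Cx^{1-\eta} \] for all real $x\geq 1$ and $D=x^{1-\varepsilon}$. Here $d,a$ run over integers and $y,z$ over real numbers.
   Context: For a nonnegative integer $n$, $s(n)$ denotes the number of $1$s in the binary expansion of $n$. The Thue--Morse sequence $\mathbf t=(\mathbf t(n))_{n\ge 0}$ takes values in $\{0,1\}$, with $\mathbf t(n)=0$ if and only if $s(n)\equiv 0\bmod 2$. For real $0\le y\le z$ and integers $d\ge 1$, $a\ge 0$, \[ A(y,z;d,a)=\bigl\lvert\bigl\{m\in\mathbb Z: y\leq m<z,\ \mathbf t(m)=0\text{ and } m\equiv a\bmod d\bigr\}\bigr\rvert . \] Maxima over infinite ranges of real parameters are understood as suprema. Level of distribution: Let $c=(c_n)_{n\geq 0}$ be a sequence of complex numbers, and for each integer $d\geq 1$ let $\mathcal Q(d)$ and $\mathcal R(d)\neq\emptyset$ be subsets of $\mathbb Z/d\mathbb Z$ such that $\mathcal Q(d)\subseteq \mathcal R(d)$. The sequence $c$ has level of distribution $\theta$ with respect to $\mathcal Q$ and $\mathcal R$ if for all $\varepsilon>0$ and $A>0$ there is a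 constant $C'$ (which may depend on $A$ and $\varepsilon$) such that for all $x\geq 1$ \[ \sum_{1\leq d\leq x^{\theta-\varepsilon}} \max_{0\leq y\leq x} \max_{\substack{0\leq a<d\\ a+d\mathbb Z\in \mathcal Q(d)}} \Biggl\lvert \sum_{\substack{0\leq n<y\\ n\equiv a \bmod d}}c_n -\frac 1{\lvert \mathcal R(d)\rvert} \sum_{\substack{0\leq n<y\\ n+d\mathbb Z\in \mathcal R(d)}}c_n \Biggr\rvert \leq C'\Biggl(\sum_{0\leq n<x}\lvert c_n\rvert\Biggr)(\log 2x)^{-A}. \] The maximum over the empty index set is defined as $0$. For the Thue--Morse sequence one takes $c_n=\mathbf t(n)\in\{0,1\}$. *)

theory Defs
  imports
    Complex_Main
    "HOL-Library.Extended_Nonnegative_Real"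
    "HOL-Number_Theory.Cong"
    "HOL-Algebra.IntRing"
begin

definition binary_ones :: "nat \<Rightarrow> nat" where
  "binary_ones n = card {k. bit n k}"

definition thue_morse :: "nat \<Rightarrow> nat" where
  "thue_morse n = (if binary_ones n mod 2 = 0 then 0 else 1)"

text \<open>Only used for \<open>0 \<le> y\<close>, so that the integers in \<open>[y, z)\<close> are natural numbers.\<close>

definition tm_count :: "real \<Rightarrow> real \<Rightarrow> nat \<Rightarrow> nat \<Rightarrow> nat" where
  "tm_count y z d a =
     card {m::nat. y \<le> real m \<and> real m < z \<and> thue_morse m = 0 \<and> [m = a] (mod d)}"

text \<open>
  The ring \<open>\<int>/d\<int>\<close> is \<^term>\<open>ZFact (int d)\<close>, and the class \<open>a + d\<int>\<close> is
  \<^term>\<open>ZMod (int d) (int a)\<close>.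

  Maxima are suprema in \<^typ>\<open>ennreal\<close>: there the supremum of an unbounded family is infinite
  rather than unspecified, and the supremum of the empty family is \<open>0\<close>.
\<close>

definition has_level_of_distribution ::
    "(nat \<Rightarrow> complex) \<Rightarrow> (nat \<Rightarrow> int set set) \<Rightarrow> (nat \<Rightarrow> int set set) \<Rightarrow> real \<Rightarrow> bool" where
  "has_level_of_distribution c Q R \<theta> \<longleftrightarrow>
     (\<forall>d\<ge>1. Q d \<subseteq> R d \<and> R d \<subseteq> carrier (ZFact (int d)) \<and> R d \<noteq> {}) \<and>
     (\<forall>\<epsilon>>0. \<forall>A>0. \<exists>C'::real. \<forall>x::real. x \<ge> 1 \<longrightarrow>
        (\<Sum>d | 1 \<le> d \<and> real d \<le> x powr (\<theta> - \<epsilon>).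
           SUP y\<in>{0..x}. SUP a\<in>{a. a < d \<and> ZMod (int d) (int a) \<in> Q d}.
             ennreal (cmod ((\<Sum>n | real n < y \<and> [n = a] (mod d). c n)
               - (\<Sum>n | real n < y \<and> ZMod (int d) (int n) \<in> R d. c n) / of_nat (card (R d)))))
        \<le> ennreal (C' * (\<Sum>n | real n < x. cmod (c n)) * ln (2 * x) powr (- A)))"

end

theory Submission
  imports Defs "HOL-Analysis.Convex"
begin

text \<open>
  Write \<open>f(n) = (-1) ^ s(n)\<close>. It suffices to bound the sums of \<open>f(n d + a)\<close> over \<open>n < N\<close>, uniformly in \<open>a\<close> and with
  a saving of a power of \<open>N\<close>, for a length \<open>N\<close> that is a small power of \<open>x\<close>; longer progressions are cut into pieces.
  As \<open>f(2 n) = f(n)\<close>, only odd \<open>d\<close> matter. A saving is not available for every \<open>d\<close>: for \<open>d = 2 ^ l + 1\<close>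
  and \<open>n < 2 ^ l\<close> the two halves of the expansion of \<open>n d\<close> are copies of each other. But the moduli that misbehave are so rare that the
  trivial bound is good enough for them.

  The difficulty is that \<open>n d + a\<close> has many more digits than \<open>n\<close>. The remedy is to remove digits. If \<open>K d\<close> is, modulo
  \<open>2 ^ b\<close>, a number \<open>t\<close> much smaller than \<open>2 ^ a\<close>, then passing from \<open>n\<close> to \<open>n + r K\<close> affects the digits
  between positions \<open>a\<close> and \<open>b\<close> only by rare carries. An application of van der Corput's inequality with shifts
  \<open>r K\<close> hence replaces \<open>f\<close>, cut off at \<open>b\<close> digits, by a product of two shifted copies of \<open>f\<close>, cut off at \<open>a\<close>
  digits. Dirichlet's approximation theorem provides \<open>K\<close> of size about \<open>2 ^ (b - a)\<close>. As \<open>log d\<close> is bounded by a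
  constant times \<open>log N\<close>, a bounded number \<open>M\<close> of such steps reduces the digits to \<open>log N\<close> many
  (\<open>window_corr_iterate\<close>).

  Now \<open>n d + a\<close> runs through a complete residue system, and the mean over it of the product of the \<open>2 ^ M\<close> shifted copies
  is a correlation of Gowers type, with directions \<open>(r' - r) t\<close>. It is estimated digit block by digit block
  (\<open>corr_strip_block\<close>). A block of low digits never does harm, and for one pattern of the directions in that block it yields a
  factor less than one, due to the identity that the product of \<open>f(y) f(y + 1)\<close> over \<open>y < 2 ^ M\<close> is \<open>-1\<close>. When
  \<open>t\<close> is a fixed power of two times an odd number, the relevant digits of the directions are uniformly distributed, so that
  the pattern occurs independently in each block with constant probability. With a number of blocks proportional to \<open>log N\<close> the
  mean gain is a power of \<open>N\<close> (\<open>cube_avg_damping\<close>).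

  Two properties of \<open>d\<close> enter: \<open>K d\<close> must not be divisible by a high power of two, and \<open>n d + a\<close> must not be close to a
  multiple of \<open>2 ^ a'\<close> too often, where \<open>a'\<close> is the number of digits that remain after a step. Both fail for few \<open>d\<close>
  only, by counting pairs \<open>(d, h)\<close> such that \<open>d h\<close> is close to a multiple of a power of two
  (\<open>card_resonant\<close>, \<open>card_clustering\<close>).
\<close>

section \<open>Signs of binary digits\<close>

text \<open>
  The product of the signs \<open>-1\<close> over the ones among the lowest \<open>b\<close> binary digits. On natural numbers below
  \<open>2 ^ b\<close> it is \<open>(-1) ^ s(n)\<close>. Taking integer arguments makes it periodic modulo \<open>2 ^ b\<close> on all of
  \<open>\<int>\<close>, so that negative shifts need no separate treatment.
\<close>

definition digit_sign :: "nat \<Rightarrow> int \<Rightarrow> real" where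
  "digit_sign b z = (\<Prod>k<b. if bit z k then -1 else 1)"

lemma abs_digit_sign [simp]: "\<bar>digit_sign b z\<bar> = 1"
  by (simp add: digit_sign_def abs_prod if_distrib cong: if_cong)

lemma digit_sign_square [simp]: "digit_sign b z * digit_sign b z = 1"
proof -
  have "digit_sign b z * digit_sign b z = \<bar>digit_sign b z\<bar> * \<bar>digit_sign b z\<bar>" 
    by (simp only: abs_mult_self_eq)
  then show ?thesis by simp
qed

lemma digit_sign_add:
  "digit_sign (a + b) z = digit_sign a z * digit_sign b (z div 2 ^ a)"
proof (induction b)
  case (Suc b)
  have "bit z (a + b) = bit (z div 2 ^ a) b"
    by (simp add: bit_iff_odd div_mult2_eq[symmetric] power_add zdiv_zmult2_eq)
  with Suc show ?case by (simp add: digit_sign_def)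
qed (simp add: digit_sign_def)

lemma digit_sign_mod: "digit_sign b (z mod 2 ^ b) = digit_sign b z"
  unfolding digit_sign_def take_bit_eq_mod[symmetric]
  by (rule prod.cong) (auto simp: bit_take_bit_iff)

lemma int_div_less:
  fixes m n q :: int
  assumes "0 < q" "m < n * q"
  shows "m div q < n"
proof (rule ccontr)
  assume "\<not> m div q < n"
  then have "n * q \<le> (m div q) * q" using assms(1) by (intro mult_right_mono) auto
  also have "\<dots> \<le> m" using assms(1) by (simp add: minus_mod_eq_div_mult[symmetric])
  finally show False using assms(2) by simp
qed

lemma digit_sign_cong: "x mod 2 ^ b = y mod 2 ^ b \<Longrightarrow> digit_sign b x = digit_sign b y"
  by (metis digit_sign_mod)

lemma digit_sign_zero [simp]: "digit_sign b 0 = 1"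
  by (simp add: digit_sign_def)

lemma digit_sign_power: "p < b \<Longrightarrow> digit_sign b (2 ^ p) = -1"
proof -
  assume "p < b"
  have "digit_sign b (2 ^ p) = (\<Prod>k<b. if k = p then -1 else 1)"
    unfolding digit_sign_def by (rule prod.cong) (auto simp: bit_exp_iff)
  also have "\<dots> = -1" using \<open>p < b\<close> by (simp add: prod.delta)
  finally show ?thesis .
qed

lemma digit_sign_shift:
  assumes "0 \<le> \<delta>" "\<delta> < 2 ^ e"
  shows "digit_sign (e + b) (2 ^ e * y + \<delta>) = digit_sign e \<delta> * digit_sign b y"
proof -
  have "digit_sign e (2 ^ e * y + \<delta>) = digit_sign e \<delta>"
    by (rule digit_sign_cong) simp
  moreover have "(2 ^ e * y + \<delta>) div 2 ^ e = y" using assms by simp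
  ultimately show ?thesis by (simp add: digit_sign_add)
qed

lemma prod_Pow_insert:
  fixes g :: "'a set \<Rightarrow> 'b :: comm_monoid_mult"
  assumes "finite A" "a \<notin> A"
  shows "(\<Prod>\<omega>\<in>Pow (insert a A). g \<omega>) = (\<Prod>\<omega>\<in>Pow A. g \<omega>) * (\<Prod>\<omega>\<in>Pow A. g (insert a \<omega>))"
proof -
  have inj: "inj_on (insert a) (Pow A)" using assms(2) by (auto intro!: inj_onI)
  have "(\<Prod>\<omega>\<in>Pow (insert a A). g \<omega>) = (\<Prod>\<omega>\<in>Pow A \<union> insert a ` Pow A. g \<omega>)"
    by (simp add: Pow_insert)
  also have "\<dots> = (\<Prod>\<omega>\<in>Pow A. g \<omega>) * (\<Prod>\<omega>\<in>insert a ` Pow A. g \<omega>)"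
    using assms by (intro prod.union_disjoint) auto
  also have "(\<Prod>\<omega>\<in>insert a ` Pow A. g \<omega>) = (\<Prod>\<omega>\<in>Pow A. g (insert a \<omega>))"
    using inj by (simp add: prod.reindex)
  finally show ?thesis .
qed

lemma prod_Pow_binary:
  fixes g :: "int \<Rightarrow> real"
  shows "(\<Prod>\<omega>\<in>Pow {..<M::nat}. g (\<Sum>i\<in>\<omega>. 2 ^ i)) = (\<Prod>y<2 ^ M. g (int y))"
proof (induction M arbitrary: g)
  case (Suc M)
  have fin: "finite \<omega>" "M \<notin> \<omega>" if "\<omega> \<in> Pow {..<M}" for \<omega>
    using that by (auto intro: finite_subset)
  have "(\<Prod>\<omega>\<in>Pow {..<Suc M}. g (\<Sum>i\<in>\<omega>. 2 ^ i))
     = (\<Prod>\<omega>\<in>Pow {..<M}. g (\<Sum>i\<in>\<omega>. 2 ^ i)) * (\<Prod>\<omega>\<in>Pow {..<M}. g (\<Sum>i\<in>insert M \<omega>. 2 ^ i))"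
    by (simp add: lessThan_Suc prod_Pow_insert)
  also have "(\<Prod>\<omega>\<in>Pow {..<M}. g (\<Sum>i\<in>insert M \<omega>. 2 ^ i))
     = (\<Prod>\<omega>\<in>Pow {..<M}. (\<lambda>y. g (y + 2 ^ M)) (\<Sum>i\<in>\<omega>. 2 ^ i))"
    by (rule prod.cong) (use fin in \<open>auto simp: add.commute\<close>)
  also have "\<dots> = (\<Prod>y<2 ^ M. g (int y + 2 ^ M))" by (rule Suc.IH)
  also have "(\<Prod>\<omega>\<in>Pow {..<M}. g (\<Sum>i\<in>\<omega>. 2 ^ i)) = (\<Prod>y<2 ^ M. g (int y))"
    by (rule Suc.IH)
  also have "(\<Prod>y<2 ^ M. g (int y)) * (\<Prod>y<2 ^ M. g (int y + 2 ^ M)) = (\<Prod>y<2 ^ Suc M. g (int y))"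
  proof -
    have "(\<Prod>y<2 ^ M. g (int y + 2 ^ M)) = (\<Prod>y\<in>{2 ^ M..<2 ^ M + 2 ^ M}. g (int y))"
      using prod.shift_bounds_nat_ivl[of "\<lambda>y. g (int y)" 0 "2^M" "2^M"]
      by (simp add: lessThan_atLeast0)
    moreover have "{..<2 ^ Suc M} = {..<2 ^ M} \<union> {2 ^ M..<2 ^ M + (2::nat) ^ M}" by auto
    ultimately show ?thesis by (simp add: prod.union_disjoint ivl_disj_int)
  qed
  finally show ?case .
qed simp

text \<open>
  With \<open>f(y) = (-1) ^ s(y)\<close>, the product of \<open>f(y) f(y + 1)\<close> over \<open>y < 2 ^ M\<close> telescopes to
  \<open>f(0) f(2 ^ M) = -1\<close>. This one sign is the source of all cancellation in the proof.
\<close>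

lemma prod_digit_sign_telescope:
  "(\<Prod>y<2 ^ M. digit_sign (Suc M) (int y)) * (\<Prod>y<2 ^ M. digit_sign (Suc M) (int y + 1)) = -1"
proof -
  define g where "g y = digit_sign (Suc M) (int y)" for y
  have "(\<Prod>y<n. g y) * (\<Prod>y<n. g (Suc y)) = g 0 * g n" for n
  proof (induction n)
    case (Suc n)
    have "(\<Prod>y<Suc n. g y) * (\<Prod>y<Suc n. g (Suc y))
       = ((\<Prod>y<n. g y) * (\<Prod>y<n. g (Suc y))) * (g n * g (Suc n))" by (simp add: algebra_simps)
    also have "\<dots> = g 0 * (g n * g n) * g (Suc n)" by (simp add: Suc algebra_simps)
    finally show ?case by (simp add: g_def)
  qed (simp add: g_def)
  from this[of "2 ^ M"] show ?thesis
    by (simp add: g_def digit_sign_power add.commute)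
qed

section \<open>Cancellation in correlations over complete residue systems\<close>

definition corr :: "nat set set \<Rightarrow> nat \<Rightarrow> (nat set \<Rightarrow> int) \<Rightarrow> real" where
  "corr \<Omega> l q = (\<Sum>x\<in>{0..<2 ^ l}. \<Prod>\<omega>\<in>\<Omega>. digit_sign l (x + q \<omega>))"

lemma abs_prod_digit_sign [simp]: "\<bar>\<Prod>\<omega>\<in>\<Omega>. digit_sign l (q \<omega>)\<bar> = 1"
  by (simp add: abs_prod)

lemma abs_corr_le: "\<bar>corr \<Omega> l q\<bar> \<le> 2 ^ l"
proof -
  have "\<bar>corr \<Omega> l q\<bar> \<le> (\<Sum>x\<in>{0..<2 ^ l::int}. 1)"
    unfolding corr_def by (rule order.trans[OF sum_abs]) (simp add: sum_mono)
  then show ?thesis by simp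
qed

lemma sum_split_digits:
  fixes g :: "int \<Rightarrow> real"
  assumes "A > 0" "B > 0"
  shows "(\<Sum>x\<in>{0..<A * B}. g x) = (\<Sum>u\<in>{0..<A}. \<Sum>v\<in>{0..<B}. g (u + A * v))"
proof -
  have "(\<Sum>u\<in>{0..<A}. \<Sum>v\<in>{0..<B}. g (u + A * v)) = (\<Sum>(u, v)\<in>{0..<A} \<times> {0..<B}. g (u + A * v))"
    by (simp add: sum.cartesian_product)
  also have "\<dots> = (\<Sum>x\<in>{0..<A * B}. g x)"
  proof (rule sum.reindex_bij_witness[of _ "\<lambda>x. (x mod A, x div A)" "\<lambda>(u, v). u + A * v"])
    fix x assume "x \<in> {0..<A * B}"
    then show "(x mod A, x div A) \<in> {0..<A} \<times> {0..<B}"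
      using assms by (auto simp: pos_imp_zdiv_nonneg_iff mult.commute intro!: int_div_less)
  next
    fix p assume "p \<in> {0..<A} \<times> {0..<B}"
    then obtain u v where p: "p = (u, v)" "0 \<le> u" "u < A" "0 \<le> v" "v < B" by auto
    have "A * v \<le> A * (B - 1)" using p assms by (intro mult_left_mono) auto
    then show "(case p of (u, v) \<Rightarrow> u + A * v) \<in> {0..<A * B}"
      using p assms by (auto simp: algebra_simps)
  qed (use assms in auto)
  finally show ?thesis by simp
qed

text \<open>
  Splitting \<open>x = u + 2 ^ k v\<close> separates the lowest \<open>k\<close> digits: their signs come out as a factor, and the upper
  digits see the same correlation again, with the shifts divided by \<open>2 ^ k\<close> and rounded down.
\<close>

lemma corr_add:
  "corr \<Omega> (k + l) q =
     (\<Sum>u\<in>{0..<2 ^ k}. (\<Prod>\<omega>\<in>\<Omega>. digit_sign k (u + q \<omega>)) * corr \<Omega> l (\<lambda>\<omega>. (u + q \<omega>) div 2 ^ k))"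
proof -
  have "corr \<Omega> (k + l) q = (\<Sum>u\<in>{0..<2 ^ k}. \<Sum>v\<in>{0..<2 ^ l}.
      \<Prod>\<omega>\<in>\<Omega>. digit_sign (k + l) (u + 2 ^ k * v + q \<omega>))"
    unfolding corr_def power_add by (subst sum_split_digits) auto
  also have "\<dots> = (\<Sum>u\<in>{0..<2 ^ k}. \<Sum>v\<in>{0..<2 ^ l}.
      (\<Prod>\<omega>\<in>\<Omega>. digit_sign k (u + q \<omega>)) * (\<Prod>\<omega>\<in>\<Omega>. digit_sign l (v + (u + q \<omega>) div 2 ^ k)))"
  proof (intro sum.cong refl, unfold prod.distrib[symmetric], rule prod.cong[OF refl])
    fix u v :: int and \<omega>
    have e: "u + 2 ^ k * v + q \<omega> = (u + q \<omega>) + v * 2 ^ k" by simp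
    have "digit_sign k (u + 2 ^ k * v + q \<omega>) = digit_sign k (u + q \<omega>)"
      unfolding e by (rule digit_sign_cong) simp
    moreover have "(u + 2 ^ k * v + q \<omega>) div 2 ^ k = v + (u + q \<omega>) div 2 ^ k"
      unfolding e by simp
    ultimately show "digit_sign (k + l) (u + 2 ^ k * v + q \<omega>)
       = digit_sign k (u + q \<omega>) * digit_sign l (v + (u + q \<omega>) div 2 ^ k)"
      by (simp add: digit_sign_add)
  qed
  finally show ?thesis by (simp add: corr_def sum_distrib_left)
qed

text \<open>
  The gain from one block of \<open>e + M + 1\<close> digits. If the block of the \<open>i\<close>-th direction is \<open>2 ^ (e + i)\<close>, the sums
  over subsets \<open>\<omega>\<close> run through all multiples \<open>2 ^ e y\<close> with \<open>y < 2 ^ M\<close>, which is the configuration in which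
  \<open>prod_digit_sign_telescope\<close> applies.
\<close>

definition block_factor :: "nat \<Rightarrow> nat \<Rightarrow> (nat \<Rightarrow> int) \<Rightarrow> real" where
  "block_factor M e \<tau> = (if \<forall>i<M. \<tau> i = 2 ^ (e + i) then 1 - 2 / 2 ^ (e + M + 1) else 1)"

lemma sum_div_mod:
  fixes \<tau> :: "nat \<Rightarrow> int"
  shows "(\<Sum>i\<in>\<omega>. \<tau> i) = q * (\<Sum>i\<in>\<omega>. \<tau> i div q) + (\<Sum>i\<in>\<omega>. \<tau> i mod q)"
proof -
  have "(\<Sum>i\<in>\<omega>. \<tau> i) = (\<Sum>i\<in>\<omega>. q * (\<tau> i div q) + \<tau> i mod q)" by simp
  then show ?thesis by (simp only: sum.distrib sum_distrib_left)
qed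

text \<open>
  Rounding down commutes with the sum of the shifts up to a carry that depends on the low digits only.
\<close>

lemma sum_div_carry:
  fixes \<tau> :: "nat \<Rightarrow> int"
  shows "(u + (\<Sum>i\<in>\<omega>. \<tau> i) + \<delta>) div 2 ^ k
     = (\<Sum>i\<in>\<omega>. \<tau> i div 2 ^ k) + (u + (\<Sum>i\<in>\<omega>. \<tau> i mod 2 ^ k) + \<delta>) div 2 ^ k"
proof -
  have e: "u + (\<Sum>i\<in>\<omega>. \<tau> i) + \<delta>
     = (u + (\<Sum>i\<in>\<omega>. \<tau> i mod 2 ^ k) + \<delta>) + 2 ^ k * (\<Sum>i\<in>\<omega>. \<tau> i div 2 ^ k)"
    unfolding sum_div_mod[of \<tau> \<omega> "2 ^ k"] by (simp only: add_ac)
  show ?thesis unfolding e by (subst div_mult_self2) auto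
qed

lemma sum_power2_int: "(\<Sum>i<n. 2 ^ i :: int) = 2 ^ n - 1"
  by (induction n) auto

text \<open>
  The shifts are the subset sums of \<open>\<tau>\<close>, perturbed by carries \<open>\<delta>\<close> between \<open>0\<close> and \<open>M\<close>; stripping off a block of
  digits reproduces this shape, because a sum of at most \<open>M + 2\<close> numbers, of which all but the carry are below
  \<open>2 ^ k\<close>, carries over at most \<open>M\<close>. Hence the bound for the upper digits, assumed for all admissible carries, can
  only improve. It does improve for the favourable pattern of low digits: the digits below \<open>2 ^ e\<close> absorb the carry,
  so that the choices \<open>u = 0\<close> and \<open>u = 2 ^ e\<close> of the low part of \<open>x\<close> lead to the same upper shifts, while their
  signs are opposite by \<open>prod_digit_sign_telescope\<close>. These two of the \<open>2 ^ k\<close> terms cancel.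
\<close>

lemma corr_strip_block:
  fixes M e l :: nat and \<tau> :: "nat \<Rightarrow> int" and B :: real
  defines "\<Omega> \<equiv> Pow {..<M}" and "k \<equiv> e + M + 1"
  assumes M: "M < 2 ^ e"
  assumes bound: "\<And>\<delta>. (\<And>\<omega>. \<omega> \<in> \<Omega> \<Longrightarrow> 0 \<le> \<delta> \<omega> \<and> \<delta> \<omega> \<le> int M) \<Longrightarrow>
    \<bar>corr \<Omega> l (\<lambda>\<omega>. (\<Sum>i\<in>\<omega>. \<tau> i div 2 ^ k) + \<delta> \<omega>)\<bar> \<le> 2 ^ l * B"
  assumes \<delta>: "\<And>\<omega>. \<omega> \<in> \<Omega> \<Longrightarrow> 0 \<le> \<delta> \<omega> \<and> \<delta> \<omega> \<le> int M"
  shows "\<bar>corr \<Omega> (k + l) (\<lambda>\<omega>. (\<Sum>i\<in>\<omega>. \<tau> i) + \<delta> \<omega>)\<bar>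
           \<le> 2 ^ (k + l) * (block_factor M e (\<lambda>i. \<tau> i mod 2 ^ k) * B)"
proof -
  define car where "car u \<omega> = (u + (\<Sum>i\<in>\<omega>. \<tau> i mod 2 ^ k) + \<delta> \<omega>) div 2 ^ k" for u \<omega>
  define sg where "sg u = (\<Prod>\<omega>\<in>\<Omega>. digit_sign k (u + ((\<Sum>i\<in>\<omega>. \<tau> i) + \<delta> \<omega>)))" for u
  define T where "T u = sg u * corr \<Omega> l (\<lambda>\<omega>. (\<Sum>i\<in>\<omega>. \<tau> i div 2 ^ k) + car u \<omega>)" for u
  have card_le: "card \<omega> \<le> M" if "\<omega> \<in> \<Omega>" for \<omega>
    using that card_mono[of "{..<M}" \<omega>] by (auto simp: \<Omega>_def)
  have eqT: "corr \<Omega> (k + l) (\<lambda>\<omega>. (\<Sum>i\<in>\<omega>. \<tau> i) + \<delta> \<omega>) = (\<Sum>u\<in>{0..<2 ^ k}. T u)"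
    unfolding corr_add T_def sg_def
  proof (intro sum.cong refl arg_cong2[where f="(*)"])
    fix u :: int
    show "corr \<Omega> l (\<lambda>\<omega>. (u + ((\<Sum>i\<in>\<omega>. \<tau> i) + \<delta> \<omega>)) div 2 ^ k)
       = corr \<Omega> l (\<lambda>\<omega>. (\<Sum>i\<in>\<omega>. \<tau> i div 2 ^ k) + car u \<omega>)"
      unfolding corr_def car_def add.assoc[symmetric]
      by (intro sum.cong prod.cong refl arg_cong[where f="digit_sign l"])
         (subst sum_div_carry, simp add: add.assoc)
  qed
  have Tle: "\<bar>T u\<bar> \<le> 2 ^ l * B" if u: "u \<in> {0..<2 ^ k}" for u
  proof -
    have "\<bar>T u\<bar> = \<bar>corr \<Omega> l (\<lambda>\<omega>. (\<Sum>i\<in>\<omega>. \<tau> i div 2 ^ k) + car u \<omega>)\<bar>"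
      by (simp add: T_def sg_def abs_mult)
    also have "\<dots> \<le> 2 ^ l * B"
    proof (rule bound)
      fix \<omega> assume \<omega>: "\<omega> \<in> \<Omega>"
      define s where "s = (\<Sum>i\<in>\<omega>. \<tau> i mod 2 ^ k)"
      have s0: "0 \<le> s" unfolding s_def by (intro sum_nonneg) auto
      have "s \<le> (\<Sum>i\<in>\<omega>. 2 ^ k - 1)" unfolding s_def
        by (intro sum_mono) (use pos_mod_bound[of "2^k::int"] in force)
      also have "\<dots> = int (card \<omega>) * (2 ^ k - 1)" by simp
      also have "\<dots> \<le> int M * (2 ^ k - 1)" using card_le[OF \<omega>] by (intro mult_right_mono) auto
      finally have "u + s + \<delta> \<omega> < (int M + 1) * 2 ^ k"
        using u \<delta>[OF \<omega>] by (auto simp: algebra_simps)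
      then have "(u + s + \<delta> \<omega>) div 2 ^ k < int M + 1" 
        by (intro int_div_less) auto
      moreover have "0 \<le> (u + s + \<delta> \<omega>) div 2 ^ k"
        using u s0 \<delta>[OF \<omega>] by (simp add: pos_imp_zdiv_nonneg_iff)
      ultimately show "0 \<le> car u \<omega> \<and> car u \<omega> \<le> int M" by (simp add: car_def s_def)
    qed
    finally show ?thesis .
  qed
  show ?thesis
  proof (cases "\<forall>i<M. \<tau> i mod 2 ^ k = 2 ^ (e + i)")
    case False
    then have bf: "block_factor M e (\<lambda>i. \<tau> i mod 2 ^ k) = 1" by (auto simp: block_factor_def)
    have "\<bar>\<Sum>u\<in>{0..<2 ^ k}. T u\<bar> \<le> (\<Sum>u\<in>{0..<2 ^ k::int}. 2 ^ l * B)"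
      by (rule order.trans[OF sum_abs]) (intro sum_mono Tle)
    then show ?thesis by (simp add: eqT bf power_add)
  next
    case True
    then have bf: "block_factor M e (\<lambda>i. \<tau> i mod 2 ^ k) = 1 - 2 / 2 ^ k"
      unfolding block_factor_def k_def by (rule if_P)
    define y where "y \<omega> = (\<Sum>i\<in>\<omega>. 2 ^ i :: int)" for \<omega> :: "nat set"
    have y: "0 \<le> y \<omega>" "y \<omega> < 2 ^ M" if "\<omega> \<in> \<Omega>" for \<omega>
    proof -
      show "0 \<le> y \<omega>" unfolding y_def by (intro sum_nonneg) simp
      have "y \<omega> \<le> (\<Sum>i<M. 2 ^ i)" unfolding y_def
        using that by (intro sum_mono2) (auto simp: \<Omega>_def)
      also have "\<dots> = 2 ^ M - 1" using sum_power2_int[of M] by simp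
      finally show "y \<omega> < 2 ^ M" by simp
    qed
    have low: "(\<Sum>i\<in>\<omega>. \<tau> i mod 2 ^ k) = 2 ^ e * y \<omega>" if "\<omega> \<in> \<Omega>" for \<omega>
      unfolding y_def sum_distrib_left
      by (rule sum.cong) (use that True in \<open>auto simp: \<Omega>_def power_add\<close>)
    have \<delta>e: "0 \<le> \<delta> \<omega>" "\<delta> \<omega> < 2 ^ e" if "\<omega> \<in> \<Omega>" for \<omega>
    proof -
      have "int M < 2 ^ e" using M by (metis of_nat_less_iff of_nat_numeral of_nat_power)
      then show "0 \<le> \<delta> \<omega>" "\<delta> \<omega> < 2 ^ e" using \<delta>[OF that] by linarith+
    qed
    \<comment> \<open>The low part \<open>2 ^ e * c\<close> of the variable shifts \<open>y \<omega>\<close> by \<open>c\<close> and leaves the carry \<open>\<delta>\<close> alone.\<close>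
    have sgc: "digit_sign k (2 ^ e * c + ((\<Sum>i\<in>\<omega>. \<tau> i) + \<delta> \<omega>))
        = digit_sign e (\<delta> \<omega>) * digit_sign (Suc M) (y \<omega> + c)" 
      if \<omega>: "\<omega> \<in> \<Omega>" for c \<omega>
    proof -
      have "digit_sign k (2 ^ e * c + ((\<Sum>i\<in>\<omega>. \<tau> i) + \<delta> \<omega>))
          = digit_sign k (2 ^ e * (y \<omega> + c) + \<delta> \<omega>)"
      proof (rule digit_sign_cong)
        have "2 ^ e * c + ((\<Sum>i\<in>\<omega>. \<tau> i) + \<delta> \<omega>)
            = (2 ^ e * (y \<omega> + c) + \<delta> \<omega>) + 2 ^ k * (\<Sum>i\<in>\<omega>. \<tau> i div 2 ^ k)"
          unfolding sum_div_mod[of \<tau> \<omega> "2 ^ k"] low[OF \<omega>] by (simp only: ring_distribs add_ac)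
        then show "(2 ^ e * c + ((\<Sum>i\<in>\<omega>. \<tau> i) + \<delta> \<omega>)) mod 2 ^ k
            = (2 ^ e * (y \<omega> + c) + \<delta> \<omega>) mod 2 ^ k"
          by (simp only: mod_mult_self2)
      qed
      also have "\<dots> = digit_sign e (\<delta> \<omega>) * digit_sign (Suc M) (y \<omega> + c)"
        using digit_sign_shift[OF \<delta>e[OF \<omega>], of "Suc M"] by (simp add: k_def)
      finally show ?thesis .
    qed
    have car: "car (2 ^ e * c) \<omega> = 0" if \<omega>: "\<omega> \<in> \<Omega>" and c: "0 \<le> c" "c \<le> 1" for c \<omega>
    proof -
      have "2 ^ e * (c + y \<omega>) \<le> 2 ^ e * 2 ^ M" using y[OF \<omega>] c by (intro mult_left_mono) simp_all
      moreover have "(2::int) ^ e * 1 \<le> 2 ^ e * 2 ^ M" by (intro mult_left_mono) auto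
      moreover have "(2::int) ^ k = 2 * (2 ^ e * 2 ^ M)" by (simp add: k_def power_add)
      ultimately have "2 ^ e * c + 2 ^ e * y \<omega> + \<delta> \<omega> < 2 ^ k"
        using \<delta>e[OF \<omega>] distrib_left[of "2 ^ e" c "y \<omega>"] by linarith
      moreover have "0 \<le> 2 ^ e * c + 2 ^ e * y \<omega> + \<delta> \<omega>"
      proof -
        have "0 \<le> 2 ^ e * c" "0 \<le> 2 ^ e * y \<omega>"
          by (rule mult_nonneg_nonneg[OF _ c(1)], simp, rule mult_nonneg_nonneg[OF _ y(1)[OF \<omega>]], simp)
        then show ?thesis using \<delta>e(1)[OF \<omega>] by (rule add_nonneg_nonneg[OF add_nonneg_nonneg])
      qed
      ultimately show ?thesis unfolding car_def low[OF \<omega>] by (rule div_pos_pos_trivial[rotated])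
    qed
    have sgs: "sg 0 * sg (2 ^ e) = -1"
    proof -
      have "sg 0 * sg (2 ^ e) = (\<Prod>\<omega>\<in>\<Omega>. digit_sign (Suc M) (y \<omega>) * digit_sign (Suc M) (y \<omega> + 1))"
        unfolding sg_def prod.distrib[symmetric]
      proof (rule prod.cong[OF refl])
        fix \<omega> assume \<omega>: "\<omega> \<in> \<Omega>"
        have "digit_sign e (\<delta> \<omega>) * digit_sign (Suc M) (y \<omega>)
            * (digit_sign e (\<delta> \<omega>) * digit_sign (Suc M) (y \<omega> + 1))
           = (digit_sign e (\<delta> \<omega>) * digit_sign e (\<delta> \<omega>))
             * (digit_sign (Suc M) (y \<omega>) * digit_sign (Suc M) (y \<omega> + 1))"
          by (simp only: mult_ac)
        then show "digit_sign k (0 + ((\<Sum>i\<in>\<omega>. \<tau> i) + \<delta> \<omega>)) *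
              digit_sign k (2 ^ e + ((\<Sum>i\<in>\<omega>. \<tau> i) + \<delta> \<omega>)) =
              digit_sign (Suc M) (y \<omega>) * digit_sign (Suc M) (y \<omega> + 1)"
          using sgc[OF \<omega>, of 0] sgc[OF \<omega>, of 1] by simp
      qed
      also have "\<dots> = -1"
        unfolding prod.distrib \<Omega>_def y_def
        using prod_Pow_binary[of "digit_sign (Suc M)" M]
          prod_Pow_binary[of "\<lambda>z. digit_sign (Suc M) (z + 1)" M]
          prod_digit_sign_telescope[of M] by simp
      finally show ?thesis .
    qed
    have T0: "T 0 + T (2 ^ e) = 0"
    proof -
      have c: "corr \<Omega> l (\<lambda>\<omega>. (\<Sum>i\<in>\<omega>. \<tau> i div 2 ^ k) + car 0 \<omega>)
          = corr \<Omega> l (\<lambda>\<omega>. (\<Sum>i\<in>\<omega>. \<tau> i div 2 ^ k) + car (2 ^ e) \<omega>)"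
        unfolding corr_def using car[where c=0] car[where c=1]
        by (intro sum.cong prod.cong refl) simp
      have "sg (2 ^ e) * sg (2 ^ e) = 1" unfolding sg_def prod.distrib[symmetric] by simp
      then have "sg 0 = (sg 0 * sg (2 ^ e)) * sg (2 ^ e)" by (simp only: mult.assoc mult_1_right)
      then have "sg 0 = - sg (2 ^ e)" unfolding sgs by simp
      then show ?thesis by (simp add: T_def c)
    qed
    have ek: "(2::int) ^ e < 2 ^ k" unfolding k_def by (rule power_strict_increasing) simp_all
    \<comment> \<open>The two cancelling terms are removed; the others are bounded trivially.\<close>
    have "(\<Sum>u\<in>{0..<2 ^ k}. T u) = (\<Sum>u\<in>{0..<2 ^ k} - {0, 2 ^ e}. T u) + (\<Sum>u\<in>{0, 2 ^ e}. T u)"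
      by (rule sum.subset_diff) (use ek in auto)
    also have "(\<Sum>u\<in>{0, 2 ^ e}. T u) = 0" using T0 by simp
    finally have "\<bar>\<Sum>u\<in>{0..<2 ^ k}. T u\<bar> = \<bar>\<Sum>u\<in>{0..<2 ^ k} - {0, 2 ^ e}. T u\<bar>" by simp
    also have "\<dots> \<le> (\<Sum>u\<in>{0..<2 ^ k} - {0, 2 ^ e::int}. 2 ^ l * B)"
      by (rule order.trans[OF sum_abs]) (intro sum_mono Tle, auto)
    also have "\<dots> = real (card ({0..<2 ^ k} - {0, 2 ^ e::int})) * (2 ^ l * B)" by simp
    also have "card ({0..<2 ^ k} - {0, 2 ^ e::int}) = 2 ^ k - 2"
      using ek by (subst card_Diff_subset) (auto simp: nat_power_eq numeral_2_eq_2)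
    also have "real (2 ^ k - 2) = 2 ^ k - 2" by (simp add: k_def of_nat_diff)
    also have "(2 ^ k - 2) * (2 ^ l * B) = 2 ^ (k + l) * ((1 - 2 / 2 ^ k) * B)"
      by (simp add: power_add field_simps)
    finally show ?thesis by (simp add: eqT bf)
  qed
qed

primrec damping :: "nat \<Rightarrow> nat \<Rightarrow> nat \<Rightarrow> (nat \<Rightarrow> int) \<Rightarrow> real" where
  "damping M e 0 \<tau> = 1"
| "damping M e (Suc L) \<tau> = block_factor M e (\<lambda>i. \<tau> i mod 2 ^ (e + M + 1))
     * damping M e L (\<lambda>i. \<tau> i div 2 ^ (e + M + 1))"

lemma corr_le_damping:
  assumes "M < 2 ^ e" "\<And>\<omega>. \<omega> \<in> Pow {..<M} \<Longrightarrow> 0 \<le> \<delta> \<omega> \<and> \<delta> \<omega> \<le> int M"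
  shows "\<bar>corr (Pow {..<M}) ((e + M + 1) * L + l) (\<lambda>\<omega>. (\<Sum>i\<in>\<omega>. \<tau> i) + \<delta> \<omega>)\<bar>
     \<le> 2 ^ ((e + M + 1) * L + l) * damping M e L \<tau>"
  using assms(2)
proof (induction L arbitrary: \<tau> \<delta>)
  case 0
  then show ?case using abs_corr_le by simp
next
  case (Suc L)
  have "(e + M + 1) * Suc L + l = (e + M + 1) + ((e + M + 1) * L + l)" by simp
  then show ?case
    using corr_strip_block[OF assms(1), of "(e + M + 1) * L + l" \<tau> "damping M e L (\<lambda>i. \<tau> i div 2 ^ (e + M + 1))"
       \<delta>, OF Suc.IH Suc.prems] by (simp only: damping.simps)
qed

text \<open>
  The lowest \<open>j\<close> digits may be ignored: they contribute a sign and a carry, and \<open>corr_le_damping\<close> tolerates carries.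
  This is needed because the shifts that occur below are divisible by a power of two.
\<close>

lemma corr_drop_digits:
  assumes "M < 2 ^ e"
  shows "\<bar>corr (Pow {..<M}) (j + ((e + M + 1) * L + l)) (\<lambda>\<omega>. \<Sum>i\<in>\<omega>. \<tau> i)\<bar>
     \<le> 2 ^ (j + ((e + M + 1) * L + l)) * damping M e L (\<lambda>i. \<tau> i div 2 ^ j)"
proof -
  let ?l = "(e + M + 1) * L + l" and ?D = "damping M e L (\<lambda>i. \<tau> i div 2 ^ j)"
  have "\<bar>corr (Pow {..<M}) (j + ?l) (\<lambda>\<omega>. \<Sum>i\<in>\<omega>. \<tau> i)\<bar> \<le> (\<Sum>u\<in>{0..<2 ^ j::int}. 2 ^ ?l * ?D)"
    unfolding corr_add[of _ j ?l]
  proof (rule order.trans[OF sum_abs], rule sum_mono)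
    fix u :: int assume u: "u \<in> {0..<2 ^ j}"
    define car where "car \<omega> = (u + (\<Sum>i\<in>\<omega>. \<tau> i mod 2 ^ j)) div 2 ^ j" for \<omega>
    have card_le: "card \<omega> \<le> M" if "\<omega> \<in> Pow {..<M}" for \<omega>
      using that card_mono[of "{..<M}" \<omega>] by auto
    have carry: "(u + (\<Sum>i\<in>\<omega>. \<tau> i)) div 2 ^ j = (\<Sum>i\<in>\<omega>. \<tau> i div 2 ^ j) + car \<omega>"
      if "\<omega> \<in> Pow {..<M}" for \<omega>
      using sum_div_carry[of u \<tau> \<omega> 0 j] by (simp add: car_def)
    have "corr (Pow {..<M}) ?l (\<lambda>\<omega>. (u + (\<Sum>i\<in>\<omega>. \<tau> i)) div 2 ^ j)
       = corr (Pow {..<M}) ?l (\<lambda>\<omega>. (\<Sum>i\<in>\<omega>. \<tau> i div 2 ^ j) + car \<omega>)"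
      unfolding corr_def using carry
      by (intro sum.cong prod.cong refl arg_cong[where f="digit_sign ?l"]) simp
    then have "\<bar>(\<Prod>\<omega>\<in>Pow {..<M}. digit_sign j (u + (\<Sum>i\<in>\<omega>. \<tau> i)))
        * corr (Pow {..<M}) ?l (\<lambda>\<omega>. (u + (\<Sum>i\<in>\<omega>. \<tau> i)) div 2 ^ j)\<bar>
       = \<bar>corr (Pow {..<M}) ?l (\<lambda>\<omega>. (\<Sum>i\<in>\<omega>. \<tau> i div 2 ^ j) + car \<omega>)\<bar>"
      by (simp only: abs_mult abs_prod_digit_sign mult_1_left)
    also have "\<dots> \<le> 2 ^ ?l * ?D"
    proof (rule corr_le_damping[OF assms])
      fix \<omega> assume \<omega>: "\<omega> \<in> Pow {..<M}"
      define s where "s = (\<Sum>i\<in>\<omega>. \<tau> i mod 2 ^ j)"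
      have s0: "0 \<le> s" unfolding s_def by (intro sum_nonneg) auto
      have "s \<le> (\<Sum>i\<in>\<omega>. 2 ^ j - 1)" unfolding s_def
        by (intro sum_mono) (use pos_mod_bound[of "2^j::int"] in force)
      also have "\<dots> = int (card \<omega>) * (2 ^ j - 1)" by simp
      also have "\<dots> \<le> int M * (2 ^ j - 1)" using card_le[OF \<omega>] by (intro mult_right_mono) auto
      finally have "u + s < (int M + 1) * 2 ^ j" using u by (auto simp: algebra_simps)
      then have "(u + s) div 2 ^ j < int M + 1" 
        by (intro int_div_less) auto
      moreover have "0 \<le> (u + s) div 2 ^ j" using u s0 by (simp add: pos_imp_zdiv_nonneg_iff)
      ultimately show "0 \<le> car \<omega> \<and> car \<omega> \<le> int M" by (simp add: car_def s_def)
    qed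
    finally show "\<bar>(\<Prod>\<omega>\<in>Pow {..<M}. digit_sign j (u + (\<Sum>i\<in>\<omega>. \<tau> i)))
        * corr (Pow {..<M}) ?l (\<lambda>\<omega>. (u + (\<Sum>i\<in>\<omega>. \<tau> i)) div 2 ^ j)\<bar> \<le> 2 ^ ?l * ?D" .
  qed
  then show ?thesis by (simp add: power_add mult.assoc)
qed

section \<open>Averaging over the shifts\<close>

text \<open>
  The mean of \<open>\<Phi>\<close> when the coordinates below \<open>n\<close> are independent and uniform in \<open>{0..<R}\<close> and the others are kept.
  The recursion on \<open>n\<close> mirrors the successive applications of van der Corput's inequality.
\<close>

primrec cube_avg :: "nat \<Rightarrow> nat \<Rightarrow> ((nat \<Rightarrow> int) \<Rightarrow> real) \<Rightarrow> (nat \<Rightarrow> int) \<Rightarrow> real" where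
  "cube_avg R 0 \<Phi> \<tau> = \<Phi> \<tau>"
| "cube_avg R (Suc n) \<Phi> \<tau> = (\<Sum>v\<in>{0..<int R}. cube_avg R n \<Phi> (\<tau>(n := v))) / real R"

text \<open>
  Low and high digits of a uniformly distributed number are independent.
\<close>

lemma cube_avg_mult:
  assumes "A > 0" "B > 0"
  shows "cube_avg (A * B) n (\<lambda>\<tau>. \<Phi> (\<lambda>i. \<tau> i mod int A) * \<Psi> (\<lambda>i. \<tau> i div int A)) \<tau>
     = cube_avg A n \<Phi> (\<lambda>i. \<tau> i mod int A) * cube_avg B n \<Psi> (\<lambda>i. \<tau> i div int A)"
proof (induction n arbitrary: \<tau>)
  case (Suc n)
  have upd: "(\<lambda>i. (\<tau>(n := u + int A * v)) i mod int A) = (\<lambda>i. \<tau> i mod int A)(n := u)"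
      "(\<lambda>i. (\<tau>(n := u + int A * v)) i div int A) = (\<lambda>i. \<tau> i div int A)(n := v)"
    if "u \<in> {0..<int A}" for u v
    using that by (auto simp: fun_eq_iff)
  have "cube_avg (A * B) (Suc n) (\<lambda>\<tau>. \<Phi> (\<lambda>i. \<tau> i mod int A) * \<Psi> (\<lambda>i. \<tau> i div int A)) \<tau>
      = (\<Sum>x\<in>{0..<int A * int B}. cube_avg A n \<Phi> (\<lambda>i. (\<tau>(n := x)) i mod int A)
          * cube_avg B n \<Psi> (\<lambda>i. (\<tau>(n := x)) i div int A)) / (real A * real B)"
    by (simp only: cube_avg.simps Suc of_nat_mult)
  also have "(\<Sum>x\<in>{0..<int A * int B}. cube_avg A n \<Phi> (\<lambda>i. (\<tau>(n := x)) i mod int A)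
          * cube_avg B n \<Psi> (\<lambda>i. (\<tau>(n := x)) i div int A))
      = (\<Sum>u\<in>{0..<int A}. \<Sum>v\<in>{0..<int B}. cube_avg A n \<Phi> ((\<lambda>i. \<tau> i mod int A)(n := u))
          * cube_avg B n \<Psi> ((\<lambda>i. \<tau> i div int A)(n := v)))"
    using assms by (subst sum_split_digits) (auto intro!: sum.cong simp only: upd of_nat_0_less_iff)
  finally show ?case by (simp add: sum_product)
qed simp

lemma cube_avg_block_factor:
  assumes "n \<le> M" "k = e + M + 1"
  shows "cube_avg (2 ^ k) n (block_factor M e) \<tau>
    = 1 - (if \<forall>i\<in>{n..<M}. \<tau> i = 2 ^ (e + i) then 2 / 2 ^ k / (2 ^ k) ^ n else 0)"
  using assms(1)
proof (induction n arbitrary: \<tau>)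
  case 0
  show ?case by (auto simp: block_factor_def assms(2))
next
  case (Suc n)
  let ?c = "2 / 2 ^ k / (2 ^ k) ^ n :: real"
  let ?P = "\<forall>i\<in>{Suc n..<M}. \<tau> i = 2 ^ (e + i)"
  have mem: "(2::int) ^ (e + n) \<in> {0..<2 ^ k}"
  proof -
    have "(2::int) ^ (e + n) < 2 ^ k" using Suc.prems unfolding assms(2)
      by (intro power_strict_increasing) auto
    then show ?thesis by simp
  qed
  have set: "{n..<M} = insert n {Suc n..<M}" using Suc.prems by auto
  have "cube_avg (2 ^ k) (Suc n) (block_factor M e) \<tau>
     = (\<Sum>v\<in>{0..<2 ^ k::int}. 1 - (if \<forall>i\<in>{n..<M}. (\<tau>(n := v)) i = 2 ^ (e + i) then ?c else 0)) / 2 ^ k"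
    using Suc by simp
  also have "\<dots> = (\<Sum>v\<in>{0..<2 ^ k::int}. 1 - (if v = 2 ^ (e + n) then if ?P then ?c else 0 else 0)) / 2 ^ k"
    unfolding set by (intro arg_cong2[where f="(/)"] sum.cong refl) auto
  also have "\<dots> = (2 ^ k - (if ?P then ?c else 0)) / 2 ^ k"
    using mem by (simp add: sum_subtractf)
  also have "\<dots> = 1 - (if ?P then 2 / 2 ^ k / (2 ^ k) ^ Suc n else 0)"
    by (simp add: field_simps)
  finally show ?case .
qed

text \<open>
  The \<open>L\<close> digit blocks are independent, and each of them shows the favourable pattern in all \<open>M\<close> directions at once
  with probability \<open>2 ^ (- k M)\<close>. So the gain is exponential in \<open>L\<close>.
\<close>

lemma cube_avg_damping:
  assumes "k = e + M + 1"
  shows "cube_avg (2 ^ (k * L)) M (damping M e L) \<tau> = (1 - 2 / 2 ^ k / (2 ^ k) ^ M) ^ L"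
proof (induction L arbitrary: \<tau>)
  case 0
  have "cube_avg 1 n (damping M e 0) \<tau> = 1" for n by (induction n arbitrary: \<tau>) simp_all
  then show ?case by (simp del: damping.simps)
next
  case (Suc L)
  have D: "damping M e (Suc L) = (\<lambda>\<tau>. block_factor M e (\<lambda>i. \<tau> i mod int (2 ^ k))
        * damping M e L (\<lambda>i. \<tau> i div int (2 ^ k)))" by (simp add: fun_eq_iff assms)
  have P: "2 ^ (k * Suc L) = (2 ^ k * 2 ^ (k * L) :: nat)" by (simp add: power_add)
  have "cube_avg (2 ^ (k * Suc L)) M (damping M e (Suc L)) \<tau>
     = cube_avg (2 ^ k * 2 ^ (k * L)) M (\<lambda>\<tau>. block_factor M e (\<lambda>i. \<tau> i mod int (2 ^ k))
        * damping M e L (\<lambda>i. \<tau> i div int (2 ^ k))) \<tau>"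
    unfolding D P ..
  also have "\<dots> = cube_avg (2 ^ k) M (block_factor M e) (\<lambda>i. \<tau> i mod int (2 ^ k))
     * cube_avg (2 ^ (k * L)) M (damping M e L) (\<lambda>i. \<tau> i div int (2 ^ k))"
    by (rule cube_avg_mult) auto
  finally show ?case using cube_avg_block_factor[OF order.refl assms, of "\<lambda>i. \<tau> i mod int (2 ^ k)"] Suc
    by (simp del: damping.simps)
qed

lemma damping_mod:
  assumes "k = e + M + 1"
  shows "damping M e L (\<lambda>i. \<tau> i mod 2 ^ (k * L)) = damping M e L \<tau>"
proof (induction L arbitrary: \<tau>)
  case (Suc L)
  have m: "(\<lambda>i. \<tau> i mod 2 ^ (k * Suc L) mod 2 ^ k) = (\<lambda>i. \<tau> i mod 2 ^ k)"
    by (auto simp: fun_eq_iff power_add zmod_zmult2_eq)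
  have d: "(\<lambda>i. \<tau> i mod 2 ^ (k * Suc L) div 2 ^ k) = (\<lambda>i. \<tau> i div 2 ^ k mod 2 ^ (k * L))"
    by (auto simp: fun_eq_iff power_add zmod_zmult2_eq)
  show ?case using m d Suc[of "\<lambda>i. \<tau> i div 2 ^ k"] by (simp add: assms)
qed simp

section \<open>Removing digits by van der Corput's inequality\<close>

lemma sum_shift_diff:
  fixes g :: "nat \<Rightarrow> real"
  assumes "\<And>x. \<bar>g x\<bar> \<le> 1"
  shows "\<bar>(\<Sum>x<N. g (x + h)) - (\<Sum>x<N. g x)\<bar> \<le> 2 * real h"
proof -
  have "(\<Sum>x<N. g (x + h)) = (\<Sum>x\<in>{h..<N + h}. g x)"
    using sum.shift_bounds_nat_ivl[of g 0 h N] by (simp add: lessThan_atLeast0)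
  moreover have "(\<Sum>x\<in>{h..<N + h}. g x) + (\<Sum>x<h. g x) = (\<Sum>x<N + h. g x)"
    by (simp add: lessThan_atLeast0 add.commute[of _ "sum g {0..<h}"] sum.atLeastLessThan_concat)
  moreover have "(\<Sum>x<N. g x) + (\<Sum>x\<in>{N..<N + h}. g x) = (\<Sum>x<N + h. g x)"
    by (simp add: lessThan_atLeast0 sum.atLeastLessThan_concat)
  moreover have "\<bar>\<Sum>x<h. g x\<bar> \<le> real h"
    using order.trans[OF sum_abs sum_mono[of "{..<h}" "\<lambda>x. \<bar>g x\<bar>" "\<lambda>_. 1"]] assms by simp
  moreover have "\<bar>\<Sum>x\<in>{N..<N + h}. g x\<bar> \<le> real h"
    using order.trans[OF sum_abs sum_mono[of "{N..<N+h}" "\<lambda>x. \<bar>g x\<bar>" "\<lambda>_. 1"]] assms by simp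
  ultimately show ?thesis by linarith
qed

text \<open>
  Van der Corput's inequality with shifts by multiples of \<open>K\<close>, written as a double average over the two shifts. Averaging
  the sum over \<open>R\<close> shifts changes it by a boundary term only, and the Cauchy--Schwarz inequality does the rest.
\<close>

lemma van_der_corput:
  fixes g :: "nat \<Rightarrow> real"
  assumes g: "\<And>x. \<bar>g x\<bar> \<le> 1" and "N > 0" "R > 0"
  shows "(\<bar>\<Sum>x<N. g x\<bar> / N)\<^sup>2
    \<le> (\<Sum>r<R. \<Sum>r'<R. \<bar>\<Sum>x<N. g (x + r * K) * g (x + r' * K)\<bar> / N) / R\<^sup>2 + 4 * R * K / N"
proof -
  define S where "S = \<bar>\<Sum>x<N. g x\<bar> / N"
  define T where "T = (\<Sum>x<N. \<bar>\<Sum>r<R. g (x + r * K)\<bar>) / (N * R)"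
  have S1: "S \<le> 1" "0 \<le> S"
    using order.trans[OF sum_abs sum_mono[of "{..<N}" "\<lambda>x. \<bar>g x\<bar>" "\<lambda>_. 1"]] g assms(2)
    by (auto simp: S_def field_simps)
  have inner: "\<bar>\<Sum>r<R. g (x + r * K)\<bar> \<le> R" for x
    using order.trans[OF sum_abs sum_mono[of "{..<R}" "\<lambda>r. \<bar>g (x + r * K)\<bar>" "\<lambda>_. 1"]] g by simp
  have T1: "T \<le> 1" "0 \<le> T"
    using sum_mono[of "{..<N}" "\<lambda>x. \<bar>\<Sum>r<R. g (x + r * K)\<bar>" "\<lambda>_. real R"] inner assms(2,3)
    by (auto simp: T_def field_simps intro!: divide_nonneg_nonneg sum_nonneg)
  have "\<bar>R * (\<Sum>x<N. g x) - (\<Sum>x<N. \<Sum>r<R. g (x + r * K))\<bar>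
     = \<bar>\<Sum>r<R. (\<Sum>x<N. g x) - (\<Sum>x<N. g (x + r * K))\<bar>"
    by (subst sum.swap) (simp add: sum_subtractf)
  also have "\<dots> \<le> (\<Sum>r<R. 2 * (real R * real K))"
  proof (rule order.trans[OF sum_abs], rule sum_mono)
    fix r assume "r \<in> {..<R}"
    then have "real r * real K \<le> real R * real K" by (intro mult_right_mono) auto
    then show "\<bar>(\<Sum>x<N. g x) - (\<Sum>x<N. g (x + r * K))\<bar> \<le> 2 * (real R * real K)"
      using sum_shift_diff[where g=g and N=N and h="r * K"] g by (simp add: abs_minus_commute)
  qed
  finally have "R * \<bar>\<Sum>x<N. g x\<bar> \<le> \<bar>\<Sum>x<N. \<Sum>r<R. g (x + r * K)\<bar> + R * (2 * (real R * real K))"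
    by (simp add: abs_mult[symmetric])
  also have "\<bar>\<Sum>x<N. \<Sum>r<R. g (x + r * K)\<bar> \<le> (\<Sum>x<N. \<bar>\<Sum>r<R. g (x + r * K)\<bar>)" by (rule sum_abs)
  finally have ST: "S \<le> T + 2 * R * K / N" 
    using assms(2,3) by (simp add: S_def T_def field_simps)
  have "S\<^sup>2 \<le> T\<^sup>2 + 4 * R * K / N"
  proof (cases "S \<le> T")
    case True
    then have "S\<^sup>2 \<le> T\<^sup>2" using S1 by (intro power_mono) auto
    then show ?thesis by (smt (verit) divide_nonneg_nonneg mult_nonneg_nonneg of_nat_0_le_iff)
  next
    case False
    \<comment> \<open>Both means are at most one, so the boundary term enters the square with a factor two.\<close>
    have "S\<^sup>2 - T\<^sup>2 = (S + T) * (S - T)" by (simp add: power2_eq_square algebra_simps)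
    also have "\<dots> \<le> 2 * (2 * R * K / N)" using S1 T1 ST False by (intro mult_mono) auto
    finally show ?thesis by simp
  qed
  also have "T\<^sup>2 \<le> (\<Sum>r<R. \<Sum>r'<R. \<bar>\<Sum>x<N. g (x + r * K) * g (x + r' * K)\<bar> / N) / R\<^sup>2"
  proof -
    have "(\<Sum>x<N. \<bar>\<Sum>r<R. g (x + r * K)\<bar>)\<^sup>2 \<le> N * (\<Sum>x<N. (\<bar>\<Sum>r<R. g (x + r * K)\<bar>)\<^sup>2)"
      using Cauchy_Schwarz_ineq_sum[of "\<lambda>_. 1" "\<lambda>x. \<bar>\<Sum>r<R. g (x + r * K)\<bar>" "{..<N}"] by simp
    also have "(\<Sum>x<N. (\<bar>\<Sum>r<R. g (x + r * K)\<bar>)\<^sup>2)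
       = (\<Sum>x<N. \<Sum>r<R. \<Sum>r'<R. g (x + r * K) * g (x + r' * K))"
      by (simp add: power2_eq_square sum_product)
    also have "\<dots> = (\<Sum>r<R. \<Sum>r'<R. \<Sum>x<N. g (x + r * K) * g (x + r' * K))"
      by (subst sum.swap, rule sum.cong[OF refl], rule sum.swap)
    also have "\<dots> \<le> (\<Sum>r<R. \<Sum>r'<R. \<bar>\<Sum>x<N. g (x + r * K) * g (x + r' * K)\<bar>)"
      by (intro sum_mono) simp
    finally have "(\<Sum>x<N. \<bar>\<Sum>r<R. g (x + r * K)\<bar>)\<^sup>2
       \<le> N * (\<Sum>r<R. \<Sum>r'<R. \<bar>\<Sum>x<N. g (x + r * K) * g (x + r' * K)\<bar>)"
      by (simp add: mult_left_mono)
    then show ?thesis using assms(2,3)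
      by (simp add: T_def power_divide power_mult_distrib sum_divide_distrib[symmetric] field_simps power2_eq_square)
  qed
  finally show ?thesis by (simp add: S_def)
qed

text \<open>
  The residue of \<open>z\<close> of least absolute value lies in \<open>{-Y..<Y}\<close>. Outside this set, adding a number of
  size at most \<open>Y\<close> does not change the quotient by \<open>B\<close>.
\<close>

definition near_multiple :: "int \<Rightarrow> int \<Rightarrow> int \<Rightarrow> bool" where
  "near_multiple B Y z \<longleftrightarrow> z mod B < Y \<or> B - Y \<le> z mod B"

lemma div_add_not_near:
  assumes "\<not> near_multiple B Y z" "\<bar>\<delta>\<bar> \<le> Y" "B > 0"
  shows "(z + \<delta>) div B = z div B"
proof -
  have e: "z + \<delta> = (z mod B + \<delta>) + B * (z div B)" using mult_div_mod_eq[of B z] by linarith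
  have "Y \<le> z mod B" "z mod B < B - Y" using assms(1) unfolding near_multiple_def by linarith+
  then have "0 \<le> z mod B + \<delta>" "z mod B + \<delta> < B" using assms(2) by linarith+
  then have "(z mod B + \<delta>) div B = 0" by (rule div_pos_pos_trivial)
  then show ?thesis unfolding e using assms(3) by (subst div_mult_self2) auto
qed

text \<open>
  Small shifts do not reach the digits from position \<open>a\<close> on, unless \<open>z\<close> is close to a multiple of \<open>2 ^ a\<close>. In a
  product of two shifted signs these digits then occur twice and drop out.
\<close>

lemma digit_sign_pair:
  assumes "a \<le> b" "\<not> near_multiple (2 ^ a) Y z" "\<bar>\<delta>\<bar> \<le> Y" "\<bar>\<delta>'\<bar> \<le> Y"
  shows "digit_sign b (z + \<delta>) * digit_sign b (z + \<delta>') = digit_sign a (z + \<delta>) * digit_sign a (z + \<delta>')"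
proof -
  have b: "b = a + (b - a)" using assms(1) by simp
  let ?H = "digit_sign (b - a) (z div 2 ^ a)"
  have "digit_sign b (z + \<delta>) = digit_sign a (z + \<delta>) * ?H"
    "digit_sign b (z + \<delta>') = digit_sign a (z + \<delta>') * ?H"
    using div_add_not_near[OF assms(2,3)] div_add_not_near[OF assms(2,4)]
    by (subst b, simp add: digit_sign_add)+
  then have "digit_sign b (z + \<delta>) * digit_sign b (z + \<delta>')
     = digit_sign a (z + \<delta>) * digit_sign a (z + \<delta>') * (?H * ?H)" by (simp only: mult_ac)
  then show ?thesis by simp
qed

text \<open>
  An additive error can be carried through a power at the cost of the exponent, since \<open>a ^ p - X ^ p \<le> p (a - X)\<close> for
  \<open>0 \<le> X \<le> a \<le> 1\<close>.
\<close>

lemma power_le_add_mult: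
  fixes a X \<delta> :: real
  assumes "0 \<le> a" "a \<le> 1" "0 \<le> X" "X \<le> 1" "a \<le> X + \<delta>" "0 \<le> \<delta>"
  shows "a ^ p \<le> X ^ p + p * \<delta>"
proof (induction p)
  case (Suc p)
  show ?case
  proof (cases "a \<le> X")
    case True
    then have "a ^ Suc p \<le> X ^ Suc p" using assms by (intro power_mono) auto
    moreover have "0 \<le> real (Suc p) * \<delta>" using assms(6) by (intro mult_nonneg_nonneg) auto
    ultimately show ?thesis by linarith
  next
    case False
    have "a ^ Suc p - X ^ Suc p = a * (a ^ p - X ^ p) + X ^ p * (a - X)" by (simp add: algebra_simps)
    also have "a * (a ^ p - X ^ p) \<le> 1 * (p * \<delta>)"
    proof (rule order.trans)
      show "a * (a ^ p - X ^ p) \<le> a * (p * \<delta>)" using Suc assms(1) by (intro mult_left_mono) auto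
      show "a * (p * \<delta>) \<le> 1 * (p * \<delta>)" using assms by (intro mult_right_mono mult_nonneg_nonneg) auto
    qed
    also have "X ^ p * (a - X) \<le> 1 * \<delta>" using assms False by (intro mult_mono power_le_one) auto
    finally show ?thesis by (simp add: algebra_simps)
  qed
qed simp

lemma power_mean_le:
  fixes f :: "'a \<Rightarrow> real"
  assumes "finite I" "I \<noteq> {}" "\<And>i. i \<in> I \<Longrightarrow> 0 \<le> f i"
  shows "((\<Sum>i\<in>I. f i) / card I) ^ 2 ^ n \<le> (\<Sum>i\<in>I. f i ^ 2 ^ n) / card I"
proof (induction n)
  case (Suc n)
  have c: "card I > 0" using assms by (simp add: card_gt_0_iff)
  have "((\<Sum>i\<in>I. f i) / card I) ^ 2 ^ Suc n = (((\<Sum>i\<in>I. f i) / card I) ^ 2 ^ n)\<^sup>2"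
    by (simp add: power_mult[symmetric] mult.commute)
  also have "\<dots> \<le> ((\<Sum>i\<in>I. f i ^ 2 ^ n) / card I)\<^sup>2"
    by (intro power_mono Suc zero_le_power divide_nonneg_nonneg sum_nonneg assms(3)) auto
  also have "\<dots> \<le> (\<Sum>i\<in>I. (f i ^ 2 ^ n)\<^sup>2) / card I"
    using Cauchy_Schwarz_ineq_sum[of "\<lambda>_. 1" "\<lambda>i. f i ^ 2 ^ n" I] c
    by (simp add: power_divide field_simps power2_eq_square[of "real (card I)"])
  also have "(\<Sum>i\<in>I. (f i ^ 2 ^ n)\<^sup>2) = (\<Sum>i\<in>I. f i ^ 2 ^ Suc n)"
    by (simp add: power_mult[symmetric] mult.commute)
  finally show ?case .
qed simp

lemma bij_affine_mod:
  fixes u w :: int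
  assumes "coprime u (int R)" "R > 0"
  shows "bij_betw (\<lambda>x. (int x * u + w) mod int R) {..<R} {0..<int R}"
proof -
  have inj: "inj_on (\<lambda>x. (int x * u + w) mod int R) {..<R}"
  proof (rule inj_onI)
    fix x y assume xy: "x \<in> {..<R}" "y \<in> {..<R}" "(int x * u + w) mod int R = (int y * u + w) mod int R"
    then have "int R dvd (int x - int y) * u" by (simp add: mod_eq_dvd_iff algebra_simps)
    then have "int R dvd int x - int y" 
      using assms(1) by (simp add: coprime_dvd_mult_left_iff coprime_commute)
    then have "int x mod int R = int y mod int R" by (simp add: mod_eq_dvd_iff)
    then show "x = y" using xy by simp
  qed
  moreover have "(\<lambda>x. (int x * u + w) mod int R) ` {..<R} \<subseteq> {0..<int R}" using assms(2) by auto
  ultimately show ?thesis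
    by (simp add: bij_betw_def card_image card_subset_eq)
qed

text \<open>
  The correlation after \<open>M - n\<close> applications of van der Corput's inequality. The directions are numbered downwards, from
  \<open>M - 1\<close> to \<open>0\<close>, so that the \<open>n\<close> directions still to come are the coordinates below \<open>n\<close>, as in \<open>cube_avg\<close>. Only
  the lowest \<open>b\<close> digits are left.
\<close>

definition window_corr :: "nat \<Rightarrow> nat \<Rightarrow> nat \<Rightarrow> nat \<Rightarrow> nat \<Rightarrow> int \<Rightarrow> (nat \<Rightarrow> int) \<Rightarrow> real" where
  "window_corr N d M n b c \<tau> =
     \<bar>\<Sum>x<N. \<Prod>\<omega>\<in>Pow {n..<M}. digit_sign b (int x * int d + c + (\<Sum>i\<in>\<omega>. \<tau> i))\<bar> / real N"

lemma window_corr_bounds: "0 \<le> window_corr N d M n b c \<tau> \<and> window_corr N d M n b c \<tau> \<le> 1"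
proof -
  have "\<bar>\<Sum>x<N. \<Prod>\<omega>\<in>Pow {n..<M}. digit_sign b (int x * int d + c + (\<Sum>i\<in>\<omega>. \<tau> i))\<bar> \<le> (\<Sum>x<N. 1)"
    by (rule order.trans[OF sum_abs]) (simp only: abs_prod_digit_sign order.refl)
  then show ?thesis by (simp add: window_corr_def divide_le_eq)
qed

text \<open>
  The shift by \<open>K\<close> in the variable moves the argument by \<open>K d\<close>, which modulo \<open>2 ^ b'\<close> is the small number \<open>t\<close>.
  By \<open>digit_sign_pair\<close> the product of two shifted copies therefore sees the digits below \<open>b\<close> only, except for those \<open>x\<close>
  for which one of the at most \<open>2 ^ M\<close> arguments is near a multiple of \<open>2 ^ b\<close>. The two shifts \<open>r\<close> and \<open>r'\<close>
  amount to the new direction \<open>(r' - r) t\<close>.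
\<close>

lemma window_corr_shift_pair:
  fixes Y t c :: int and r r' K n M N d b b' :: nat and \<tau> :: "nat \<Rightarrow> int" and \<beta> :: real
  defines "g \<equiv> \<lambda>x. \<Prod>\<omega>\<in>Pow {Suc n..<M}. digit_sign b' (int x * int d + c + (\<Sum>i\<in>\<omega>. \<tau> i))"
  assumes "n < M" "N > 0" "b \<le> b'"
    and t: "(int K * int d) mod 2 ^ b' = t mod 2 ^ b'"
    and Y: "\<bar>int r * t\<bar> \<le> Y" "\<bar>int r' * t\<bar> \<le> Y"
    and near: "\<And>c. real (card {x\<in>{..<N}. near_multiple (2 ^ b) Y (int x * int d + c)}) \<le> \<beta> * N"
  shows "\<bar>\<Sum>x<N. g (x + r * K) * g (x + r' * K)\<bar> / N
     \<le> window_corr N d M n b (c + int r * t) (\<tau>(n := (int r' - int r) * t)) + 2 * 2 ^ M * \<beta>"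
proof -
  define z where "z \<omega> x = int x * int d + c + (\<Sum>i\<in>\<omega>. \<tau> i)" for \<omega> :: "nat set" and x :: nat
  \<comment> \<open>The points where a carry may reach beyond digit \<open>b\<close> for one of the subsets \<open>\<omega>\<close>.\<close>
  define Bad where "Bad = (\<Union>\<omega>\<in>Pow {Suc n..<M}. {x\<in>{..<N}. near_multiple (2 ^ b) Y (z \<omega> x)})"
  define h where "h x = (\<Prod>\<omega>\<in>Pow {n..<M}. digit_sign b (int x * int d + (c + int r * t)
      + (\<Sum>i\<in>\<omega>. (\<tau>(n := (int r' - int r) * t)) i)))" for x :: nat
  have shift: "digit_sign b' (int (x + q * K) * int d + c + s) = digit_sign b' (int x * int d + c + s + int q * t)"
    for x q s
  proof (rule digit_sign_cong)
    have "int (x + q * K) * int d + c + s = int x * int d + c + s + int q * (int K * int d)"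
      by (simp add: algebra_simps)
    also have "\<dots> mod 2 ^ b' = (int x * int d + c + s + int q * t) mod 2 ^ b'"
      using t by (metis mod_add_right_eq mod_mult_right_eq)
    finally show "(int (x + q * K) * int d + c + s) mod 2 ^ b'
        = (int x * int d + c + s + int q * t) mod 2 ^ b'" .
  qed
  have eq: "g (x + r * K) * g (x + r' * K) = h x" if x: "x \<in> {..<N} - Bad" for x
  proof -
    have set: "{n..<M} = insert n {Suc n..<M}" using \<open>n < M\<close> by auto
    have "g (x + r * K) * g (x + r' * K)
       = (\<Prod>\<omega>\<in>Pow {Suc n..<M}. digit_sign b' (z \<omega> x + int r * t) * digit_sign b' (z \<omega> x + int r' * t))"
      unfolding g_def shift z_def prod.distrib ..
    also have "\<dots> = (\<Prod>\<omega>\<in>Pow {Suc n..<M}. digit_sign b (z \<omega> x + int r * t) * digit_sign b (z \<omega> x + int r' * t))"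
      using x Y by (intro prod.cong refl digit_sign_pair[OF \<open>b \<le> b'\<close>]) (auto simp: Bad_def)
    also have "\<dots> = h x"
      unfolding h_def set
    proof (subst prod_Pow_insert, simp, simp, unfold prod.distrib, intro arg_cong2[where f="(*)"] prod.cong refl)
      fix \<omega> assume \<omega>: "\<omega> \<in> Pow {Suc n..<M}"
      then have n: "finite \<omega>" "n \<notin> \<omega>" by (auto intro: finite_subset)
      then have e: "(\<Sum>i\<in>\<omega>. (\<tau>(n := (int r' - int r) * t)) i) = (\<Sum>i\<in>\<omega>. \<tau> i)"
        by (intro sum.cong) auto
      show "digit_sign b (z \<omega> x + int r * t) = digit_sign b (int x * int d + (c + int r * t)
          + (\<Sum>i\<in>\<omega>. (\<tau>(n := (int r' - int r) * t)) i))"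
        unfolding e z_def by (simp add: algebra_simps)
      show "digit_sign b (z \<omega> x + int r' * t) = digit_sign b (int x * int d + (c + int r * t)
          + (\<Sum>i\<in>insert n \<omega>. (\<tau>(n := (int r' - int r) * t)) i))"
        unfolding sum.insert[OF n] e z_def by (simp add: algebra_simps)
    qed
    finally show ?thesis .
  qed
  have gh: "\<bar>g x\<bar> = 1" "\<bar>h x\<bar> = 1" for x unfolding g_def h_def by (rule abs_prod_digit_sign)+
  have "(\<Sum>x<N. \<bar>g (x + r * K) * g (x + r' * K) - h x\<bar>) = (\<Sum>x\<in>Bad. \<bar>g (x + r * K) * g (x + r' * K) - h x\<bar>)"
    by (rule sum.mono_neutral_right) (auto simp: eq Bad_def)
  also have "\<dots> \<le> (\<Sum>x\<in>Bad. 2)"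
  proof (rule sum_mono)
    fix x
    have "\<bar>g (x + r * K) * g (x + r' * K)\<bar> = 1" by (simp only: abs_mult gh mult_1_left)
    then show "\<bar>g (x + r * K) * g (x + r' * K) - h x\<bar> \<le> 2" using gh(2)[of x] by linarith
  qed
  also have "\<dots> = 2 * real (card Bad)" by simp
  also have "real (card Bad) \<le> (\<Sum>\<omega>\<in>Pow {Suc n..<M}. real (card {x\<in>{..<N}. near_multiple (2 ^ b) Y (z \<omega> x)}))"
    unfolding Bad_def of_nat_sum[symmetric] of_nat_le_iff by (rule card_UN_le) simp
  also have "\<dots> \<le> (\<Sum>\<omega>\<in>Pow {Suc n..<M}. \<beta> * N)"
    unfolding z_def add.assoc by (intro sum_mono near)
  also have "\<dots> = 2 ^ (M - Suc n) * (\<beta> * N)" by (simp add: card_Pow)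
  also have "\<dots> \<le> 2 ^ M * (\<beta> * N)"
  proof (intro mult_right_mono power_increasing)
    show "0 \<le> \<beta> * N" using near[of 0] by (meson of_nat_0_le_iff order.trans)
  qed auto
  finally have diff: "(\<Sum>x<N. \<bar>g (x + r * K) * g (x + r' * K) - h x\<bar>) \<le> 2 * (2 ^ M * (\<beta> * N))" by simp
  have "\<bar>\<Sum>x<N. g (x + r * K) * g (x + r' * K)\<bar>
      = \<bar>(\<Sum>x<N. h x) + (\<Sum>x<N. g (x + r * K) * g (x + r' * K) - h x)\<bar>" by (simp add: sum_subtractf)
  also have "\<dots> \<le> \<bar>\<Sum>x<N. h x\<bar> + (\<Sum>x<N. \<bar>g (x + r * K) * g (x + r' * K) - h x\<bar>)"
    by (rule order.trans[OF abs_triangle_ineq]) (intro add_mono order.refl sum_abs)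
  also have "\<dots> \<le> \<bar>\<Sum>x<N. h x\<bar> + 2 * (2 ^ M * (\<beta> * N))" using diff by simp
  finally have "\<bar>\<Sum>x<N. g (x + r * K) * g (x + r' * K)\<bar> / N \<le> (\<bar>\<Sum>x<N. h x\<bar> + 2 * (2 ^ M * (\<beta> * N))) / N"
    by (rule divide_right_mono) simp
  also have "\<dots> = \<bar>\<Sum>x<N. h x\<bar> / N + 2 * 2 ^ M * \<beta>" using \<open>N > 0\<close> by (simp add: field_simps)
  finally show ?thesis by (simp only: window_corr_def h_def)
qed

text \<open>
  Induction over the directions. Each van der Corput step squares the correlation, removes the digits between
  \<open>b n\<close> and \<open>b (n + 1)\<close>, and opens a new direction \<open>(r' - r) t n\<close>. As \<open>t n\<close> is \<open>2 ^ j\<close> times an odd number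
  and \<open>R\<close> is a power of two, the quotients of these directions by \<open>2 ^ j\<close> run uniformly through the residues modulo
  \<open>R\<close>. That the directions depend on \<open>d\<close> is thus of no consequence for the average.
\<close>

lemma window_corr_iterate:
  fixes b K :: "nat \<Rightarrow> nat" and t Y :: "nat \<Rightarrow> int" and N d M \<rho> j :: nat
    and \<Phi> :: "(nat \<Rightarrow> int) \<Rightarrow> real" and \<alpha> \<beta> :: real
  defines "R \<equiv> 2 ^ \<rho>" and "err \<equiv> 4 * \<alpha> + 2 * 2 ^ M * \<beta>"
  assumes "N > 0"
    and b: "\<And>n. n < M \<Longrightarrow> b n \<le> b (Suc n)"
    and K: "\<And>n. n < M \<Longrightarrow> real R * real (K n) \<le> \<alpha> * N"
    and t: "\<And>n. n < M \<Longrightarrow> (int (K n) * int d) mod 2 ^ b (Suc n) = t n mod 2 ^ b (Suc n)"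
    and odd: "\<And>n. n < M \<Longrightarrow> \<exists>u. odd u \<and> t n = 2 ^ j * u"
    and Y: "\<And>n. n < M \<Longrightarrow> int R * \<bar>t n\<bar> \<le> Y n"
    and near: "\<And>n c. n < M \<Longrightarrow>
      real (card {x\<in>{..<N}. near_multiple (2 ^ b n) (Y n) (int x * int d + c)}) \<le> \<beta> * N"
    and base: "\<And>c \<tau>. window_corr N d M 0 (b 0) c \<tau> \<le> \<Phi> (\<lambda>i. \<tau> i div 2 ^ j mod int R)"
  shows "n \<le> M \<Longrightarrow> window_corr N d M n (b n) c \<tau> ^ 2 ^ n
     \<le> cube_avg R n \<Phi> (\<lambda>i. \<tau> i div 2 ^ j mod int R) + (2 ^ n - 1) * err"
proof (induction n arbitrary: c \<tau>)
  case 0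
  then show ?case using base by simp
next
  case (Suc n)
  then have n: "n < M" by simp
  have R: "R > 0" by (simp add: R_def)
  have \<beta>: "0 \<le> \<beta>" using near[OF n, of 0] \<open>N > 0\<close>
    by (meson of_nat_0_le_iff of_nat_0_less_iff order.trans zero_le_mult_iff not_less)
  have \<alpha>: "0 \<le> \<alpha>" using K[OF n] \<open>N > 0\<close>
    by (metis mult_nonneg_nonneg of_nat_0_le_iff of_nat_0_less_iff order.trans zero_le_mult_iff not_less)
  have err: "0 \<le> err" using \<alpha> \<beta> by (simp add: err_def)
  obtain u where u: "odd u" "t n = 2 ^ j * u" using odd[OF n] by blast
  define g where "g x = (\<Prod>\<omega>\<in>Pow {Suc n..<M}. digit_sign (b (Suc n)) (int x * int d + c + (\<Sum>i\<in>\<omega>. \<tau> i)))"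
    for x :: nat
  define W where "W r r' = window_corr N d M n (b n) (c + int r * t n) (\<tau>(n := (int r' - int r) * t n))"
    for r r' :: nat
  define \<sigma> where "\<sigma> = (\<lambda>i. \<tau> i div 2 ^ j mod int R)"
  define X where "X = (\<Sum>r<R. \<Sum>r'<R. W r r') / (real R)\<^sup>2"
  have S: "window_corr N d M (Suc n) (b (Suc n)) c \<tau> = \<bar>\<Sum>x<N. g x\<bar> / N"
    by (simp only: window_corr_def g_def)
  have rt: "\<bar>int r * t n\<bar> \<le> Y n" if "r < R" for r
  proof -
    have "int r * \<bar>t n\<bar> \<le> int R * \<bar>t n\<bar>" using that by (intro mult_right_mono) auto
    then show ?thesis using Y[OF n] by (simp add: abs_mult)
  qed
  have Wb: "0 \<le> W r r'" "W r r' \<le> 1" for r r' using window_corr_bounds by (auto simp: W_def)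
  have "(\<Sum>r<R. \<Sum>r'<R. W r r') \<le> (\<Sum>r<R. \<Sum>r'<R. 1)" by (intro sum_mono Wb)
  then have X: "0 \<le> X" "X \<le> 1" using Wb R by (auto simp: X_def power2_eq_square intro!: divide_nonneg_nonneg sum_nonneg)
  have "(\<bar>\<Sum>x<N. g x\<bar> / N)\<^sup>2
      \<le> (\<Sum>r<R. \<Sum>r'<R. \<bar>\<Sum>x<N. g (x + r * K n) * g (x + r' * K n)\<bar> / N) / (real R)\<^sup>2 + 4 * real R * real (K n) / real N"
    using \<open>N > 0\<close> R by (intro van_der_corput) (simp_all add: g_def)
  also have "(\<Sum>r<R. \<Sum>r'<R. \<bar>\<Sum>x<N. g (x + r * K n) * g (x + r' * K n)\<bar> / N)
      \<le> (\<Sum>r<R. \<Sum>r'<R. W r r' + 2 * 2 ^ M * \<beta>)"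
    unfolding g_def W_def
    by (intro sum_mono window_corr_shift_pair[OF n \<open>N > 0\<close> b[OF n] t[OF n] rt rt near[OF n]]) auto
  also have "\<dots> = (\<Sum>r<R. \<Sum>r'<R. W r r') + (real R)\<^sup>2 * (2 * 2 ^ M * \<beta>)"
    by (simp add: sum.distrib power2_eq_square)
  also have "\<dots> / (real R)\<^sup>2 = X + 2 * 2 ^ M * \<beta>" using R by (simp add: X_def field_simps)
  also have "4 * real R * real (K n) / real N \<le> 4 * \<alpha>" using K[OF n] \<open>N > 0\<close> by (simp add: field_simps)
  finally have "(\<bar>\<Sum>x<N. g x\<bar> / N)\<^sup>2 \<le> X + err" using R by (simp add: err_def divide_right_mono)
  then have "((\<bar>\<Sum>x<N. g x\<bar> / N)\<^sup>2) ^ 2 ^ n \<le> X ^ 2 ^ n + real (2 ^ n) * err"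
    using window_corr_bounds[of N d M "Suc n" "b (Suc n)" c \<tau>] X err
    by (intro power_le_add_mult) (auto simp: S power_le_one)
  also have "X ^ 2 ^ n \<le> (\<Sum>r<R. \<Sum>r'<R. W r r' ^ 2 ^ n) / (real R)\<^sup>2"
  proof -
    have ne: "{..<R} \<times> {..<R} \<noteq> {}" using R by auto
    show ?thesis
    using power_mean_le[of "{..<R} \<times> {..<R}" "\<lambda>p. W (fst p) (snd p)" n] ne Wb
    by (simp add: X_def sum.cartesian_product' power2_eq_square)
  qed
  also have "(\<Sum>r<R. \<Sum>r'<R. W r r' ^ 2 ^ n)
     \<le> (\<Sum>r<R. real R * (cube_avg R (Suc n) \<Phi> \<sigma> + (2 ^ n - 1) * err))"
  proof (rule sum_mono)
    fix r
    \<comment> \<open>For fixed \<open>r\<close>, the new direction divided by \<open>2 ^ j\<close> is an affine function of \<open>r'\<close> with odd slope.\<close>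
    have upd: "(\<lambda>i. (\<tau>(n := (int r' - int r) * t n)) i div 2 ^ j mod int R)
       = \<sigma>(n := (int r' * u + (- int r * u)) mod int R)" for r'
    proof -
      have "(int r' - int r) * t n = 2 ^ j * (int r' * u + (- int r * u))"
        using u(2) by (simp add: algebra_simps)
      then have "(int r' - int r) * t n div 2 ^ j = int r' * u + (- int r * u)" by simp
      then show ?thesis by (auto simp: fun_eq_iff \<sigma>_def)
    qed
    have "(\<Sum>r'<R. W r r' ^ 2 ^ n)
       \<le> (\<Sum>r'<R. cube_avg R n \<Phi> (\<sigma>(n := (int r' * u + (- int r * u)) mod int R)) + (2 ^ n - 1) * err)"
      unfolding W_def upd[symmetric] by (intro sum_mono Suc.IH) (use n in simp)
    also have "\<dots> = (\<Sum>r'<R. cube_avg R n \<Phi> (\<sigma>(n := (int r' * u + (- int r * u)) mod int R)))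
        + R * ((2 ^ n - 1) * err)" by (simp add: sum.distrib)
    also have "(\<Sum>r'<R. cube_avg R n \<Phi> (\<sigma>(n := (int r' * u + (- int r * u)) mod int R)))
       = (\<Sum>v\<in>{0..<int R}. cube_avg R n \<Phi> (\<sigma>(n := v)))"
      using R u(1) by (intro sum.reindex_bij_betw bij_affine_mod) (auto simp: R_def coprime_right_2_iff_odd)
    also have "\<dots> = R * cube_avg R (Suc n) \<Phi> \<sigma>" using R by simp
    finally show "(\<Sum>r'<R. W r r' ^ 2 ^ n) \<le> real R * (cube_avg R (Suc n) \<Phi> \<sigma> + (2 ^ n - 1) * err)"
      by (simp only: distrib_left)
  qed
  also have "\<dots> = (real R)\<^sup>2 * (cube_avg R (Suc n) \<Phi> \<sigma> + (2 ^ n - 1) * err)"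
    by (simp add: power2_eq_square)
  also have "\<dots> / (real R)\<^sup>2 = cube_avg R (Suc n) \<Phi> \<sigma> + (2 ^ n - 1) * err" using R by simp
  finally have "((\<bar>\<Sum>x<N. g x\<bar> / N)\<^sup>2) ^ 2 ^ n \<le> cube_avg R (Suc n) \<Phi> \<sigma> + (2 ^ Suc n - 1) * err"
    using R by (simp add: divide_right_mono algebra_simps)
  moreover have "((\<bar>\<Sum>x<N. g x\<bar> / N)\<^sup>2) ^ 2 ^ n = (\<bar>\<Sum>x<N. g x\<bar> / N) ^ 2 ^ Suc n"
    by (simp only: power_mult[symmetric] power_Suc)
  ultimately show ?case by (simp only: S \<sigma>_def)
qed

section \<open>Visits to neighbourhoods of multiples\<close>

lemma card_multiples_interval:
  fixes l h B :: int
  assumes "B > 0" "l \<le> h"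
  shows "finite {m. l \<le> m * B \<and> m * B \<le> h}"
    and "real (card {m. l \<le> m * B \<and> m * B \<le> h}) \<le> real_of_int (h - l) / B + 1"
proof -
  have sub: "{m. l \<le> m * B \<and> m * B \<le> h} \<subseteq> {\<lceil>real_of_int l / B\<rceil>..\<lfloor>real_of_int h / B\<rfloor>}"
  proof
    fix m assume "m \<in> {m. l \<le> m * B \<and> m * B \<le> h}"
    then have "real_of_int l \<le> real_of_int m * B" "real_of_int m * B \<le> real_of_int h"
      by (simp_all flip: of_int_mult)
    then have "real_of_int l / B \<le> m" "m \<le> real_of_int h / B" using assms(1) by (simp_all add: field_simps)
    then show "m \<in> {\<lceil>real_of_int l / B\<rceil>..\<lfloor>real_of_int h / B\<rfloor>}" by (simp add: ceiling_le_iff le_floor_iff)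
  qed
  then show "finite {m. l \<le> m * B \<and> m * B \<le> h}" by (rule finite_subset) simp
  have "real (card {m. l \<le> m * B \<and> m * B \<le> h}) \<le> real (card {\<lceil>real_of_int l / B\<rceil>..\<lfloor>real_of_int h / B\<rfloor>})"
    using card_mono[OF _ sub] by simp
  also have "\<dots> = max 0 (real_of_int (\<lfloor>real_of_int h / B\<rfloor> - \<lceil>real_of_int l / B\<rceil> + 1))" by simp
  also have "\<dots> \<le> real_of_int (h - l) / B + 1"
  proof -
    have "real_of_int (\<lfloor>real_of_int h / B\<rfloor> - \<lceil>real_of_int l / B\<rceil> + 1) \<le> real_of_int (h - l) / B + 1"
      using of_int_floor_le[of "real_of_int h / B"] le_of_int_ceiling[of "real_of_int l / B"]
      unfolding of_int_diff of_int_add of_int_1 diff_divide_distrib by linarith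
    moreover have "0 \<le> real_of_int (h - l) / B" using assms by simp
    ultimately show ?thesis by (intro max.boundedI) simp_all
  qed
  finally show "real (card {m. l \<le> m * B \<and> m * B \<le> h}) \<le> real_of_int (h - l) / B + 1" .
qed

lemma near_multipleE:
  assumes "near_multiple B Y z" "B > 0"
  obtains m s where "z = m * B + s" "- Y \<le> s" "s < Y"
proof (cases "z mod B < Y")
  case True
  have "z = (z div B) * B + z mod B" by simp
  moreover have "0 \<le> z mod B" using assms(2) by simp
  ultimately show ?thesis using True that[of "z div B" "z mod B"] by linarith
next
  case False
  then have n: "B - Y \<le> z mod B" using assms(1) by (simp add: near_multiple_def)
  have l: "z mod B < B" "0 \<le> z mod B" using assms(2) by simp_all
  have e: "z = (z div B + 1) * B + (z mod B - B)" using div_mult_mod_eq[of z B] by (simp add: ring_distribs)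
  show ?thesis by (rule that[OF e]) (use n l False in linarith)+
qed

lemma near_multipleI:
  assumes "z = m * B + s" "- Y \<le> s" "s < Y" "B > 0" "2 * Y \<le> B"
  shows "near_multiple B Y z"
proof -
  have z: "z mod B = s mod B" using assms(1) by simp
  show ?thesis
  proof (cases "0 \<le> s")
    case True
    then have "s mod B = s" using assms by (intro mod_pos_pos_trivial) linarith+
    then show ?thesis using assms(3) z by (simp add: near_multiple_def)
  next
    case False
    have "s mod B = (s + B) mod B" by simp
    also have "\<dots> = s + B" using False assms by (intro mod_pos_pos_trivial) linarith+
    finally show ?thesis using assms(2) z by (simp add: near_multiple_def)
  qed
qed

text \<open>
  The points \<open>x K + c\<close> with \<open>x < X\<close> pass at most \<open>X K / B + 2\<close> multiples of \<open>B\<close>, and at most \<open>2 Y / K + 1\<close> of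
  them fit into the neighbourhood of one multiple. The bound is used both for fixed modulus \<open>d\<close> and variable \<open>x\<close>, and for
  fixed multiplier and variable \<open>d\<close>, in order to count exceptional moduli.
\<close>

lemma card_near_multiple_le:
  fixes K X :: nat and B Y c :: int
  assumes "K > 0" "B > 0" "0 \<le> Y" "2 * Y \<le> B"
  shows "real (card {x\<in>{..<X}. near_multiple B Y (int x * int K + c)})
     \<le> (real X * real K / real_of_int B + 2) * (2 * real_of_int Y / real K + 1)"
proof -
  define Ms where "Ms = {m. c - Y \<le> m * B \<and> m * B \<le> c + int X * int K + Y}"
  define Xs where "Xs m = {x. m * B - c - Y \<le> x * int K \<and> x * int K \<le> m * B - c + Y}" for m
  have Ms: "finite Ms" "real (card Ms) \<le> real X * real K / real_of_int B + 2"
  proof -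
    have le: "c - Y \<le> c + int X * int K + Y" using assms(3) by simp
    show "finite Ms" unfolding Ms_def by (rule card_multiples_interval(1)[OF assms(2) le])
    have "real (card Ms) \<le> real_of_int (c + int X * int K + Y - (c - Y)) / B + 1"
      unfolding Ms_def by (rule card_multiples_interval(2)[OF assms(2) le])
    also have "\<dots> = real X * real K / real_of_int B + (2 * Y) / B + 1" by (simp add: add_divide_distrib)
    also have "real_of_int (2 * Y) / B \<le> 1" using assms by (subst divide_le_eq_1_pos) (simp_all flip: of_int_mult)
    finally show "real (card Ms) \<le> real X * real K / real_of_int B + 2" by simp
  qed
  have Xs: "finite (Xs m)" "real (card (Xs m)) \<le> 2 * real_of_int Y / real K + 1" for m
    unfolding Xs_def using assms(1,3)
      card_multiples_interval[of "int K" "m * B - c - Y" "m * B - c + Y"] by simp_all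
  have "card {x\<in>{..<X}. near_multiple B Y (int x * int K + c)}
      = card (int ` {x\<in>{..<X}. near_multiple B Y (int x * int K + c)})"
    by (simp add: card_image)
  also have "\<dots> \<le> card (\<Union>m\<in>Ms. Xs m)"
  proof (rule card_mono)
    show "finite (\<Union>m\<in>Ms. Xs m)" using Ms Xs by simp
    show "int ` {x\<in>{..<X}. near_multiple B Y (int x * int K + c)} \<subseteq> (\<Union>m\<in>Ms. Xs m)"
    proof (rule image_subsetI)
      fix x assume x: "x \<in> {x\<in>{..<X}. near_multiple B Y (int x * int K + c)}"
      then obtain m s where ms: "int x * int K + c = m * B + s" "- Y \<le> s" "s < Y"
        using near_multipleE[OF _ assms(2)] by blast
      have "int x * int K \<le> int X * int K" using x by (intro mult_right_mono) auto
      moreover have "0 \<le> int x * int K" by simp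
      ultimately have "m \<in> Ms" "int x \<in> Xs m" using ms unfolding Ms_def Xs_def mem_Collect_eq by linarith+
      then show "int x \<in> (\<Union>m\<in>Ms. Xs m)" by blast
    qed
  qed
  also have "\<dots> \<le> (\<Sum>m\<in>Ms. card (Xs m))" by (rule card_UN_le[OF Ms(1)])
  finally have "real (card {x\<in>{..<X}. near_multiple B Y (int x * int K + c)}) \<le> (\<Sum>m\<in>Ms. real (card (Xs m)))"
    by (simp flip: of_nat_sum)
  also have "\<dots> \<le> (\<Sum>m\<in>Ms. 2 * real_of_int Y / real K + 1)" by (intro sum_mono Xs)
  also have "\<dots> = real (card Ms) * (2 * real_of_int Y / real K + 1)" by simp
  also have "\<dots> \<le> (real X * real K / real_of_int B + 2) * (2 * real_of_int Y / real K + 1)"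
    using Ms(2) assms(3) by (intro mult_right_mono) auto
  finally show ?thesis .
qed

lemma power2_diff_real: "n \<le> m \<Longrightarrow> (2::real) ^ (m - n) = 2 ^ m / 2 ^ n"
  by (simp add: power_diff)

text \<open>
  Dirichlet's approximation theorem for \<open>d / 2 ^ b\<close>, by the pigeonhole principle.
\<close>

lemma dirichlet_near_multiple:
  fixes d b \<kappa> :: nat
  assumes "1 \<le> \<kappa>" "\<kappa> \<le> b"
  obtains K m s where "K \<in> {1..2 ^ \<kappa>}" "int K * int d = m * 2 ^ b + s" "\<bar>s\<bar> < 2 ^ (b - \<kappa>)"
proof -
  define cell where "cell x = (int x * int d mod 2 ^ b) div 2 ^ (b - \<kappa>)" for x :: nat
  have split: "(2::int) ^ b = 2 ^ \<kappa> * 2 ^ (b - \<kappa>)" using assms(2) by (simp flip: power_add)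
  have "cell ` {..2 ^ \<kappa>} \<subseteq> {0..<2 ^ \<kappa>}"
  proof (rule image_subsetI)
    fix x
    have "int x * int d mod 2 ^ b < 2 ^ \<kappa> * 2 ^ (b - \<kappa>)" unfolding split[symmetric] by simp
    then have "cell x < 2 ^ \<kappa>" unfolding cell_def by (intro int_div_less) simp_all
    then show "cell x \<in> {0..<2 ^ \<kappa>}" by (simp add: cell_def pos_imp_zdiv_nonneg_iff)
  qed
  then have "card (cell ` {..2 ^ \<kappa>}) \<le> card {0..<2 ^ \<kappa>::int}" by (intro card_mono) auto
  also have "\<dots> < card {..2 ^ \<kappa>::nat}" by (simp add: nat_power_eq)
  finally have "\<not> inj_on cell {..2 ^ \<kappa>}" by (rule pigeonhole)
  then obtain x0 y0 where xy0: "x0 \<in> {..2 ^ \<kappa>}" "y0 \<in> {..2 ^ \<kappa>}" "x0 \<noteq> y0" "cell x0 = cell y0"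
    unfolding inj_on_def by blast
  have "\<exists>x y. x < y \<and> y \<le> 2 ^ \<kappa> \<and> cell x = cell y"
  proof (cases "x0 < y0")
    case True
    then show ?thesis using xy0 by (intro exI[of _ x0] exI[of _ y0]) simp
  next
    case False
    then show ?thesis using xy0 by (intro exI[of _ y0] exI[of _ x0]) simp
  qed
  then obtain x y where xy: "x < y" "y \<le> 2 ^ \<kappa>" "cell x = cell y" by blast
  let ?B = "2 ^ b :: int" and ?c = "2 ^ (b - \<kappa>) :: int"
  let ?rx = "int x * int d mod ?B" and ?ry = "int y * int d mod ?B"
  have "\<bar>?ry - ?rx\<bar> < ?c"
  proof -
    have "?rx = cell x * ?c + ?rx mod ?c" "?ry = cell y * ?c + ?ry mod ?c"
      unfolding cell_def by (rule div_mult_mod_eq[symmetric])+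
    moreover have "0 \<le> ?rx mod ?c" "?rx mod ?c < ?c" "0 \<le> ?ry mod ?c" "?ry mod ?c < ?c" by simp_all
    ultimately show ?thesis unfolding xy(3) by linarith
  qed
  moreover have "int (y - x) * int d = (int y * int d div ?B - int x * int d div ?B) * ?B + (?ry - ?rx)"
    using xy(1) div_mult_mod_eq[of "int y * int d" ?B] div_mult_mod_eq[of "int x * int d" ?B]
    by (simp add: of_nat_diff left_diff_distrib)
  moreover have "y - x \<in> {1..2 ^ \<kappa>}" using xy by auto
  ultimately show ?thesis using that by blast
qed

section \<open>Exceptional moduli\<close>

text \<open>
  Some moduli are truly exceptional: for \<open>d = 2 ^ l + 1\<close> and small \<open>n\<close>, the binary expansion of \<open>n d\<close> consists of two
  copies of that of \<open>n\<close>, so that \<open>s(n d)\<close> is always even. Dirichlet's theorem yields a multiplier \<open>K\<close> that brings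
  \<open>d\<close> close to a multiple of \<open>2 ^ b\<close>, but \<open>K d\<close> may be divisible by too high a power of two to give well distributed
  shifts. The set collects the moduli for which this can happen.
\<close>

definition resonant :: "nat \<Rightarrow> nat \<Rightarrow> nat \<Rightarrow> nat set" where
  "resonant \<Lambda> u b = {d\<in>{..<2 ^ \<Lambda>}. \<exists>K\<in>{1..2 ^ (7 * u)}.
      2 ^ (4 * u) dvd K \<and> near_multiple (2 ^ b) (2 ^ (b - 7 * u)) (int d * int K)}"

lemma card_resonant:
  assumes "u \<ge> 1" "14 * u \<le> b" "b \<le> \<Lambda> + 7 * u"
  shows "real (card (resonant \<Lambda> u b)) \<le> 9 * 2 ^ \<Lambda> / 2 ^ u"
proof -
  define D U B :: real where "D = 2 ^ \<Lambda>" and "U = 2 ^ u" and "B = 2 ^ b"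
  define Ks where "Ks = (\<lambda>q. 2 ^ (4 * u) * q) ` {1..2 ^ (3 * u) :: nat}"
  define S where "S K = {d\<in>{..<2 ^ \<Lambda>}. near_multiple (2 ^ b) (2 ^ (b - 7 * u)) (int d * int K + 0)}" for K
  have U1: "1 \<le> U" by (simp add: U_def)
  have DU: "U ^ 4 \<le> D" unfolding D_def U_def power_mult[symmetric]
    using assms by (intro power_increasing) auto
  have BU: "U ^ 11 \<le> B" unfolding B_def U_def power_mult[symmetric]
    using assms by (intro power_increasing) auto
  have BD: "B \<le> D * U ^ 7" unfolding B_def D_def U_def power_mult[symmetric] power_add[symmetric]
    using assms by (intro power_increasing) auto
  have Y: "real_of_int (2 ^ (b - 7 * u)) = B / U ^ 7" 
    unfolding B_def U_def power_mult[symmetric] of_int_power using assms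
    by (simp add: power2_diff_real mult.commute del: of_int_power)
  have sub: "resonant \<Lambda> u b \<subseteq> (\<Union>K\<in>Ks. S K)"
  proof
    fix d assume "d \<in> resonant \<Lambda> u b"
    then obtain K where K: "K \<in> {1..2 ^ (7 * u)}" "2 ^ (4 * u) dvd K" "d \<in> S K"
      unfolding resonant_def S_def by auto
    then obtain q where q: "K = 2 ^ (4 * u) * q" by (elim dvdE)
    have "(2::nat) ^ (7 * u) = 2 ^ (4 * u) * 2 ^ (3 * u)" by (simp flip: power_add)
    then have "q \<in> {1..2 ^ (3 * u)}" using K(1) q by auto
    then show "d \<in> (\<Union>K\<in>Ks. S K)" using K(3) q by (auto simp: Ks_def)
  qed
  have SK: "real (card (S K)) \<le> 9 * D / U ^ 4" if "K \<in> Ks" for K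
  proof -
    obtain q where q: "1 \<le> q" "q \<le> 2 ^ (3 * u)" "K = 2 ^ (4 * u) * q" using \<open>K \<in> Ks\<close> by (auto simp: Ks_def)
    have K0: "K > 0" using q by simp
    have Kl: "U ^ 4 \<le> real K"
    proof -
      have "2 ^ (4 * u) * 1 \<le> 2 ^ (4 * u) * q" using q(1) by (intro mult_left_mono) auto
      then have "real (2 ^ (4 * u)) \<le> real K" unfolding q(3) of_nat_le_iff by simp
      then show ?thesis by (simp add: U_def power_mult[symmetric] mult.commute)
    qed
    have Ku: "real K \<le> U ^ 7"
    proof -
      have "2 ^ (4 * u) * q \<le> 2 ^ (4 * u) * 2 ^ (3 * u)" using q(2) by (intro mult_left_mono) auto
      also have "\<dots> = 2 ^ (7 * u)" by (simp flip: power_add)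
      finally have "real K \<le> real (2 ^ (7 * u))" unfolding q(3) of_nat_le_iff .
      then show ?thesis by (simp add: U_def power_mult[symmetric] mult.commute)
    qed
    have Y2: "2 * 2 ^ (b - 7 * u) \<le> (2::int) ^ b"
    proof -
      have "(2::int) ^ Suc (b - 7 * u) \<le> 2 ^ b" using assms by (intro power_increasing) auto
      then show ?thesis by simp
    qed
    have "real (card (S K)) \<le> (real (2 ^ \<Lambda>) * real K / real_of_int (2 ^ b) + 2)
        * (2 * real_of_int (2 ^ (b - 7 * u)) / real K + 1)"
      unfolding S_def by (rule card_near_multiple_le[OF K0 _ _ Y2]) simp_all
    also have "\<dots> = (D * real K / B + 2) * (2 * (B / U ^ 7) / real K + 1)"
      unfolding Y by (simp add: D_def B_def)
    also have "\<dots> = 2 * D / U ^ 7 + D * (real K / B) + 4 * (B / U ^ 7) * (1 / real K) + 2"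
      using K0 U1 by (simp add: B_def field_simps)
    also have "\<dots> \<le> 2 * (D / U ^ 4) + D * (1 / U ^ 4) + 4 * D * (1 / U ^ 4) + 2 * (D / U ^ 4)"
    proof (intro add_mono)
      have "U ^ 4 \<le> U ^ 7" using U1 by (intro power_increasing) auto
      then have "D / U ^ 7 \<le> D / U ^ 4" using U1 by (intro divide_left_mono) (auto simp: D_def)
      then show "2 * D / U ^ 7 \<le> 2 * (D / U ^ 4)" by simp
      have "real K / B \<le> U ^ 7 / U ^ 11" using Ku BU U1 by (intro frac_le) auto
      also have "\<dots> = 1 / U ^ 4" using U1 by (simp add: field_simps flip: power_add)
      finally show "D * (real K / B) \<le> D * (1 / U ^ 4)" by (intro mult_left_mono) (auto simp: D_def)
      have "B / U ^ 7 \<le> D" using BD U1 by (simp add: divide_le_eq)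
      moreover have "1 / real K \<le> 1 / U ^ 4" using Kl U1 by (intro divide_left_mono mult_pos_pos) (auto simp: K0)
      ultimately show "4 * (B / U ^ 7) * (1 / real K) \<le> 4 * D * (1 / U ^ 4)"
        by (intro mult_mono) (auto simp: D_def B_def U_def)
      show "2 \<le> 2 * (D / U ^ 4)" using DU U1 by (simp add: le_divide_eq)
    qed
    also have "\<dots> = 9 * D / U ^ 4" by simp
    finally show ?thesis .
  qed
  have finK: "finite Ks" "card Ks \<le> 2 ^ (3 * u)"
    using card_image_le[of "{1..2 ^ (3 * u) :: nat}" "\<lambda>q. 2 ^ (4 * u) * q"] by (simp_all add: Ks_def)
  have "real (card (resonant \<Lambda> u b)) \<le> real (card (\<Union>K\<in>Ks. S K))"
    using card_mono[OF _ sub] finK by (simp add: S_def)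
  also have "\<dots> \<le> (\<Sum>K\<in>Ks. real (card (S K)))"
    unfolding of_nat_sum[symmetric] of_nat_le_iff by (rule card_UN_le[OF finK(1)])
  also have "\<dots> \<le> (\<Sum>K\<in>Ks. 9 * D / U ^ 4)" by (intro sum_mono SK)
  also have "\<dots> = real (card Ks) * (9 * D / U ^ 4)" by simp
  also have "\<dots> \<le> real (2 ^ (3 * u)) * (9 * D / U ^ 4)"
    using finK(2) U1 by (intro mult_right_mono) (simp_all add: D_def del: of_nat_power)
  also have "real (2 ^ (3 * u)) = U ^ 3" by (simp add: U_def power_mult[symmetric] mult.commute)
  also have "U ^ 3 * (9 * D / U ^ 4) = 9 * D / U" using U1 by (simp add: field_simps eval_nat_numeral)
  finally show ?thesis by (simp add: D_def U_def)
qed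

lemma sum_reciprocals_le: "(\<Sum>h\<in>{1..<2 ^ p :: nat}. 1 / real h) \<le> p"
proof (induction p)
  case (Suc p)
  have "{1..<2 ^ Suc p :: nat} = {1..<2 ^ p} \<union> {2 ^ p..<2 ^ Suc p}" by (auto simp: le_less_trans)
  moreover have "(\<Sum>h\<in>{2 ^ p..<2 ^ Suc p :: nat}. 1 / real h) \<le> (\<Sum>h\<in>{2 ^ p..<2 ^ Suc p :: nat}. 1 / 2 ^ p)"
  proof (rule sum_mono)
    fix h :: nat assume "h \<in> {2 ^ p..<2 ^ Suc p}"
    then have "real (2 ^ p) \<le> real h" unfolding of_nat_le_iff by simp
    moreover from this have "0 < real h" by (rule less_le_trans[rotated]) simp
    ultimately show "1 / real h \<le> 1 / 2 ^ p" by (intro divide_left_mono mult_pos_pos) simp_all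
  qed
  ultimately show ?case using Suc by (simp add: sum.union_disjoint ivl_disj_int)
qed simp

text \<open>
  The differences that two visits to the neighbourhood of radius \<open>2 ^ (a - u)\<close> of the multiples of \<open>2 ^ a\<close> can have;
  hence the doubled radius.
\<close>

definition near_returns :: "nat \<Rightarrow> nat \<Rightarrow> nat \<Rightarrow> nat set" where
  "near_returns u a d = {h\<in>{1..<2 ^ (7 * u)}. near_multiple (2 ^ a) (2 * 2 ^ (a - u)) (int d * int h)}"

text \<open>
  For the moduli outside this set the progression spends little time close to multiples of \<open>2 ^ a\<close>, wherever it starts
  (\<open>near_visits_long\<close>).
\<close>

definition clustering :: "nat \<Rightarrow> nat \<Rightarrow> nat \<Rightarrow> nat \<Rightarrow> nat set" where
  "clustering \<Lambda> u w a = {d\<in>{..<2 ^ \<Lambda>}. 2 ^ (7 * u - w) < card (near_returns u a d)}"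

text \<open>
  Averaging over \<open>d\<close> bounds the number of pairs \<open>(d, h)\<close> with \<open>d h\<close> near a multiple of \<open>2 ^ a\<close>, and Markov's
  inequality bounds the number of \<open>d\<close> for which there are many such \<open>h\<close>.
\<close>

lemma card_clustering:
  assumes "u = 2 * w" "w \<ge> 1" "13 * u \<le> a" "a \<le> \<Lambda> + 6 * u"
  shows "real (card (clustering \<Lambda> u w a)) \<le> 63 * 2 ^ \<Lambda> / 2 ^ w"
proof -
  define D U A W :: real where "D = 2 ^ \<Lambda>" and "U = 2 ^ u" and "A = 2 ^ a" and "W = 2 ^ w"
  have u2: "u \<ge> 2" using assms by simp
  have U1: "1 \<le> U" by (simp add: U_def)
  have W1: "1 \<le> W" by (simp add: W_def)
  have UW: "U = W * W" by (simp add: U_def W_def assms(1) mult_2 power_add)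
  have DU: "U \<le> D" unfolding D_def U_def using assms by (intro power_increasing) auto
  have AU: "U ^ 8 \<le> A" unfolding A_def U_def power_mult[symmetric]
    using assms by (intro power_increasing) auto
  have AD: "A \<le> D * U ^ 6" unfolding A_def D_def U_def power_mult[symmetric] power_add[symmetric]
    using assms by (intro power_increasing) auto
  have Y: "real_of_int (2 * 2 ^ (a - u)) = 2 * A / U" 
    unfolding A_def U_def of_int_power of_int_mult using assms
    by (simp add: power2_diff_real del: of_int_power)
  define S where "S h = {d\<in>{..<2 ^ \<Lambda>}. near_multiple (2 ^ a) (2 * 2 ^ (a - u)) (int d * int h + 0)}" for h
  have Sh: "real (card (S h)) \<le> 7 * D / U + 8 * D * U ^ 5 * (1 / real h)"
    if h: "h \<in> {1..<2 ^ (7 * u)}" for h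
  proof -
    have h0: "h > 0" using h by simp
    have hu: "real h \<le> U ^ 7"
    proof -
      have "real h \<le> real (2 ^ (7 * u))" using h unfolding of_nat_le_iff by simp
      then show ?thesis by (simp add: U_def power_mult[symmetric] mult.commute)
    qed
    have Y2: "2 * (2 * 2 ^ (a - u)) \<le> (2::int) ^ a"
    proof -
      have "(2::int) ^ (2 + (a - u)) \<le> 2 ^ a" using assms u2 by (intro power_increasing) auto
      then show ?thesis by (simp add: power_add)
    qed
    have "real (card (S h)) \<le> (real (2 ^ \<Lambda>) * real h / real_of_int (2 ^ a) + 2)
        * (2 * real_of_int (2 * 2 ^ (a - u)) / real h + 1)"
      unfolding S_def by (rule card_near_multiple_le[OF h0 _ _ Y2]) simp_all
    also have "\<dots> = (D * real h / A + 2) * (2 * (2 * A / U) / real h + 1)"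
      unfolding Y by (simp add: D_def A_def)
    also have "\<dots> = 4 * D / U + D * (real h / A) + 8 * (A / U) * (1 / real h) + 2"
      using h0 U1 by (simp add: A_def field_simps)
    also have "\<dots> \<le> 4 * D / U + D * (1 / U) + 8 * (D * U ^ 5) * (1 / real h) + 2 * (D / U)"
    proof (intro add_mono order.refl)
      have "real h / A \<le> U ^ 7 / U ^ 8" using hu AU U1 by (intro frac_le) auto
      also have "\<dots> = 1 / U" using U1 by (simp add: field_simps eval_nat_numeral)
      finally show "D * (real h / A) \<le> D * (1 / U)" by (intro mult_left_mono) (auto simp: D_def)
      have "A / U \<le> D * U ^ 6 / U" using AD U1 by (intro divide_right_mono) auto
      also have "\<dots> = D * U ^ 5" using U1 by (simp add: field_simps eval_nat_numeral)
      finally show "8 * (A / U) * (1 / real h) \<le> 8 * (D * U ^ 5) * (1 / real h)"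
        by (intro mult_right_mono mult_left_mono) auto
      show "2 \<le> 2 * (D / U)" using DU U1 by (simp add: le_divide_eq)
    qed
    also have "\<dots> = 7 * D / U + 8 * D * U ^ 5 * (1 / real h)" by simp
    finally show ?thesis .
  qed
  have "real (card (clustering \<Lambda> u w a)) * (U ^ 7 / W) = (\<Sum>d\<in>clustering \<Lambda> u w a. U ^ 7 / W)" by simp
  also have "\<dots> \<le> (\<Sum>d\<in>clustering \<Lambda> u w a. real (card (near_returns u a d)))"
  proof (rule sum_mono)
    fix d assume "d \<in> clustering \<Lambda> u w a"
    then have "real (2 ^ (7 * u - w)) \<le> real (card (near_returns u a d))"
      unfolding of_nat_le_iff by (simp add: clustering_def)
    moreover have "real (2 ^ (7 * u - w)) = U ^ 7 / W"
    proof -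
      have "w \<le> 7 * u" using assms by simp
      then have "real (2 ^ (7 * u - w)) = 2 ^ (7 * u) / 2 ^ w"
        by (simp only: of_nat_power of_nat_numeral power2_diff_real)
      then show ?thesis by (simp add: U_def W_def power_mult[symmetric] mult.commute)
    qed
    ultimately show "U ^ 7 / W \<le> real (card (near_returns u a d))" by metis
  qed
  also have "\<dots> \<le> (\<Sum>d<2 ^ \<Lambda>. real (card (near_returns u a d)))"
    by (rule sum_mono2) (auto simp: clustering_def)
  also have "\<dots> = (\<Sum>d<2 ^ \<Lambda>. \<Sum>h\<in>{1..<2 ^ (7 * u)}. if near_multiple (2 ^ a) (2 * 2 ^ (a - u)) (int d * int h) then 1 else 0)"
    by (simp add: near_returns_def sum.If_cases Int_def)
  also have "\<dots> = (\<Sum>h\<in>{1..<2 ^ (7 * u)}. \<Sum>d<2 ^ \<Lambda>. if near_multiple (2 ^ a) (2 * 2 ^ (a - u)) (int d * int h) then 1 else 0)"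
    by (rule sum.swap)
  also have "\<dots> = (\<Sum>h\<in>{1..<2 ^ (7 * u)}. real (card (S h)))"
    by (simp add: S_def sum.If_cases Int_def)
  also have "\<dots> \<le> (\<Sum>h\<in>{1..<2 ^ (7 * u)}. 7 * D / U + 8 * D * U ^ 5 * (1 / real h))"
    by (intro sum_mono Sh)
  also have "\<dots> = real (card {1..<2 ^ (7 * u) :: nat}) * (7 * D / U)
      + 8 * D * U ^ 5 * (\<Sum>h\<in>{1..<2 ^ (7 * u) :: nat}. 1 / real h)"
    by (simp only: sum.distrib sum_constant sum_distrib_left)
  also have "\<dots> \<le> U ^ 7 * (7 * D / U) + 8 * D * U ^ 5 * (7 * U)"
  proof (intro add_mono mult_right_mono mult_left_mono)
    have "real (card {1..<2 ^ (7 * u) :: nat}) \<le> real (2 ^ (7 * u))" unfolding of_nat_le_iff by simp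
    then show "real (card {1..<2 ^ (7 * u) :: nat}) \<le> U ^ 7"
      by (simp add: U_def power_mult[symmetric] mult.commute)
    have "real u \<le> U" unfolding U_def using less_exp[of u] by (metis less_imp_le of_nat_le_iff of_nat_numeral of_nat_power)
    then show "(\<Sum>h\<in>{1..<2 ^ (7 * u) :: nat}. 1 / real h) \<le> 7 * U"
      using sum_reciprocals_le[of "7 * u"] by simp
  qed (use U1 in \<open>auto simp: D_def\<close>)
  also have "\<dots> = 63 * D * U ^ 6" using U1 by (simp add: field_simps eval_nat_numeral)
  finally have "real (card (clustering \<Lambda> u w a)) \<le> 63 * D * U ^ 6 / (U ^ 7 / W)"
    using U1 W1 by (subst pos_le_divide_eq) auto
  also have "\<dots> = 63 * D / W" using U1 W1 UW by (simp add: field_simps eval_nat_numeral)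
  finally show ?thesis by (simp add: D_def W_def)
qed

text \<open>
  Measured from the first visit, all visits are at distances from \<open>near_returns\<close>. These do not depend on the offset \<open>c\<close>,
  which makes the bound uniform in the residue class.
\<close>

lemma near_visits_short:
  assumes "u \<ge> 2" "u \<le> a"
  shows "card {x\<in>{..<2 ^ (7 * u)}. near_multiple (2 ^ a) (2 ^ (a - u)) (int x * int d + c)}
     \<le> 1 + card (near_returns u a d)"
proof -
  define Z where "Z = {x\<in>{..<2 ^ (7 * u) :: nat}. near_multiple (2 ^ a) (2 ^ (a - u)) (int x * int d + c)}"
  have fin: "finite Z" by (simp add: Z_def)
  show ?thesis
  proof (cases "Z = {}")
    case True
    then have "card Z = 0" by simp
    then show ?thesis unfolding Z_def by linarith
  next
    case False
    define x0 where "x0 = Min Z"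
    have x0: "x0 \<in> Z" "\<And>x. x \<in> Z \<Longrightarrow> x0 \<le> x" using fin False by (auto simp: x0_def)
    have "(\<lambda>x. x - x0) ` Z \<subseteq> insert 0 (near_returns u a d)"
    proof (rule image_subsetI)
      fix x assume x: "x \<in> Z"
      show "x - x0 \<in> insert 0 (near_returns u a d)"
      proof (cases "x = x0")
        case False
        obtain m s where ms: "int x * int d + c = m * 2 ^ a + s" "- (2 ^ (a - u)) \<le> s" "s < 2 ^ (a - u)"
          using near_multipleE[of "2 ^ a" "2 ^ (a - u)" "int x * int d + c"] x by (auto simp: Z_def)
        obtain m' s' where ms': "int x0 * int d + c = m' * 2 ^ a + s'" "- (2 ^ (a - u)) \<le> s'" "s' < 2 ^ (a - u)"
          using near_multipleE[of "2 ^ a" "2 ^ (a - u)" "int x0 * int d + c"] x0(1) by (auto simp: Z_def)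
        have "near_multiple (2 ^ a) (2 * 2 ^ (a - u)) (int d * int (x - x0))"
        proof (rule near_multipleI)
          show "int d * int (x - x0) = (m - m') * 2 ^ a + (s - s')"
            using ms(1) ms'(1) x0(2)[OF x] by (simp add: of_nat_diff algebra_simps)
          show "- (2 * 2 ^ (a - u)) \<le> s - s'" "s - s' < 2 * 2 ^ (a - u)" using ms ms' by linarith+
          have "(2::int) ^ (2 + (a - u)) \<le> 2 ^ a" using assms by (intro power_increasing) auto
          then show "2 * (2 * 2 ^ (a - u)) \<le> (2::int) ^ a" by (simp add: power_add)
        qed simp
        moreover have "x - x0 \<in> {1..<2 ^ (7 * u)}" using False x0(2)[OF x] x by (auto simp: Z_def)
        ultimately show ?thesis by (simp add: near_returns_def)
      qed simp
    qed
    then have "card ((\<lambda>x. x - x0) ` Z) \<le> card (insert 0 (near_returns u a d))"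
      by (rule card_mono[rotated]) (simp add: near_returns_def)
    moreover have "card ((\<lambda>x. x - x0) ` Z) = card Z"
      by (rule card_image) (use x0(2) in \<open>auto intro!: inj_onI dest: eq_diff_iff\<close>)
    moreover have "card (insert 0 (near_returns u a d)) \<le> 1 + card (near_returns u a d)"
      by (simp add: card_insert_if near_returns_def)
    ultimately show ?thesis unfolding Z_def by simp
  qed
qed

text \<open>
  The short range \<open>2 ^ (7 * u)\<close> keeps the exceptional set small; longer ranges are cut into such pieces, each with its
  own offset.
\<close>

lemma near_visits_long:
  assumes "u \<ge> 2" "u \<le> a" "w \<le> u" "d \<in> {..<2 ^ \<Lambda>} - clustering \<Lambda> u w a"
  shows "real (card {x\<in>{..<2 ^ (13 * u)}. near_multiple (2 ^ a) (2 ^ (a - u)) (int x * int d + c)})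
     \<le> 2 / 2 ^ w * 2 ^ (13 * u)"
proof -
  let ?near = "\<lambda>c x. near_multiple (2 ^ a) (2 ^ (a - u)) (int x * int d + c)"
  have short: "real (card {x\<in>{..<2 ^ (7 * u)}. ?near c x}) \<le> 2 * 2 ^ (7 * u) / 2 ^ w" for c
  proof -
    have "card {x\<in>{..<2 ^ (7 * u)}. ?near c x} \<le> 1 + 2 ^ (7 * u - w)"
      using near_visits_short[OF assms(1,2), of d c] assms(4) by (auto simp: clustering_def)
    also have "\<dots> \<le> 2 * 2 ^ (7 * u - w)" by simp
    finally have "real (card {x\<in>{..<2 ^ (7 * u)}. ?near c x}) \<le> real (2 * 2 ^ (7 * u - w))"
      unfolding of_nat_le_iff .
    also have "\<dots> = 2 * 2 ^ (7 * u) / 2 ^ w" using assms(3)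
      by (simp add: power2_diff_real)
    finally show ?thesis .
  qed
  have sub: "{x\<in>{..<2 ^ (13 * u)}. ?near c x}
     \<subseteq> (\<Union>q<2 ^ (6 * u). (\<lambda>x. q * 2 ^ (7 * u) + x) ` {x\<in>{..<2 ^ (7 * u)}. ?near (c + int q * 2 ^ (7 * u) * int d) x})"
    (is "_ \<subseteq> (\<Union>q<_. ?S q)")
  proof
    fix x assume x: "x \<in> {x\<in>{..<2 ^ (13 * u)}. ?near c x}"
    let ?q = "x div 2 ^ (7 * u)" and ?r = "x mod 2 ^ (7 * u)"
    have e: "x = ?q * 2 ^ (7 * u) + ?r" by (rule div_mult_mod_eq[symmetric])
    then have e': "int x = int ?q * 2 ^ (7 * u) + int ?r" by (metis of_nat_add of_nat_mult of_nat_numeral of_nat_power)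
    have "x < 2 ^ (6 * u) * 2 ^ (7 * u)" using x by (simp flip: power_add)
    then have "?q < 2 ^ (6 * u)" by (simp add: less_mult_imp_div_less)
    moreover have "?near (c + int ?q * 2 ^ (7 * u) * int d) ?r"
    proof -
      have "int ?r * int d + (c + int ?q * 2 ^ (7 * u) * int d) = int x * int d + c"
        unfolding e' by (simp add: algebra_simps)
      then show ?thesis using x by (simp only: mem_Collect_eq)
    qed
    ultimately show "x \<in> (\<Union>q<2 ^ (6 * u). ?S q)" using e by (intro UN_I[of ?q]) (auto intro!: image_eqI[of _ _ ?r])
  qed
  have "real (card {x\<in>{..<2 ^ (13 * u)}. ?near c x}) \<le> real (card (\<Union>q<2 ^ (6 * u). ?S q))"
    unfolding of_nat_le_iff by (rule card_mono[OF _ sub]) simp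
  also have "\<dots> \<le> (\<Sum>q<2 ^ (6 * u). real (card (?S q)))"
    unfolding of_nat_sum[symmetric] of_nat_le_iff by (rule card_UN_le) simp
  also have "\<dots> \<le> (\<Sum>q<2 ^ (6 * u) :: nat. 2 * 2 ^ (7 * u) / 2 ^ w)"
  proof (rule sum_mono)
    fix q :: nat
    have "real (card (?S q)) \<le> real (card {x\<in>{..<2 ^ (7 * u)}. ?near (c + int q * 2 ^ (7 * u) * int d) x})"
      unfolding of_nat_le_iff by (rule card_image_le) simp
    also have "\<dots> \<le> 2 * 2 ^ (7 * u) / 2 ^ w" by (rule short)
    finally show "real (card (?S q)) \<le> 2 * 2 ^ (7 * u) / 2 ^ w" .
  qed
  also have "\<dots> = 2 / 2 ^ w * (2 ^ (6 * u) * 2 ^ (7 * u))" by simp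
  also have "(2 ^ (6 * u) * 2 ^ (7 * u) :: real) = 2 ^ (13 * u)" by (simp flip: power_add)
  finally show ?thesis .
qed

section \<open>The Thue--Morse sequence along a single progression\<close>

lemma digit_sign_thue_morse:
  assumes "n < 2 ^ b"
  shows "digit_sign b (int n) = 1 - 2 * real (thue_morse n)"
proof -
  have sub: "{k. bit n k} \<subseteq> {..<b}"
  proof
    fix k assume "k \<in> {k. bit n k}"
    then have k: "bit n k" by simp
    show "k \<in> {..<b}"
    proof (rule ccontr)
      assume "k \<notin> {..<b}"
      then have "(2::nat) ^ b \<le> 2 ^ k" by (intro power_increasing) auto
      then have "n div 2 ^ k = 0" using assms by (intro div_less) linarith
      then show False using k by (simp add: bit_iff_odd)
    qed
  qed
  have "digit_sign b (int n) = (\<Prod>k<b. if bit n k then -1 else 1)"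
    unfolding digit_sign_def by (simp add: bit_of_nat_iff_bit)
  also have "\<dots> = (\<Prod>k\<in>{k\<in>{..<b}. bit n k}. -1)"
    by (subst prod.inter_filter) simp_all
  also have "{k\<in>{..<b}. bit n k} = {k. bit n k}" using sub by auto
  finally have "digit_sign b (int n) = (-1) ^ binary_ones n" by (simp add: binary_ones_def)
  then show ?thesis by (auto simp: thue_morse_def minus_one_power_iff even_iff_mod_2_eq_zero)
qed

text \<open>
  Once only \<open>\<nu>\<close> digits are left and the range has length \<open>2 ^ \<nu>\<close>, the progression with odd \<open>d\<close> is a complete residue
  system, and the correlation over a complete residue system has been estimated.
\<close>

lemma window_corr_full:
  assumes "odd d" "M < 2 ^ e" "\<nu> = j + ((e + M + 1) * L + l)"
  shows "window_corr (2 ^ \<nu>) d M 0 \<nu> c \<tau>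
     \<le> damping M e L (\<lambda>i. \<tau> i div 2 ^ j mod int (2 ^ ((e + M + 1) * L)))"
proof -
  let ?G = "\<lambda>z. \<Prod>\<omega>\<in>Pow {0..<M}. digit_sign \<nu> (z + (\<Sum>i\<in>\<omega>. \<tau> i))"
  have G: "?G (z mod 2 ^ \<nu>) = ?G z" for z
    by (intro prod.cong refl digit_sign_cong) (simp add: mod_add_left_eq)
  have "(\<Sum>x<2 ^ \<nu>. ?G (int x * int d + c)) = (\<Sum>x<2 ^ \<nu>. ?G ((int x * int d + c) mod int (2 ^ \<nu>)))"
    using G by simp
  also have "\<dots> = (\<Sum>z\<in>{0..<int (2 ^ \<nu>)}. ?G z)"
    using assms(1) by (intro sum.reindex_bij_betw bij_affine_mod) (auto simp: coprime_right_2_iff_odd)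
  also have "\<dots> = corr (Pow {..<M}) \<nu> (\<lambda>\<omega>. \<Sum>i\<in>\<omega>. \<tau> i)"
    by (simp add: corr_def lessThan_atLeast0)
  finally have "\<bar>\<Sum>x<2 ^ \<nu>. ?G (int x * int d + c)\<bar> \<le> 2 ^ \<nu> * damping M e L (\<lambda>i. \<tau> i div 2 ^ j)"
    using corr_drop_digits[OF assms(2), of j L l \<tau>] by (simp only: assms(3))
  then have "window_corr (2 ^ \<nu>) d M 0 \<nu> c \<tau> \<le> damping M e L (\<lambda>i. \<tau> i div 2 ^ j)"
    by (simp add: window_corr_def divide_le_eq mult.commute)
  also have "\<dots> = damping M e L (\<lambda>i. \<tau> i div 2 ^ j mod 2 ^ ((e + M + 1) * L))"
    by (rule damping_mod[symmetric]) simp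
  finally show ?thesis by simp
qed

lemma two_adic_valuation_less:
  fixes K j :: nat
  assumes "K > 0" "\<not> 2 ^ j dvd K"
  obtains v q where "v < j" "K = 2 ^ v * q" "odd q"
proof -
  obtain q where q: "K = 2 ^ multiplicity 2 K * q" "odd q"
    using multiplicity_decompose'[of K 2] assms(1) by auto
  have "multiplicity 2 K < j"
  proof (rule ccontr)
    assume "\<not> multiplicity 2 K < j"
    then have "2 ^ j dvd (2::nat) ^ multiplicity 2 K" by (intro le_imp_power_dvd) simp
    then show False using assms(2) q(1) by (metis dvd_mult2)
  qed
  with q that show ?thesis by blast
qed

text \<open>
  The multiplier from Dirichlet's theorem is doubled until its \<open>2\<close>-adic valuation is exactly \<open>4 * u\<close>. The valuation is
  smaller than that at the start, because \<open>d\<close> is not resonant.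
\<close>

lemma good_shift:
  fixes d \<Lambda> u b :: nat
  assumes "odd d" "d \<in> {..<2 ^ \<Lambda>} - resonant \<Lambda> u b" "u \<ge> 1" "14 * u \<le> b"
  obtains K :: nat and t :: int where "K \<le> 2 ^ (11 * u)" "(int K * int d) mod 2 ^ b = t mod 2 ^ b"
    "\<exists>o'. odd o' \<and> t = 2 ^ (4 * u) * o'" "2 ^ u * \<bar>t\<bar> \<le> 2 ^ (b - u - u)"
proof -
  obtain K0 m s where K0: "K0 \<in> {1..2 ^ (7 * u)}" "int K0 * int d = m * 2 ^ b + s"
    "\<bar>s\<bar> < 2 ^ (b - 7 * u)"
    using dirichlet_near_multiple[of "7 * u" b d] assms by auto
  have "near_multiple (2 ^ b) (2 ^ (b - 7 * u)) (int d * int K0)"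
  proof (rule near_multipleI)
    show "int d * int K0 = m * 2 ^ b + s" using K0(2) by (simp add: mult.commute)
    have "(2::int) ^ Suc (b - 7 * u) \<le> 2 ^ b" using assms by (intro power_increasing) auto
    then show "2 * 2 ^ (b - 7 * u) \<le> (2::int) ^ b" by simp
  qed (use K0(3) in auto)
  then have "\<not> 2 ^ (4 * u) dvd K0" using assms(2) K0(1) by (auto simp: resonant_def)
  then obtain v q where v: "v < 4 * u" "K0 = 2 ^ v * q" "odd q"
    using two_adic_valuation_less[of K0 "4 * u"] K0(1) by auto
  define w where "w = 4 * u - v"
  have vw: "v + w = 4 * u" using v(1) by (simp add: w_def)
  define K where "K = 2 ^ w * K0"
  define t where "t = 2 ^ w * s"
  have Kd: "int K * int d = (2 ^ w * m) * 2 ^ b + t"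
  proof -
    have "int K * int d = 2 ^ w * (int K0 * int d)" by (simp add: K_def)
    also have "\<dots> = (2 ^ w * m) * 2 ^ b + t" unfolding K0(2) t_def by (simp only: distrib_left mult.assoc)
    finally show ?thesis .
  qed
  show ?thesis
  proof (rule that)
    have "K \<le> 2 ^ (4 * u) * 2 ^ (7 * u)" unfolding K_def
      using K0(1) vw by (intro mult_mono power_increasing) auto
    then show "K \<le> 2 ^ (11 * u)" by (simp flip: power_add)
    show "(int K * int d) mod 2 ^ b = t mod 2 ^ b" unfolding Kd by simp
    show "\<exists>o'. odd o' \<and> t = 2 ^ (4 * u) * o'"
    proof (intro exI conjI)
      let ?o = "int q * int d - 2 ^ w * m * 2 ^ (b - 4 * u)"
      have b: "(2::int) ^ b = 2 ^ (4 * u) * 2 ^ (b - 4 * u)" using assms by (simp flip: power_add)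
      have "int K = 2 ^ (4 * u) * int q" unfolding K_def v(2) vw[symmetric] by (simp add: power_add)
      then show "t = 2 ^ (4 * u) * ?o" using Kd b by (simp add: algebra_simps)
      have "b - 4 * u > 0" using assms by simp
      then show "odd ?o" using v(3) assms(1) by simp
    qed
    have "2 ^ u * \<bar>t\<bar> = 2 ^ (u + w) * \<bar>s\<bar>" by (simp add: t_def abs_mult power_add)
    also have "\<dots> \<le> 2 ^ (5 * u) * 2 ^ (b - 7 * u)" using vw K0(3) by (intro mult_mono power_increasing) auto
    also have "\<dots> = 2 ^ (b - u - u)"
    proof -
      have "5 * u + (b - 7 * u) = b - u - u" using assms by simp
      then show ?thesis by (simp only: power_add[symmetric])
    qed
    finally show "2 ^ u * \<bar>t\<bar> \<le> 2 ^ (b - u - u)" .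
  qed
qed

text \<open>
  If \<open>2 ^ a\<close> exceeds \<open>d\<close> considerably, \<open>x d + c\<close> moves slowly compared with \<open>2 ^ a\<close> and quickly enough
  compared with the neighbourhood, so no condition on \<open>d\<close> is needed.
\<close>

lemma near_visits_top:
  assumes "u \<ge> 1" "d > 0" "d < 2 ^ \<Lambda>" "\<Lambda> + 6 * u \<le> a"
  shows "real (card {x\<in>{..<2 ^ (13 * u)}. near_multiple (2 ^ a) (2 ^ (5 * u) * int d) (int x * int d + c)})
     \<le> 12 / 2 ^ u * 2 ^ (13 * u)"
proof -
  define U :: real where "U = 2 ^ u"
  have U1: "1 \<le> U" by (simp add: U_def)
  have dA: "real d * U ^ 6 \<le> 2 ^ a"
  proof -
    have "real d \<le> real (2 ^ \<Lambda>)" using assms(3) unfolding of_nat_le_iff by simp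
    then have "real d * U ^ 6 \<le> 2 ^ \<Lambda> * U ^ 6" using U1 by (intro mult_right_mono) auto
    also have "\<dots> = 2 ^ (\<Lambda> + 6 * u)" by (simp add: U_def power_mult[symmetric] power_add mult.commute)
    also have "\<dots> \<le> 2 ^ a" using assms(4) by (intro power_increasing) auto
    finally show ?thesis .
  qed
  have Y2: "2 * (2 ^ (5 * u) * int d) \<le> 2 ^ a"
  proof -
    have "2 * (2 ^ (5 * u) * int d) \<le> 2 ^ (5 * u + 1) * 2 ^ \<Lambda>"
    proof -
      have "int d \<le> 2 ^ \<Lambda>" using assms(3) by (metis less_imp_le of_nat_le_iff of_nat_numeral of_nat_power)
      then have "2 ^ (5 * u + 1) * int d \<le> 2 ^ (5 * u + 1) * 2 ^ \<Lambda>" by (intro mult_left_mono) auto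
      then show ?thesis by simp
    qed
    also have "\<dots> = 2 ^ (5 * u + 1 + \<Lambda>)" by (simp only: power_add)
    also have "\<dots> \<le> 2 ^ a" using assms by (intro power_increasing) auto
    finally show ?thesis by (simp_all only: UNIV_I)
  qed
  have "real (card {x\<in>{..<2 ^ (13 * u)}. near_multiple (2 ^ a) (2 ^ (5 * u) * int d) (int x * int d + c)})
    \<le> (real (2 ^ (13 * u)) * real d / real_of_int (2 ^ a) + 2) * (2 * real_of_int (2 ^ (5 * u) * int d) / real d + 1)"
    by (rule card_near_multiple_le[OF assms(2) _ _ Y2]) simp_all
  also have "2 * real_of_int (2 ^ (5 * u) * int d) / real d = 2 * U ^ 5"
    using assms(2) by (simp add: U_def power_mult[symmetric] mult.commute)
  also have "real (2 ^ (13 * u)) * real d / real_of_int (2 ^ a) = U ^ 13 * (real d / 2 ^ a)"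
    by (simp add: U_def power_mult[symmetric] mult.commute)
  also have "(U ^ 13 * (real d / 2 ^ a) + 2) * (2 * U ^ 5 + 1) \<le> (U ^ 7 + 2 * U ^ 7) * (2 * U ^ 5 + 2 * U ^ 5)"
  proof (intro mult_mono add_mono order.refl)
    have "real d / 2 ^ a \<le> 1 / U ^ 6" using dA U1 by (simp add: divide_le_eq le_divide_eq mult.commute)
    then have "U ^ 13 * (real d / 2 ^ a) \<le> U ^ 13 * (1 / U ^ 6)" using U1 by (intro mult_left_mono) auto
    also have "\<dots> = U ^ 7" using U1 by (simp add: field_simps flip: power_add)
    finally show "U ^ 13 * (real d / 2 ^ a) \<le> U ^ 7" .
    show "2 \<le> 2 * U ^ 7" "1 \<le> 2 * U ^ 5" using one_le_power[OF U1, of 7] one_le_power[OF U1, of 5] by linarith+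
  qed (use U1 in auto)
  also have "\<dots> = 12 / U * U ^ 13" using U1 by (simp add: field_simps eval_nat_numeral)
  also have "U ^ 13 = 2 ^ (13 * u)" by (simp add: U_def power_mult[symmetric] mult.commute)
  finally show ?thesis by (simp only: U_def)
qed

text \<open>
  The index \<open>n\<close> runs over those steps whose lower digit position \<open>13 u + n u\<close> is not far above the length \<open>\<Lambda>\<close> of \<open>d\<close>.
  In the other steps the multiplier is a plain power of two, and every odd \<open>d\<close> is admissible.
\<close>

definition exceptional :: "nat \<Rightarrow> nat \<Rightarrow> nat \<Rightarrow> nat \<Rightarrow> nat set" where
  "exceptional M \<Lambda> u w = (\<Union>n\<in>{n\<in>{..<M}. 13 * u + n * u < \<Lambda> + 6 * u}.
      resonant \<Lambda> u (13 * u + Suc n * u) \<union> clustering \<Lambda> u w (13 * u + n * u))"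

lemma card_exceptional:
  assumes "u = 2 * w" "w \<ge> 1"
  shows "real (card (exceptional M \<Lambda> u w)) \<le> 72 * M * (2 ^ \<Lambda> / 2 ^ w)"
proof -
  define I where "I = {n\<in>{..<M}. 13 * u + n * u < \<Lambda> + 6 * u}"
  have fin: "finite I" by (simp add: I_def)
  have "card (exceptional M \<Lambda> u w)
     \<le> (\<Sum>n\<in>I. card (resonant \<Lambda> u (13 * u + Suc n * u) \<union> clustering \<Lambda> u w (13 * u + n * u)))"
    unfolding exceptional_def I_def[symmetric] by (rule card_UN_le[OF fin])
  then have "real (card (exceptional M \<Lambda> u w))
     \<le> (\<Sum>n\<in>I. real (card (resonant \<Lambda> u (13 * u + Suc n * u) \<union> clustering \<Lambda> u w (13 * u + n * u))))"
    by (simp flip: of_nat_sum)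
  also have "\<dots> \<le> (\<Sum>n\<in>I. 72 * (2 ^ \<Lambda> / 2 ^ w))"
  proof (rule sum_mono)
    fix n assume n: "n \<in> I"
    have "real (card (resonant \<Lambda> u (13 * u + Suc n * u) \<union> clustering \<Lambda> u w (13 * u + n * u)))
       \<le> real (card (resonant \<Lambda> u (13 * u + Suc n * u))) + real (card (clustering \<Lambda> u w (13 * u + n * u)))"
      unfolding of_nat_add[symmetric] of_nat_le_iff by (rule card_Un_le)
    also have "\<dots> \<le> 9 * 2 ^ \<Lambda> / 2 ^ u + 63 * 2 ^ \<Lambda> / 2 ^ w"
    proof (rule add_mono)
      have n': "n < M" "13 * u + n * u < \<Lambda> + 6 * u" using n by (simp_all add: I_def)
      show "real (card (resonant \<Lambda> u (13 * u + Suc n * u))) \<le> 9 * 2 ^ \<Lambda> / 2 ^ u"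
        by (rule card_resonant) (use assms n' in simp_all)
      show "real (card (clustering \<Lambda> u w (13 * u + n * u))) \<le> 63 * 2 ^ \<Lambda> / 2 ^ w"
        by (rule card_clustering) (use assms n' in simp_all)
    qed
    also have "9 * 2 ^ \<Lambda> / 2 ^ u \<le> 9 * 2 ^ \<Lambda> / (2::real) ^ w"
      using assms by (intro divide_left_mono power_increasing) auto
    finally show "real (card (resonant \<Lambda> u (13 * u + Suc n * u) \<union> clustering \<Lambda> u w (13 * u + n * u)))
       \<le> 72 * (2 ^ \<Lambda> / 2 ^ w)" by simp
  qed
  also have "\<dots> = real (card I) * (72 * (2 ^ \<Lambda> / 2 ^ w))" by simp
  also have "\<dots> \<le> real M * (72 * (2 ^ \<Lambda> / 2 ^ w))"
    using card_mono[of "{..<M}" I] by (intro mult_right_mono) (auto simp: I_def)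
  finally show ?thesis by (simp add: mult_ac)
qed

text \<open>
  All exponents are multiples of \<open>w\<close>. With \<open>u = 2 w\<close>, the range has length \<open>2 ^ (13 u)\<close>, the two shifts run below
  \<open>R = 2 ^ u\<close>, the directions are divisible by exactly \<open>2 ^ (4 u)\<close>, the multipliers are at most \<open>2 ^ (11 u)\<close>, and
  every step but the first removes \<open>u\<close> digits, until the lowest \<open>13 u\<close> are left. Those suffice for \<open>window_corr_full\<close>.
  The first step starts from arbitrarily many digits \<open>B\<close>, and \<open>\<Lambda> \<le> (M + 6) u\<close> ensures that it is one of the steps for
  which a power of two is a valid multiplier.
\<close>

lemma window_corr_power_le:
  fixes M L d \<Lambda> B :: nat and c :: int
  defines "k \<equiv> 2 * M + 1" and "w \<equiv> (2 * M + 1) * L" and "u \<equiv> 2 * ((2 * M + 1) * L)"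
  assumes "M \<ge> 1" "L \<ge> 1" "\<Lambda> \<le> (M + 6) * u" "odd d" "d \<in> {..<2 ^ \<Lambda>} - exceptional M \<Lambda> u w"
    "13 * u + M * u \<le> B"
  shows "window_corr (2 ^ (13 * u)) d M M B c \<tau> ^ 2 ^ M
     \<le> (1 - 2 / 2 ^ k / (2 ^ k) ^ M) ^ (2 * L) + 2 ^ M * (28 * 2 ^ M / 2 ^ w)"
proof -
  have w1: "w \<ge> 1" using assms(5) by (simp add: w_def)
  have uw: "u = 2 * w" by (simp add: u_def w_def)
  have u1: "u \<ge> 2" using w1 uw by simp
  have M2: "M < 2 ^ M" by (rule less_exp)
  \<comment> \<open>In the steps with \<open>top n\<close>, the bound \<open>2 ^ (5 * u) * d\<close> on all shifts is far below \<open>2 ^ b n\<close>.\<close>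
  define top where "top n \<longleftrightarrow> \<Lambda> + 6 * u \<le> 13 * u + n * u" for n
  define b where "b n = (if n < M then 13 * u + n * u else B)" for n
  define P where "P n p \<longleftrightarrow> (case p of (K, t, Y) \<Rightarrow> K \<le> 2 ^ (11 * u) \<and>
      (int K * int d) mod 2 ^ b (Suc n) = t mod 2 ^ b (Suc n) \<and>
      (\<exists>o'. odd o' \<and> t = 2 ^ (4 * u) * o') \<and> 2 ^ u * \<bar>t\<bar> \<le> Y \<and>
      (\<forall>c. real (card {x\<in>{..<2 ^ (13 * u)}. near_multiple (2 ^ b n) Y (int x * int d + c)})
          \<le> 12 / 2 ^ w * 2 ^ (13 * u)))" for n :: nat and p :: "nat \<times> int \<times> int"
  have d0: "d > 0" "d < 2 ^ \<Lambda>" using assms(7,8) by (auto intro!: Nat.gr0I)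
  have "\<exists>p. P n p" if n: "n < M" for n
  proof (cases "top n")
    case True
    have "P n (2 ^ (4 * u), 2 ^ (4 * u) * int d, 2 ^ (5 * u) * int d)"
      unfolding P_def prod.case
    proof (intro conjI allI)
      show "(2::nat) ^ (4 * u) \<le> 2 ^ (11 * u)" by (intro power_increasing) auto
      show "int (2 ^ (4 * u)) * int d mod 2 ^ b (Suc n) = 2 ^ (4 * u) * int d mod 2 ^ b (Suc n)" by simp
      show "\<exists>o'. odd o' \<and> 2 ^ (4 * u) * int d = 2 ^ (4 * u) * o'" using assms(7) by (intro exI[of _ "int d"]) simp
      have "(2::int) ^ (5 * u) = 2 ^ u * 2 ^ (4 * u)" by (simp flip: power_add)
      then show "2 ^ u * \<bar>2 ^ (4 * u) * int d\<bar> \<le> 2 ^ (5 * u) * int d" by (simp add: abs_mult)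
      fix c
      have "real (card {x\<in>{..<2 ^ (13 * u)}. near_multiple (2 ^ b n) (2 ^ (5 * u) * int d) (int x * int d + c)})
          \<le> 12 / 2 ^ u * 2 ^ (13 * u)"
        using True n u1 d0 by (intro near_visits_top[of _ _ \<Lambda>]) (auto simp: b_def top_def)
      also have "\<dots> \<le> 12 / 2 ^ w * 2 ^ (13 * u)"
        using uw by (intro mult_right_mono divide_left_mono power_increasing) auto
      finally show "real (card {x\<in>{..<2 ^ (13 * u)}. near_multiple (2 ^ b n) (2 ^ (5 * u) * int d) (int x * int d + c)})
          \<le> 12 / 2 ^ w * 2 ^ (13 * u)" .
    qed
    then show ?thesis by blast
  next
    case False
    \<comment> \<open>Direction \<open>M - 1\<close> is a top one, by the assumption on \<open>\<Lambda>\<close>, so the position \<open>b (Suc n)\<close> is not \<open>B\<close>.\<close>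
    have nM: "Suc n < M"
    proof (rule ccontr)
      assume "\<not> Suc n < M"
      then have "Suc n = M" using n by simp
      then have "(M + 6) * u = n * u + 7 * u" by (simp add: algebra_simps flip: \<open>Suc n = M\<close>)
      then show False using False assms(6) by (simp add: top_def)
    qed
    have ex: "resonant \<Lambda> u (13 * u + Suc n * u) \<union> clustering \<Lambda> u w (13 * u + n * u) \<subseteq> exceptional M \<Lambda> u w"
      unfolding exceptional_def using False n by (intro UN_upper) (simp add: top_def)
    have nres: "d \<in> {..<2 ^ \<Lambda>} - resonant \<Lambda> u (13 * u + Suc n * u)"
      and nclu: "d \<in> {..<2 ^ \<Lambda>} - clustering \<Lambda> u w (13 * u + n * u)"
      using ex assms(8) by auto
    obtain K t where Kt: "K \<le> 2 ^ (11 * u)"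
      "(int K * int d) mod 2 ^ (13 * u + Suc n * u) = t mod 2 ^ (13 * u + Suc n * u)"
      "\<exists>o'. odd o' \<and> t = 2 ^ (4 * u) * o'" "2 ^ u * \<bar>t\<bar> \<le> 2 ^ (13 * u + Suc n * u - u - u)"
      by (rule good_shift[OF assms(7) nres]) (use u1 in auto)
    have bn: "b n = 13 * u + n * u" "b (Suc n) = 13 * u + Suc n * u" using nM n by (auto simp: b_def)
    have bu: "13 * u + Suc n * u - u - u = 13 * u + n * u - u" by simp
    have "P n (K, t, 2 ^ (13 * u + n * u - u))"
      unfolding P_def prod.case bn
    proof (intro conjI allI)
      show "2 ^ u * \<bar>t\<bar> \<le> 2 ^ (13 * u + n * u - u)" using Kt(4) unfolding bu .
      fix c
      have "real (card {x\<in>{..<2 ^ (13 * u)}. near_multiple (2 ^ (13 * u + n * u)) (2 ^ (13 * u + n * u - u)) (int x * int d + c)})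
          \<le> 2 / 2 ^ w * 2 ^ (13 * u)"
        by (rule near_visits_long[OF _ _ _ nclu]) (use u1 uw in auto)
      also have "\<dots> \<le> 12 / 2 ^ w * 2 ^ (13 * u)" by (intro mult_right_mono divide_right_mono) auto
      finally show "real (card {x\<in>{..<2 ^ (13 * u)}. near_multiple (2 ^ (13 * u + n * u)) (2 ^ (13 * u + n * u - u)) (int x * int d + c)})
          \<le> 12 / 2 ^ w * 2 ^ (13 * u)" .
    qed (use Kt in auto)
    then show ?thesis by blast
  qed
  then obtain p where p: "\<And>n. n < M \<Longrightarrow> P n (p n)" by metis
  define K where "K n = fst (p n)" for n
  define t where "t n = fst (snd (p n))" for n
  define Y where "Y n = snd (snd (p n))" for n
  have Pn: "P n (K n, t n, Y n)" if "n < M" for n using p[OF that] by (simp add: K_def t_def Y_def)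
  have R: "(2::nat) ^ u = 2 ^ (k * (2 * L))" by (simp add: u_def k_def algebra_simps)
  have "window_corr (2 ^ (13 * u)) d M M (b M) c \<tau> ^ 2 ^ M
     \<le> cube_avg (2 ^ u) M (damping M M (2 * L)) (\<lambda>i. \<tau> i div 2 ^ (4 * u) mod int (2 ^ u))
       + (2 ^ M - 1) * (4 * (1 / 2 ^ u) + 2 * 2 ^ M * (12 / 2 ^ w))"
  proof (rule window_corr_iterate[where K=K and t=t and Y=Y])
    show "b n \<le> b (Suc n)" if "n < M" for n
    proof (cases "Suc n < M")
      case False
      then have "b (Suc n) = B" "b n = 13 * u + n * u" using that by (auto simp: b_def)
      moreover have "n * u \<le> M * u" using that by (intro mult_right_mono) auto
      ultimately show ?thesis using assms(9) by linarith
    qed (simp add: b_def)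
    show "real (2 ^ u) * real (K n) \<le> 1 / 2 ^ u * real (2 ^ (13 * u))" if "n < M" for n
    proof -
      have "real (K n) \<le> real (2 ^ (11 * u))" using Pn[OF that] unfolding of_nat_le_iff P_def by simp
      then have "real (2 ^ u) * real (K n) \<le> 2 ^ u * 2 ^ (11 * u)" by (intro mult_mono) auto
      also have "\<dots> = 1 / 2 ^ u * (2 ^ u * 2 ^ u * 2 ^ (11 * u))" by simp
      also have "(2 ^ u * 2 ^ u * 2 ^ (11 * u) :: real) = 2 ^ (13 * u)" by (simp flip: power_add)
      finally show ?thesis by simp
    qed
    show "window_corr (2 ^ (13 * u)) d M 0 (b 0) c \<tau>
        \<le> damping M M (2 * L) (\<lambda>i. \<tau> i div 2 ^ (4 * u) mod int (2 ^ u))" for c \<tau>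
    proof -
      have "13 * u = 4 * u + ((M + M + 1) * (2 * L) + 8 * u)" by (simp add: u_def algebra_simps)
      from window_corr_full[OF assms(7) M2 this, of c \<tau>] show ?thesis
        using R assms(4) by (simp add: b_def k_def mult_2)
    qed
  qed (use Pn in \<open>auto simp: P_def\<close>)
  also have "cube_avg (2 ^ u) M (damping M M (2 * L)) (\<lambda>i. \<tau> i div 2 ^ (4 * u) mod int (2 ^ u))
     = (1 - 2 / 2 ^ k / (2 ^ k) ^ M) ^ (2 * L)"
    unfolding R by (rule cube_avg_damping) (simp add: k_def)
  also have "(2 ^ M - 1) * (4 * (1 / 2 ^ u) + 2 * 2 ^ M * (12 / 2 ^ w)) \<le> 2 ^ M * (28 * 2 ^ M / (2::real) ^ w)"
  proof (intro mult_mono)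
    have "1 / 2 ^ u \<le> 1 / (2::real) ^ w" using uw by (intro divide_left_mono power_increasing) auto
    moreover have "1 / 2 ^ w \<le> 2 ^ M * (1 / (2::real) ^ w)" by (simp add: divide_right_mono)
    ultimately have "4 * (1 / 2 ^ u) + 2 * 2 ^ M * (12 / 2 ^ w) \<le> 28 * (2 ^ M * (1 / (2::real) ^ w))" by simp
    then show "4 * (1 / 2 ^ u) + 2 * 2 ^ M * (12 / 2 ^ w) \<le> 28 * 2 ^ M / (2::real) ^ w" by simp
  qed auto
  finally show ?thesis by (simp add: b_def)
qed

text \<open>
  The sequence \<open>(-1) ^ s(n)\<close>.
\<close>

definition tm_sign :: "nat \<Rightarrow> real" where
  "tm_sign n = 1 - 2 * real (thue_morse n)"

lemma abs_tm_sign [simp]: "\<bar>tm_sign n\<bar> = 1"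
  by (simp add: tm_sign_def thue_morse_def)

lemma tm_sign_rec: "tm_sign n = (if odd n then -1 else 1) * tm_sign (n div 2)"
proof -
  have n: "n < 2 ^ Suc n" using less_exp[of "Suc n"] by linarith
  have h: "n div 2 < 2 ^ n" using less_exp[of n] by linarith
  have "tm_sign n = digit_sign (1 + n) (int n)"
    using digit_sign_thue_morse[OF n] by (simp add: tm_sign_def)
  also have "\<dots> = digit_sign 1 (int n) * digit_sign n (int (n div 2))"
    by (subst digit_sign_add) (simp add: zdiv_int)
  also have "digit_sign n (int (n div 2)) = tm_sign (n div 2)"
    using digit_sign_thue_morse[OF h] by (simp add: tm_sign_def)
  finally show ?thesis by (simp add: digit_sign_def bit_0)
qed

lemma sum_thue_morse_pairs: "(\<Sum>n<2 * m. real (thue_morse n)) = m"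
proof (induction m)
  case (Suc m)
  have "tm_sign (2 * m + 1) = - tm_sign (2 * m)"
    using tm_sign_rec[of "2 * m"] tm_sign_rec[of "2 * m + 1"] by simp
  then have "real (thue_morse (2 * m)) + real (thue_morse (2 * m + 1)) = 1" by (simp add: tm_sign_def)
  then show ?case using Suc by simp
qed simp

text \<open>
  This extracts the \<open>2 ^ M\<close>-th root in \<open>window_corr_power_le\<close>: the base \<open>q\<close> is the root of the larger of
  \<open>1 / 2\<close>, which governs the errors, and the averaged gain of one block. The bound is uniform in the offset \<open>a\<close>.
\<close>

lemma progression_sum_bound:
  fixes M :: nat
  assumes "M \<ge> 1"
  obtains k :: nat and C q :: real where "k \<ge> 1" "1 \<le> C" "0 < q" "q < 1"
    "\<And>L \<Lambda>. L \<ge> 1 \<Longrightarrow> \<Lambda> \<le> (M + 6) * (2 * (k * L)) \<Longrightarrow> \<exists>E. real (card E) \<le> C * 2 ^ \<Lambda> * q ^ L \<and>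
       finite E \<and> (\<forall>d a. odd d \<longrightarrow> d < 2 ^ \<Lambda> \<longrightarrow> d \<notin> E \<longrightarrow>
         \<bar>\<Sum>n<2 ^ (26 * (k * L)). tm_sign (n * d + a)\<bar> \<le> C * q ^ L * 2 ^ (26 * (k * L)))"
proof -
  define k where "k = 2 * M + 1"
  define p :: real where "p = 1 - 2 / 2 ^ k / (2 ^ k) ^ M"
  define q0 where "q0 = max p (1 / 2)"
  define q where "q = root (2 ^ M) q0"
  define C0 :: real where "C0 = 1 + 28 * 4 ^ M"
  define C where "C = C0 + 72 * M"
  have p: "0 \<le> p" "p < 1"
  proof -
    have "(2::real) ^ 1 \<le> 2 ^ k" unfolding k_def by (intro power_increasing) auto
    then have "2 / 2 ^ k \<le> (1::real)" by simp
    also have "(1::real) \<le> (2 ^ k) ^ M" by (simp add: one_le_power)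
    finally have h: "2 / 2 ^ k \<le> ((2::real) ^ k) ^ M" .
    have "2 / 2 ^ k / (2 ^ k) ^ M \<le> (1::real)" by (subst divide_le_eq_1_pos) (simp, rule h)
    then show "0 \<le> p" by (simp add: p_def)
    show "p < 1" by (simp add: p_def)
  qed
  have q0: "0 < q0" "q0 < 1" "p \<le> q0" "1 / 2 \<le> q0" using p by (auto simp: q0_def)
  have q: "0 < q" "q < 1" "q ^ 2 ^ M = q0"
    using q0 by (auto simp: q_def real_root_pow_pos2)
  have qq0: "q0 \<le> q"
  proof -
    have "q ^ 2 ^ M \<le> q ^ 1" using q by (intro power_decreasing) auto
    then show ?thesis using q(3) by simp
  qed
  have C0: "1 \<le> C0" "0 \<le> C0" "C0 \<le> C" by (auto simp: C0_def C_def)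
  show ?thesis
  proof (rule that[of k C q])
    fix L \<Lambda> :: nat
    assume L: "L \<ge> 1" and \<Lambda>: "\<Lambda> \<le> (M + 6) * (2 * (k * L))"
    define w where "w = k * L"
    define u where "u = 2 * w"
    have w1: "w \<ge> 1" "L \<le> w" using L by (auto simp: w_def k_def)
    have hw: "1 / 2 ^ w \<le> q0 ^ L"
    proof -
      have "1 / 2 ^ w = (1 / 2 :: real) ^ w" by (simp add: power_divide)
      also have "\<dots> \<le> (1 / 2) ^ L" using w1 by (intro power_decreasing) auto
      also have "\<dots> \<le> q0 ^ L" using q0 by (intro power_mono) auto
      finally show ?thesis .
    qed
    have q0q: "q0 ^ L \<le> q ^ L" using q0 qq0 by (intro power_mono) auto
    show "\<exists>E. real (card E) \<le> C * 2 ^ \<Lambda> * q ^ L \<and> finite E \<and>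
       (\<forall>d a. odd d \<longrightarrow> d < 2 ^ \<Lambda> \<longrightarrow> d \<notin> E \<longrightarrow>
         \<bar>\<Sum>n<2 ^ (26 * (k * L)). tm_sign (n * d + a)\<bar> \<le> C * q ^ L * 2 ^ (26 * (k * L)))"
    proof (intro exI[of _ "exceptional M \<Lambda> u w"] conjI allI impI)
      show "finite (exceptional M \<Lambda> u w)"
        by (rule finite_subset[of _ "{..<2 ^ \<Lambda>}"]) (auto simp: exceptional_def resonant_def clustering_def)
      have "real (card (exceptional M \<Lambda> u w)) \<le> 72 * M * (2 ^ \<Lambda> * (1 / 2 ^ w))"
        using card_exceptional[OF u_def w1(1)] by simp
      also have "\<dots> \<le> C * (2 ^ \<Lambda> * q ^ L)"
        using hw q0q q C0 by (intro mult_mono) (auto simp: C_def)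
      finally show "real (card (exceptional M \<Lambda> u w)) \<le> C * 2 ^ \<Lambda> * q ^ L" by (simp add: mult.assoc)
      fix d a :: nat
      assume d: "odd d" "d < 2 ^ \<Lambda>" "d \<notin> exceptional M \<Lambda> u w"
      define N :: nat where "N = 2 ^ (13 * u)"
      \<comment> \<open>All arguments \<open>n d + a\<close> are below \<open>2 ^ B\<close>, so that \<open>B\<close> digits determine the whole sign.\<close>
      define B where "B = 13 * u + M * u + (N * d + a)"
      define W where "W = window_corr N d M M B (int a) (\<lambda>_. 0)"
      have "W ^ 2 ^ M \<le> p ^ (2 * L) + 2 ^ M * (28 * 2 ^ M / 2 ^ w)"
        unfolding W_def N_def p_def u_def w_def k_def
        by (rule window_corr_power_le[OF assms L _ d(1)])
           (use \<Lambda> d in \<open>auto simp: u_def w_def k_def B_def\<close>)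
      also have "\<dots> \<le> q0 ^ L + 28 * 4 ^ M * q0 ^ L"
      proof (intro add_mono)
        have "p ^ (2 * L) \<le> q0 ^ (2 * L)" using p q0 by (intro power_mono) auto
        also have "\<dots> \<le> q0 ^ L" using q0 by (intro power_decreasing) auto
        finally show "p ^ (2 * L) \<le> q0 ^ L" .
        have "2 ^ M * (28 * 2 ^ M / 2 ^ w) = 28 * (2 ^ M * 2 ^ M) * (1 / (2::real) ^ w)" by simp
        also have "(2::real) ^ M * 2 ^ M = 4 ^ M" by (simp flip: power_mult_distrib)
        also have "28 * 4 ^ M * (1 / (2::real) ^ w) \<le> 28 * 4 ^ M * q0 ^ L" using hw by (intro mult_left_mono) auto
        finally show "2 ^ M * (28 * 2 ^ M / 2 ^ w) \<le> 28 * 4 ^ M * q0 ^ L" .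
      qed
      also have "\<dots> = C0 * q0 ^ L" by (simp add: C0_def algebra_simps)
      also have "\<dots> \<le> C0 ^ 2 ^ M * (q ^ L) ^ 2 ^ M"
      proof (intro mult_mono)
        show "C0 \<le> C0 ^ 2 ^ M" using power_increasing[of 1 "2 ^ M" C0] C0 by simp
        have "q0 ^ L = (q ^ L) ^ 2 ^ M" by (simp only: q(3)[symmetric] power_mult[symmetric] mult.commute)
        then show "q0 ^ L \<le> (q ^ L) ^ 2 ^ M" by simp
      qed (use C0 q0 in auto)
      also have "\<dots> = (C0 * q ^ L) ^ 2 ^ M" by (simp add: power_mult_distrib)
      finally have "W \<le> C0 * q ^ L"
        using window_corr_bounds[of N d M M B "int a" "\<lambda>_. 0"] C0 q
        by (subst (asm) power_mono_iff) (auto simp: W_def)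
      also have "\<dots> \<le> C * q ^ L" using C0 q by (intro mult_right_mono) auto
      finally have W: "W \<le> C * q ^ L" .
      have "(\<Sum>n<N. digit_sign B (int n * int d + int a)) = (\<Sum>n<N. tm_sign (n * d + a))"
      proof (rule sum.cong[OF refl])
        fix n assume "n \<in> {..<N}"
        then have "n * d \<le> N * d" by (intro mult_right_mono) auto
        then have "n * d + a \<le> B" unfolding B_def by linarith
        then have "n * d + a < 2 ^ B" using less_exp[of B] by linarith
        from digit_sign_thue_morse[OF this] show "digit_sign B (int n * int d + int a) = tm_sign (n * d + a)"
          by (simp add: tm_sign_def)
      qed
      then have "W = \<bar>\<Sum>n<N. tm_sign (n * d + a)\<bar> / real N" by (simp add: W_def window_corr_def)
      then have "\<bar>\<Sum>n<N. tm_sign (n * d + a)\<bar> \<le> C * q ^ L * real N"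
        using W by (simp add: N_def divide_le_eq)
      moreover have "13 * u = 26 * (k * L)" by (simp add: u_def w_def)
      ultimately show "\<bar>\<Sum>n<2 ^ (26 * (k * L)). tm_sign (n * d + a)\<bar> \<le> C * q ^ L * 2 ^ (26 * (k * L))"
        by (simp add: N_def)
    qed
  qed (use q C0 in \<open>auto simp: k_def\<close>)
qed

section \<open>Summation over the moduli\<close>

definition prog_disc :: "nat \<Rightarrow> nat \<Rightarrow> real" where
  "prog_disc N d = (SUP a. \<bar>\<Sum>n<N. tm_sign (n * d + a)\<bar> / real N)"

lemma abs_sum_tm_sign_le: "\<bar>\<Sum>n<N. tm_sign (f n)\<bar> \<le> real N"
  using order.trans[OF sum_abs sum_mono[of "{..<N}" "\<lambda>n. \<bar>tm_sign (f n)\<bar>" "\<lambda>_. 1"]] by simp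

lemma prog_disc_upper: "\<bar>\<Sum>n<N. tm_sign (n * d + a)\<bar> \<le> prog_disc N d * real N"
proof (cases "N = 0")
  case False
  have "\<bar>\<Sum>n<N. tm_sign (n * d + a)\<bar> / real N \<le> prog_disc N d"
    unfolding prog_disc_def
    by (rule cSUP_upper) (auto intro!: bdd_aboveI[of _ 1] simp: divide_le_eq_1 abs_sum_tm_sign_le)
  then show ?thesis using False by (simp add: divide_le_eq)
qed simp

lemma prog_disc_least:
  assumes "N > 0" "\<And>a. \<bar>\<Sum>n<N. tm_sign (n * d + a)\<bar> \<le> b * real N"
  shows "prog_disc N d \<le> b"
  unfolding prog_disc_def using assms by (intro cSUP_least) (auto simp: divide_le_eq)

lemma prog_disc_bounds:
  assumes "N > 0"
  shows "0 \<le> prog_disc N d" "prog_disc N d \<le> 1"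
proof -
  have "0 \<le> prog_disc N d * real N" using prog_disc_upper[where N=N and d=d and a=0] by (rule order.trans[OF abs_ge_zero])
  then show "0 \<le> prog_disc N d" using assms by (simp add: zero_le_mult_iff)
  show "prog_disc N d \<le> 1" using assms abs_sum_tm_sign_le by (intro prog_disc_least) auto
qed

text \<open>
  Appending a digit \<open>0\<close> does not change \<open>s(n)\<close>, so for even moduli the last digit of \<open>n (2 d) + a\<close> is that of
  \<open>a\<close> and can be split off. This reduces all moduli to odd ones.
\<close>

lemma prog_disc_double:
  assumes "N > 0"
  shows "prog_disc N (2 * d) \<le> prog_disc N d"
proof (rule prog_disc_least[OF assms])
  fix a
  have "tm_sign (n * (2 * d) + a) = (if odd a then -1 else 1) * tm_sign (n * d + a div 2)" for n
  proof -
    have "(n * (2 * d) + a) div 2 = n * d + a div 2" by simp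
    then show ?thesis by (subst tm_sign_rec) simp
  qed
  then have "(\<Sum>n<N. tm_sign (n * (2 * d) + a)) = (if odd a then -1 else 1) * (\<Sum>n<N. tm_sign (n * d + a div 2))"
    by (simp add: sum_distrib_left)
  then have "\<bar>\<Sum>n<N. tm_sign (n * (2 * d) + a)\<bar> = \<bar>\<Sum>n<N. tm_sign (n * d + a div 2)\<bar>"
    by (simp add: abs_mult)
  then show "\<bar>\<Sum>n<N. tm_sign (n * (2 * d) + a)\<bar> \<le> prog_disc N d * real N"
    using prog_disc_upper by simp
qed

lemma sum_prog_disc_dyadic_odd_le:
  fixes N \<Lambda> :: nat and \<theta> :: real
  assumes "N > 0" "finite E" "real (card E) \<le> \<theta> * 2 ^ Suc \<Lambda>" "0 \<le> \<theta>"
    and "\<And>d. odd d \<Longrightarrow> d < 2 ^ Suc \<Lambda> \<Longrightarrow> d \<notin> E \<Longrightarrow> prog_disc N d \<le> \<theta>"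
  shows "(\<Sum>d\<in>{d\<in>{2 ^ \<Lambda>..<2 ^ Suc \<Lambda>}. odd d}. prog_disc N d / d) \<le> 4 * \<theta>"
proof -
  let ?I = "{d\<in>{2 ^ \<Lambda>..<2 ^ Suc \<Lambda> :: nat}. odd d}"
  have "(\<Sum>d\<in>?I. prog_disc N d / d) \<le> (\<Sum>d\<in>?I. (if d \<in> E then 1 / 2 ^ \<Lambda> else 0) + \<theta> / 2 ^ \<Lambda>)"
  proof (rule sum_mono)
    fix d assume d: "d \<in> ?I"
    then have d2: "(2::real) ^ \<Lambda> \<le> real d" by (metis (no_types, lifting) atLeastLessThan_iff mem_Collect_eq of_nat_le_iff of_nat_numeral of_nat_power)
    have "prog_disc N d / d \<le> prog_disc N d / 2 ^ \<Lambda>"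
      using prog_disc_bounds[OF assms(1)] d2 less_le_trans[OF _ d2, of 0] by (intro divide_left_mono) auto
    also have "\<dots> \<le> (if d \<in> E then 1 / 2 ^ \<Lambda> else 0) + \<theta> / 2 ^ \<Lambda>"
    proof (cases "d \<in> E")
      case True
      have "prog_disc N d / 2 ^ \<Lambda> \<le> 1 / 2 ^ \<Lambda>" using prog_disc_bounds[OF assms(1)] by (intro divide_right_mono) auto
      moreover have "0 \<le> \<theta> / 2 ^ \<Lambda>" using assms(4) by simp
      ultimately show ?thesis using True by simp
    next
      case False
      then show ?thesis using d assms(5)[of d] by (simp add: divide_right_mono)
    qed
    finally show "prog_disc N d / d \<le> (if d \<in> E then 1 / 2 ^ \<Lambda> else 0) + \<theta> / 2 ^ \<Lambda>" .
  qed
  also have "\<dots> = real (card (?I \<inter> E)) * (1 / 2 ^ \<Lambda>) + real (card ?I) * (\<theta> / 2 ^ \<Lambda>)"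
    by (simp add: sum.distrib sum.If_cases)
  also have "\<dots> \<le> (\<theta> * 2 ^ Suc \<Lambda>) * (1 / 2 ^ \<Lambda>) + 2 ^ Suc \<Lambda> * (\<theta> / 2 ^ \<Lambda>)"
  proof (intro add_mono mult_right_mono)
    have "real (card (?I \<inter> E)) \<le> real (card E)" using assms(2) by (intro of_nat_mono card_mono) auto
    then show "real (card (?I \<inter> E)) \<le> \<theta> * 2 ^ Suc \<Lambda>" using assms(3) by linarith
    have "card ?I \<le> card {..<2 ^ Suc \<Lambda> :: nat}" by (intro card_mono) auto
    then have "real (card ?I) \<le> real (2 ^ Suc \<Lambda>)" unfolding of_nat_le_iff by simp
    then show "real (card ?I) \<le> 2 ^ Suc \<Lambda>" by simp
  qed (use assms(4) in auto)
  also have "\<dots> = 4 * \<theta>" by simp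
  finally show ?thesis .
qed

lemma sum_prog_disc_odd_le:
  fixes N \<Lambda> :: nat and \<theta> :: real
  assumes "N > 0" "\<And>l. l < \<Lambda> \<Longrightarrow> (\<Sum>d\<in>{d\<in>{2 ^ l..<2 ^ Suc l}. odd d}. prog_disc N d / d) \<le> \<theta>"
  shows "(\<Sum>d\<in>{d\<in>{1..<2 ^ \<Lambda>}. odd d}. prog_disc N d / d) \<le> \<Lambda> * \<theta>"
  using assms(2)
proof (induction \<Lambda>)
  case (Suc \<Lambda>)
  have "{d\<in>{1..<2 ^ Suc \<Lambda> :: nat}. odd d} = {d\<in>{1..<2 ^ \<Lambda>}. odd d} \<union> {d\<in>{2 ^ \<Lambda>..<2 ^ Suc \<Lambda>}. odd d}"
    by (auto simp: le_less_trans) 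
  moreover have "{d\<in>{1..<2 ^ \<Lambda> :: nat}. odd d} \<inter> {d\<in>{2 ^ \<Lambda>..<2 ^ Suc \<Lambda>}. odd d} = {}" by auto
  ultimately have "(\<Sum>d\<in>{d\<in>{1..<2 ^ Suc \<Lambda>}. odd d}. prog_disc N d / d)
     = (\<Sum>d\<in>{d\<in>{1..<2 ^ \<Lambda>}. odd d}. prog_disc N d / d) + (\<Sum>d\<in>{d\<in>{2 ^ \<Lambda>..<2 ^ Suc \<Lambda>}. odd d}. prog_disc N d / d)"
    by (simp add: sum.union_disjoint)
  also have "\<dots> \<le> \<Lambda> * \<theta> + \<theta>" using Suc.IH Suc.prems by (intro add_mono) auto
  finally show ?case by (simp add: algebra_simps)
qed simp

text \<open>
  The even moduli contribute at most half of the sum over all moduli of half the size, by \<open>prog_disc_double\<close>. The resulting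
  geometric series accounts for the factor \<open>2\<close>.
\<close>

lemma sum_prog_disc_le:
  fixes N \<Lambda> :: nat and Q :: real
  assumes "N > 0" "(\<Sum>d\<in>{d\<in>{1..<2 ^ \<Lambda>}. odd d}. prog_disc N d / d) \<le> Q"
  shows "(\<Sum>d\<in>{1..<2 ^ \<Lambda>}. prog_disc N d / d) \<le> 2 * Q"
  using assms(2)
proof (induction \<Lambda>)
  case 0
  then show ?case by simp
next
  case (Suc \<Lambda>)
  have nn: "0 \<le> prog_disc N d / real d" for d using prog_disc_bounds[OF assms(1)] by simp
  have Q: "(\<Sum>d\<in>{d\<in>{1..<2 ^ \<Lambda>}. odd d}. prog_disc N d / d) \<le> Q"
    by (rule order.trans[OF sum_mono2 Suc.prems]) (auto simp: nn)
  have set: "{1..<2 ^ Suc \<Lambda> :: nat} = {d\<in>{1..<2 ^ Suc \<Lambda>}. odd d} \<union> (\<lambda>d. 2 * d) ` {1..<2 ^ \<Lambda>}"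
  proof (rule Set.set_eqI)
    fix d :: nat
    show "d \<in> {1..<2 ^ Suc \<Lambda>} \<longleftrightarrow> d \<in> {d\<in>{1..<2 ^ Suc \<Lambda>}. odd d} \<union> (\<lambda>d. 2 * d) ` {1..<2 ^ \<Lambda>}"
      by (cases "odd d") (auto elim!: evenE)
  qed
  have "(\<Sum>d\<in>{1..<2 ^ Suc \<Lambda>}. prog_disc N d / d)
     = (\<Sum>d\<in>{d\<in>{1..<2 ^ Suc \<Lambda>}. odd d}. prog_disc N d / d) + (\<Sum>d\<in>(\<lambda>d. 2 * d) ` {1..<2 ^ \<Lambda>}. prog_disc N d / d)"
    by (subst set, rule sum.union_disjoint) auto
  also have "(\<Sum>d\<in>(\<lambda>d. 2 * d) ` {1..<2 ^ \<Lambda> :: nat}. prog_disc N d / d)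
     = (\<Sum>d\<in>{1..<2 ^ \<Lambda>}. prog_disc N (2 * d) / real (2 * d))"
    by (subst sum.reindex) (auto intro!: inj_onI)
  also have "\<dots> \<le> (\<Sum>d\<in>{1..<2 ^ \<Lambda>}. (prog_disc N d / real d) / 2)"
    using prog_disc_double[OF assms(1)] by (intro sum_mono) (simp add: field_simps divide_right_mono)
  also have "\<dots> = (\<Sum>d\<in>{1..<2 ^ \<Lambda>}. prog_disc N d / d) / 2" by (simp add: sum_divide_distrib)
  finally show ?case using Suc.IH[OF Q] Suc.prems by simp
qed

section \<open>Counting in residue classes\<close>

lemma progression_index:
  fixes y z :: real and d a :: nat
  assumes "0 \<le> y" "y \<le> z" "d \<ge> 1"
  obtains m0 n1 :: nat where
    "{m. y \<le> real m \<and> real m < z \<and> [m = a] (mod d)} = (\<lambda>n. n * d + m0) ` {..<n1}"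
    "\<bar>real n1 - (z - y) / d\<bar> \<le> 1"
proof -
  define lo where "lo = nat \<lceil>y\<rceil>"
  define hi where "hi = nat \<lceil>z\<rceil>"
  \<comment> \<open>The first element of the progression that is at least \<open>lo\<close>.\<close>
  define m0 where "m0 = lo + nat ((int a - int lo) mod int d)"
  \<comment> \<open>If the progression starts beyond \<open>hi\<close>, truncated subtraction leaves a numerator below \<open>d\<close>, and the
    count is zero as it should be.\<close>
  define n1 where "n1 = (hi + d - 1 - m0) div d"
  have lo: "y \<le> real m \<longleftrightarrow> lo \<le> m" and hi: "real m < z \<longleftrightarrow> m < hi" for m
    using nat_ceiling_le_eq[of y m] nat_ceiling_le_eq[of z m] by (auto simp: lo_def hi_def not_le[symmetric])
  have m0: "lo \<le> m0" "m0 < lo + d"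
    using assms(3) pos_mod_bound[of "int d" "int a - int lo"] by (auto simp: m0_def nat_less_iff)
  have "int m0 = int lo + (int a - int lo) mod int d" using assms(3) by (simp add: m0_def)
  then have "int m0 mod int d = (int lo + (int a - int lo)) mod int d" by (simp add: mod_add_right_eq)
  then have m0a: "[m0 = a] (mod d)" by (simp add: cong_def flip: of_nat_mod)
  have mem: "n * d + m0 < hi \<longleftrightarrow> n < n1" for n
  proof -
    have "n < n1 \<longleftrightarrow> Suc n \<le> (hi + d - 1 - m0) div d" by (simp add: n1_def Suc_le_eq)
    also have "\<dots> \<longleftrightarrow> Suc n * d \<le> hi + d - 1 - m0"
      using assms(3) by (intro less_eq_div_iff_mult_less_eq) simp
    also have "\<dots> \<longleftrightarrow> n * d + m0 < hi" using assms(3) by auto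
    finally show ?thesis by simp
  qed
  show ?thesis
  proof (rule that[of m0 n1])
    show "{m. y \<le> real m \<and> real m < z \<and> [m = a] (mod d)} = (\<lambda>n. n * d + m0) ` {..<n1}"
    proof (intro equalityI subsetI)
      fix m assume "m \<in> {m. y \<le> real m \<and> real m < z \<and> [m = a] (mod d)}"
      then have m: "lo \<le> m" "m < hi" "[m = a] (mod d)" by (auto simp: lo hi)
      have c: "[m = m0] (mod d)" using m(3) m0a by (metis cong_sym cong_trans)
      have "m0 \<le> m"
      proof (rule ccontr)
        assume "\<not> m0 \<le> m"
        then have "d dvd m0 - m" "0 < m0 - m" "m0 - m < d"
          using c m(1) m0 by (auto simp: cong_sym_eq[of m m0] cong_altdef_nat)
        then show False using nat_dvd_not_less by blast
      qed
      then have "d dvd m - m0" using c by (simp add: cong_altdef_nat)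
      then obtain n where "m - m0 = n * d" by (metis dvdE mult.commute)
      then have n: "m = n * d + m0" using \<open>m0 \<le> m\<close> by simp
      then have "n < n1" using m(2) mem by simp
      then show "m \<in> (\<lambda>n. n * d + m0) ` {..<n1}" using n by blast
    next
      fix m assume "m \<in> (\<lambda>n. n * d + m0) ` {..<n1}"
      then obtain n where n: "n < n1" "m = n * d + m0" by auto
      have "m < hi" using n mem by simp
      moreover have "lo \<le> m" using n m0(1) by simp
      moreover have "[m = a] (mod d)" using m0a unfolding n(2) by (simp add: cong_def)
      ultimately show "m \<in> {m. y \<le> real m \<and> real m < z \<and> [m = a] (mod d)}" by (simp add: lo hi)
    qed
    have ry: "y \<le> real lo" "real lo < y + 1" using assms(1) by (auto simp: lo_def) linarith+
    have rz: "z \<le> real hi" "real hi < z + 1" using assms(1,2) by (auto simp: hi_def) linarith+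
    have d0: "0 < real d" using assms(3) by simp
    have "real n1 * real d \<le> z - y + d"
    proof (cases "n1 = 0")
      case False
      have "n1 * d \<le> hi + d - 1 - m0" by (simp add: n1_def)
      moreover have "0 < n1 * d" using False assms(3) by simp
      ultimately have "n1 * d + m0 + 1 \<le> hi + d" by linarith
      then have "real (n1 * d + m0 + 1) \<le> real (hi + d)" by (simp only: of_nat_le_iff)
      moreover have "real lo \<le> real m0" using m0(1) by simp
      ultimately show ?thesis using ry rz by simp
    qed (use assms in simp)
    then have up: "real n1 \<le> (z - y) / d + 1" using d0 by (simp add: field_simps)
    have "hi \<le> n1 * d + m0"
      using mem[of n1] by simp
    then have "real hi \<le> real (n1 * d + m0)" by (simp only: of_nat_le_iff)
    moreover have "real (m0 + 1) \<le> real (lo + d)" using m0(2) unfolding of_nat_le_iff by simp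
    ultimately have "z - y - d \<le> real n1 * real d" using ry rz by simp
    then have "(z - y) / d - 1 \<le> real n1" using d0 by (simp add: field_simps)
    with up show "\<bar>real n1 - (z - y) / d\<bar> \<le> 1" by linarith
  qed
qed

text \<open>
  A long progression is cut into pieces of length \<open>N\<close>, which are progressions with other offsets; the last, incomplete
  piece is estimated trivially.
\<close>

lemma abs_progression_sum_le:
  assumes "N > 0"
  shows "\<bar>\<Sum>n<n1. tm_sign (n * d + a)\<bar> \<le> real n1 * prog_disc N d + N"
proof -
  have chunks: "\<bar>\<Sum>n<q * N. tm_sign (n * d + a)\<bar> \<le> real q * real N * prog_disc N d" for q
  proof (induction q)
    case (Suc q)
    have "(\<Sum>n<Suc q * N. tm_sign (n * d + a)) = (\<Sum>n<q * N. tm_sign (n * d + a)) + (\<Sum>n\<in>{q * N..<q * N + N}. tm_sign (n * d + a))"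
      by (simp add: lessThan_atLeast0 sum.atLeastLessThan_concat add.commute)
    also have "(\<Sum>n\<in>{q * N..<q * N + N}. tm_sign (n * d + a)) = (\<Sum>n<N. tm_sign (n * d + (q * N * d + a)))"
      using sum.shift_bounds_nat_ivl[of "\<lambda>n. tm_sign (n * d + a)" 0 "q * N" N]
      by (simp add: lessThan_atLeast0 add.commute algebra_simps)
    finally have "\<bar>\<Sum>n<Suc q * N. tm_sign (n * d + a)\<bar>
       \<le> \<bar>\<Sum>n<q * N. tm_sign (n * d + a)\<bar> + \<bar>\<Sum>n<N. tm_sign (n * d + (q * N * d + a))\<bar>" by simp
    also have "\<dots> \<le> real q * real N * prog_disc N d + prog_disc N d * real N"
      by (intro add_mono Suc prog_disc_upper)
    finally show ?case by (simp add: algebra_simps)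
  qed simp
  define q where "q = n1 div N"
  define r where "r = n1 mod N"
  have n1: "n1 = q * N + r" unfolding q_def r_def by (rule div_mult_mod_eq[symmetric])
  have rN: "r \<le> N" using assms by (simp add: r_def)
  have "(\<Sum>n<n1. tm_sign (n * d + a)) = (\<Sum>n<q * N. tm_sign (n * d + a)) + (\<Sum>n\<in>{q * N..<q * N + r}. tm_sign (n * d + a))"
    unfolding n1 by (simp add: lessThan_atLeast0 sum.atLeastLessThan_concat)
  also have "(\<Sum>n\<in>{q * N..<q * N + r}. tm_sign (n * d + a)) = (\<Sum>n<r. tm_sign ((n + q * N) * d + a))"
    using sum.shift_bounds_nat_ivl[of "\<lambda>n. tm_sign (n * d + a)" 0 "q * N" r]
    by (simp add: lessThan_atLeast0 add.commute)
  finally have "\<bar>\<Sum>n<n1. tm_sign (n * d + a)\<bar> \<le> \<bar>\<Sum>n<q * N. tm_sign (n * d + a)\<bar> + \<bar>\<Sum>n<r. tm_sign ((n + q * N) * d + a)\<bar>"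
    by simp
  also have "\<dots> \<le> real q * real N * prog_disc N d + real r" by (intro add_mono chunks abs_sum_tm_sign_le)
  also have "\<dots> \<le> real n1 * prog_disc N d + N"
  proof (intro add_mono mult_right_mono)
    show "real q * real N \<le> real n1" unfolding of_nat_mult[symmetric] of_nat_le_iff using n1 by simp
  qed (use rN prog_disc_bounds[OF assms] in auto)
  finally show ?thesis .
qed

text \<open>
  As \<open>t(m) = 0\<close> has the indicator function \<open>(1 + (-1) ^ s(m)) / 2\<close>, the error consists of half the error in counting
  the progression and half the sum of signs along it.
\<close>

lemma tm_count_error:
  fixes y z x :: real and d a N :: nat
  assumes "0 \<le> y" "y \<le> z" "z - y \<le> x" "d \<ge> 1" "N > 0"
  shows "\<bar>real (tm_count y z d a) - (z - y) / (2 * real d)\<bar> \<le> 2 * real N + x * prog_disc N d / d"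
    and "\<bar>real (card {m. y \<le> real m \<and> real m < z \<and> [m = a] (mod d)}) - (z - y) / d\<bar> \<le> 1"
    and "finite {m. y \<le> real m \<and> real m < z \<and> [m = a] (mod d)}"
proof -
  obtain m0 n1 where S: "{m. y \<le> real m \<and> real m < z \<and> [m = a] (mod d)} = (\<lambda>n. n * d + m0) ` {..<n1}"
    and n1: "\<bar>real n1 - (z - y) / d\<bar> \<le> 1"
    by (rule progression_index[OF assms(1,2,4)])
  have inj: "inj_on (\<lambda>n. n * d + m0) A" for A using assms(4) by (auto intro!: inj_onI)
  show "\<bar>real (card {m. y \<le> real m \<and> real m < z \<and> [m = a] (mod d)}) - (z - y) / d\<bar> \<le> 1"
    unfolding S using n1 by (simp add: card_image[OF inj])
  show "finite {m. y \<le> real m \<and> real m < z \<and> [m = a] (mod d)}" unfolding S by simp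
  have "{m. y \<le> real m \<and> real m < z \<and> thue_morse m = 0 \<and> [m = a] (mod d)}
     = {m\<in>{m. y \<le> real m \<and> real m < z \<and> [m = a] (mod d)}. thue_morse m = 0}" by auto
  also have "\<dots> = (\<lambda>n. n * d + m0) ` {n\<in>{..<n1}. thue_morse (n * d + m0) = 0}" unfolding S by auto
  finally have "tm_count y z d a = card {n\<in>{..<n1}. thue_morse (n * d + m0) = 0}"
    by (simp only: tm_count_def card_image[OF inj])
  also have "real \<dots> = (\<Sum>n<n1. if thue_morse (n * d + m0) = 0 then 1 else 0)"
    by (simp add: sum.If_cases Int_def)
  also have "\<dots> = (\<Sum>n<n1. (1 + tm_sign (n * d + m0)) / 2)"
    by (intro sum.cong refl) (auto simp: tm_sign_def thue_morse_def)
  also have "\<dots> = real n1 / 2 + (\<Sum>n<n1. tm_sign (n * d + m0)) / 2"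
    by (simp add: sum_divide_distrib[symmetric] sum.distrib add_divide_distrib)
  finally have e: "real (tm_count y z d a) - (z - y) / (2 * real d)
     = (real n1 - (z - y) / d) / 2 + (\<Sum>n<n1. tm_sign (n * d + m0)) / 2"
    by (simp add: diff_divide_distrib)
  have "\<bar>(real n1 - (z - y) / d) / 2 + (\<Sum>n<n1. tm_sign (n * d + m0)) / 2\<bar>
     \<le> 1 / 2 + (real n1 * prog_disc N d + N) / 2"
  proof -
    have "\<bar>s / 2 + t / 2\<bar> \<le> 1 / 2 + w / 2" if "\<bar>s\<bar> \<le> 1" "\<bar>t\<bar> \<le> w" for s t w :: real
      using that by linarith
    from this[OF n1 abs_progression_sum_le[OF assms(5), where ?n1.0=n1 and d=d and a=m0]] show ?thesis .
  qed
  also have "real n1 * prog_disc N d \<le> (x / d + 1) * prog_disc N d"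
  proof (intro mult_right_mono)
    have "(z - y) / d \<le> x / d" using assms(3) by (intro divide_right_mono) auto
    then show "real n1 \<le> x / d + 1" using n1 by linarith
  qed (rule prog_disc_bounds[OF assms(5)])
  also have "(x / d + 1) * prog_disc N d \<le> x * prog_disc N d / d + 1"
    using prog_disc_bounds(2)[OF assms(5), of d] by (simp add: ring_distribs)
  also have "1 / 2 + (x * prog_disc N d / d + 1 + N) / 2 \<le> 2 * real N + x * prog_disc N d / d"
  proof -
    have "0 \<le> x * prog_disc N d / d" using assms prog_disc_bounds[OF assms(5), of d] by simp
    moreover have "1 \<le> real N" using assms(5) by simp
    moreover have "1 / 2 + (s + 1 + t) / 2 \<le> 2 * t + s" if "0 \<le> s" "1 \<le> t" for s t :: real
      using that by (simp add: field_simps)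
    ultimately show ?thesis by blast
  qed
  finally show "\<bar>real (tm_count y z d a) - (z - y) / (2 * real d)\<bar> \<le> 2 * real N + x * prog_disc N d / d"
    unfolding e by simp
qed

section \<open>Level of distribution\<close>

definition moduli :: "real \<Rightarrow> real \<Rightarrow> nat set" where
  "moduli x \<epsilon> = {d. 1 \<le> d \<and> real d \<le> x powr (1 - \<epsilon>)}"

lemma finite_moduli: "finite (moduli x \<epsilon>)"
proof (rule finite_subset)
  show "moduli x \<epsilon> \<subseteq> {..nat \<lfloor>x powr (1 - \<epsilon>)\<rfloor>}" by (auto simp: moduli_def le_nat_floor)
qed simp

lemma card_moduli: "real (card (moduli x \<epsilon>)) \<le> x powr (1 - \<epsilon>)"
proof -
  have "moduli x \<epsilon> \<subseteq> {1..nat \<lfloor>x powr (1 - \<epsilon>)\<rfloor>}" by (auto simp: moduli_def le_nat_floor)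
  then have "card (moduli x \<epsilon>) \<le> nat \<lfloor>x powr (1 - \<epsilon>)\<rfloor>" using card_mono[of "{1..nat \<lfloor>x powr (1 - \<epsilon>)\<rfloor>}"] by simp
  then have "real (card (moduli x \<epsilon>)) \<le> real (nat \<lfloor>x powr (1 - \<epsilon>)\<rfloor>)"
    by (simp only: of_nat_le_iff)
  also have "\<dots> \<le> x powr (1 - \<epsilon>)" by (rule of_nat_floor) simp
  finally show ?thesis .
qed

text \<open>
  The length \<open>N = 2 ^ (26 k L)\<close> is chosen as large as \<open>x powr (\<epsilon> / 2)\<close> permits. Then the trivial term \<open>2 N\<close> is
  harmless after summation over the moduli, and \<open>q ^ L\<close> is a negative power of \<open>x\<close>. The number of digits of \<open>d\<close> is at
  most a multiple of \<open>k L\<close> by a constant of order \<open>1 / \<epsilon>\<close>, so a fixed number \<open>M\<close> of van der Corput steps suffices for all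
  moduli.
\<close>

lemma sum_moduli_bound:
  fixes \<epsilon> :: real
  assumes "0 < \<epsilon>" "\<epsilon> \<le> 1 / 2"
  obtains \<eta> C :: real where "0 < \<eta>" "0 \<le> C"
    "\<And>x. x \<ge> 1 \<Longrightarrow> \<exists>N>0. (\<Sum>d\<in>moduli x \<epsilon>. 2 * real N + x * prog_disc N d / d) \<le> C * x powr (1 - \<eta>)"
proof -
  define M where "M = nat \<lceil>52 / \<epsilon>\<rceil>"
  have M: "52 / \<epsilon> \<le> real M" by (simp add: M_def of_nat_ceiling)
  have "0 < 52 / \<epsilon>" using assms by simp
  then have "M \<ge> 1" using M by (cases M) auto
  then obtain k C q where k: "k \<ge> 1" and Cq: "1 \<le> C" "0 < q" "q < 1"
    and main: "\<And>L \<Lambda>. L \<ge> 1 \<Longrightarrow> \<Lambda> \<le> (M + 6) * (2 * (k * L)) \<Longrightarrow> \<exists>E. real (card E) \<le> C * 2 ^ \<Lambda> * q ^ L \<and>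
       finite E \<and> (\<forall>d a. odd d \<longrightarrow> d < 2 ^ \<Lambda> \<longrightarrow> d \<notin> E \<longrightarrow>
         \<bar>\<Sum>n<2 ^ (26 * (k * L)). tm_sign (n * d + a)\<bar> \<le> C * q ^ L * 2 ^ (26 * (k * L)))"
    using progression_sum_bound by metis
  \<comment> \<open>Then \<open>26 k L \<le> (\<epsilon> / 2) log 2 x\<close> amounts to \<open>L \<le> s log 2 x\<close>.\<close>
  define s where "s = \<epsilon> / (52 * real k)"
  define \<eta>0 where "\<eta>0 = s * (- ln q) / ln 2"
  define \<eta> where "\<eta> = min (\<epsilon> / 2) (\<eta>0 / 2)"
  define X0 where "X0 = 2 powr (1 / s)"
  define c where "c = 1 + 1 / (ln 2 * (\<eta>0 / 2))"
  define C' where "C' = 2 + 8 * C * c / q + X0 * (2 + X0)"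
  have s: "0 < s" using assms k by (simp add: s_def)
  have \<eta>0: "0 < \<eta>0" using s Cq by (simp add: \<eta>0_def divide_less_0_iff mult_pos_neg)
  have \<eta>: "0 < \<eta>" "\<eta> \<le> \<epsilon> / 2" "\<eta> \<le> \<eta>0 / 2" using \<eta>0 assms by (auto simp: \<eta>_def)
  have c: "1 \<le> c" using \<eta>0 by (simp add: c_def)
  have X0: "0 < X0" by (simp add: X0_def)
  have C': "0 \<le> C'" using Cq c X0 by (simp add: C'_def)
  show ?thesis
  proof (rule that[OF \<eta>(1) C'])
    fix x :: real assume x: "x \<ge> 1"
    define L where "L = nat \<lfloor>s * log 2 x\<rfloor>"
    have lx: "0 \<le> log 2 x" using x by simp
    have Lb: "real L \<le> s * log 2 x" "s * log 2 x < real L + 1" using s lx by (auto simp: L_def)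
    have xp: "1 \<le> x powr e" if "0 \<le> e" for e using x that by (simp add: ge_one_powr_ge_zero)
    have mx: "real (card (moduli x \<epsilon>)) \<le> x"
      using card_moduli[of x \<epsilon>] powr_mono[of "1 - \<epsilon>" 1 x] x assms by simp
    show "\<exists>N>0. (\<Sum>d\<in>moduli x \<epsilon>. 2 * real N + x * prog_disc N d / d) \<le> C' * x powr (1 - \<eta>)"
    proof (cases "L = 0")
      case True
      then have "log 2 x < 1 / s" using Lb s by (simp add: field_simps)
      \<comment> \<open>Such \<open>x\<close> are bounded, and the trivial estimate with \<open>N = 1\<close> goes into the constant.\<close>
      then have xX: "x < X0" using x by (simp add: X0_def log_less_iff)
      have "(\<Sum>d\<in>moduli x \<epsilon>. 2 * real 1 + x * prog_disc 1 d / d) \<le> (\<Sum>d\<in>moduli x \<epsilon>. 2 + x)"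
      proof (rule sum_mono)
        fix d assume "d \<in> moduli x \<epsilon>"
        then have d: "1 \<le> real d" by (simp add: moduli_def)
        have "x * prog_disc 1 d / d \<le> x * 1 / 1"
          using prog_disc_bounds[of 1 d] d x by (intro frac_le mult_left_mono) auto
        then show "2 * real 1 + x * prog_disc 1 d / d \<le> 2 + x" by simp
      qed
      also have "\<dots> = real (card (moduli x \<epsilon>)) * (2 + x)" by simp
      also have "\<dots> \<le> X0 * (2 + X0)" using mx xX x by (intro mult_mono) auto
      also have "\<dots> \<le> C' * 1" using Cq c by (simp add: C'_def)
      also have "\<dots> \<le> C' * x powr (1 - \<eta>)" using \<eta> assms C' by (intro mult_left_mono xp) auto
      finally show ?thesis by (intro exI[of _ 1]) simp
    next
      case False
      then have L1: "L \<ge> 1" by simp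
      define N :: nat where "N = 2 ^ (26 * (k * L))"
      define \<Lambda> where "\<Lambda> = nat \<lfloor>log 2 x\<rfloor> + 1"
      define \<theta> where "\<theta> = C * q ^ L"
      have N0: "N > 0" by (simp add: N_def)
      have \<theta>0: "0 \<le> \<theta>" using Cq by (simp add: \<theta>_def)
      have \<Lambda>b: "log 2 x < real \<Lambda>" "real \<Lambda> \<le> 1 + log 2 x" using lx by (auto simp: \<Lambda>_def) linarith+
      have x2: "x < 2 ^ \<Lambda>"
        using \<Lambda>b(1) x by (simp add: log_less_iff powr_realpow)
      have N: "real N \<le> x powr (\<epsilon> / 2)"
      proof -
        have "real N = 2 powr (26 * real k * real L)" by (simp add: N_def powr_realpow[symmetric] mult.assoc)
        also have "\<dots> \<le> 2 powr (26 * real k * (s * log 2 x))" using Lb(1) by (intro powr_mono mult_left_mono) auto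
        also have "26 * real k * (s * log 2 x) = log 2 x * (\<epsilon> / 2)" using k by (simp add: s_def)
        also have "2 powr (log 2 x * (\<epsilon> / 2)) = (2 powr log 2 x) powr (\<epsilon> / 2)" by (simp only: powr_powr)
        also have "\<dots> = x powr (\<epsilon> / 2)" using x by simp
        finally show ?thesis .
      qed
      have \<Lambda>M: "\<Lambda> \<le> (M + 6) * (2 * (k * L))"
      proof -
        have "s * log 2 x < 2 * real L" using Lb(2) L1 by linarith
        then have "log 2 x < 2 * real L / s" using s by (simp add: field_simps)
        also have "\<dots> = 2 * (real k * real L) * (52 / \<epsilon>)" using assms k by (simp add: s_def)
        also have "\<dots> \<le> 2 * (real k * real L) * M" using M by (intro mult_left_mono) auto
        finally have "real \<Lambda> \<le> 1 + 2 * (real k * real L) * M" using \<Lambda>b by linarith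
        moreover have "1 \<le> real k * real L" using k L1 mult_mono[of 1 "real k" 1 "real L"] by simp
        ultimately have "real \<Lambda> \<le> (real M + 6) * (2 * (real k * real L))" by (simp add: algebra_simps)
        then have "real \<Lambda> \<le> real ((M + 6) * (2 * (k * L)))" by simp
        then show ?thesis by (simp only: of_nat_le_iff)
      qed
      have "(\<Sum>d\<in>{d\<in>{1..<2 ^ \<Lambda>}. odd d}. prog_disc N d / d) \<le> \<Lambda> * (4 * \<theta>)"
      proof (rule sum_prog_disc_odd_le[OF N0])
        fix l assume l: "l < \<Lambda>"
        then have "Suc l \<le> (M + 6) * (2 * (k * L))" using \<Lambda>M by linarith
        from main[OF L1 this] obtain E where E: "real (card E) \<le> C * 2 ^ Suc l * q ^ L" "finite E"
          "\<And>d a. odd d \<Longrightarrow> d < 2 ^ Suc l \<Longrightarrow> d \<notin> E \<Longrightarrow> \<bar>\<Sum>n<N. tm_sign (n * d + a)\<bar> \<le> \<theta> * real N"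
          unfolding N_def \<theta>_def by (auto simp del: power_Suc)
        show "(\<Sum>d\<in>{d\<in>{2 ^ l..<2 ^ Suc l}. odd d}. prog_disc N d / d) \<le> 4 * \<theta>"
        proof (rule sum_prog_disc_dyadic_odd_le[OF N0 E(2) _ \<theta>0])
          show "real (card E) \<le> \<theta> * 2 ^ Suc l" using E(1) by (simp add: \<theta>_def mult_ac)
          show "prog_disc N d \<le> \<theta>" if "odd d" "d < 2 ^ Suc l" "d \<notin> E" for d
            by (rule prog_disc_least[OF N0 E(3)[OF that]])
        qed
      qed
      then have T: "(\<Sum>d\<in>{1..<2 ^ \<Lambda>}. prog_disc N d / d) \<le> 2 * (\<Lambda> * (4 * \<theta>))" by (rule sum_prog_disc_le[OF N0])
      have sub: "moduli x \<epsilon> \<subseteq> {1..<2 ^ \<Lambda>}"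
      proof
        fix d assume d: "d \<in> moduli x \<epsilon>"
        then have "real d \<le> x powr (1 - \<epsilon>)" by (simp add: moduli_def)
        also have "\<dots> \<le> x" using powr_mono[of "1 - \<epsilon>" 1 x] x assms by simp
        finally have "real d < 2 ^ \<Lambda>" using x2 by (rule le_less_trans)
        then have "d < 2 ^ \<Lambda>" by (metis of_nat_less_iff of_nat_numeral of_nat_power)
        then show "d \<in> {1..<2 ^ \<Lambda>}" using d by (simp add: moduli_def)
      qed
      have qL: "q ^ L \<le> x powr (- \<eta>0) / q"
      proof -
        have "q ^ L = q powr real L" using Cq by (simp add: powr_realpow)
        also have "\<dots> \<le> q powr (s * log 2 x - 1)" using Lb(2) Cq by (intro powr_mono') auto
        also have "\<dots> = q powr (s * log 2 x) / q" using Cq by (simp add: powr_diff)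
        also have "q powr (s * log 2 x) = x powr (- \<eta>0)"
          using Cq x by (simp add: powr_def \<eta>0_def log_def field_simps)
        finally show ?thesis .
      qed
      have lc: "1 + log 2 x \<le> c * x powr (\<eta>0 / 2)"
      proof -
        have "ln x \<le> x powr (\<eta>0 / 2) / (\<eta>0 / 2)" using x \<eta>0 by (intro ln_powr_bound) auto
        then have "log 2 x \<le> (x powr (\<eta>0 / 2) / (\<eta>0 / 2)) / ln 2" unfolding log_def by (intro divide_right_mono) auto
        also have "\<dots> = (1 / (ln 2 * (\<eta>0 / 2))) * x powr (\<eta>0 / 2)" by (simp add: mult_ac)
        finally show ?thesis using xp[of "\<eta>0 / 2"] \<eta>0 by (simp add: c_def ring_distribs)
      qed
      have "(\<Sum>d\<in>moduli x \<epsilon>. 2 * real N + x * prog_disc N d / d)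
         = real (card (moduli x \<epsilon>)) * (2 * real N) + x * (\<Sum>d\<in>moduli x \<epsilon>. prog_disc N d / d)"
        by (simp add: sum.distrib sum_distrib_left)
      also have "\<dots> \<le> x powr (1 - \<epsilon>) * (2 * x powr (\<epsilon> / 2)) + x * (2 * (\<Lambda> * (4 * \<theta>)))"
      proof (intro add_mono mult_mono)
        have "(\<Sum>d\<in>moduli x \<epsilon>. prog_disc N d / d) \<le> (\<Sum>d\<in>{1..<2 ^ \<Lambda>}. prog_disc N d / d)"
          using prog_disc_bounds[OF N0] by (intro sum_mono2 sub) auto
        then show "(\<Sum>d\<in>moduli x \<epsilon>. prog_disc N d / d) \<le> 2 * (\<Lambda> * (4 * \<theta>))" using T by linarith
        show "0 \<le> (\<Sum>d\<in>moduli x \<epsilon>. prog_disc N d / d)" using prog_disc_bounds[OF N0] by (intro sum_nonneg) auto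
      qed (use card_moduli N x in auto)
      also have "x powr (1 - \<epsilon>) * (2 * x powr (\<epsilon> / 2)) = 2 * x powr (1 - \<epsilon> / 2)"
        using x by (simp add: powr_add[symmetric])
      also have "\<dots> \<le> 2 * x powr (1 - \<eta>)" using x \<eta> by (intro mult_left_mono powr_mono) auto
      also have "x * (2 * (\<Lambda> * (4 * \<theta>))) = 8 * C * x * (\<Lambda> * q ^ L)" by (simp add: \<theta>_def)
      also have "\<dots> \<le> 8 * C * x * ((c * x powr (\<eta>0 / 2)) * (x powr (- \<eta>0) / q))"
      proof (intro mult_left_mono mult_mono)
        show "real \<Lambda> \<le> c * x powr (\<eta>0 / 2)" using \<Lambda>b lc by linarith
      qed (use qL Cq c x in auto)
      also have "\<dots> = (8 * C * c / q) * (x powr 1 * x powr (\<eta>0 / 2) * x powr (- \<eta>0))" using x by simp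
      also have "x powr 1 * x powr (\<eta>0 / 2) * x powr (- \<eta>0) = x powr (1 - \<eta>0 / 2)"
        unfolding powr_add[symmetric] by (simp add: field_simps)
      also have "(8 * C * c / q) * x powr (1 - \<eta>0 / 2) \<le> (8 * C * c / q) * x powr (1 - \<eta>)"
        using x \<eta> Cq c by (intro mult_left_mono powr_mono) auto
      also have "2 * x powr (1 - \<eta>) + (8 * C * c / q) * x powr (1 - \<eta>) \<le> C' * x powr (1 - \<eta>)"
        unfolding distrib_right[symmetric] using X0 by (intro mult_right_mono) (auto simp: C'_def)
      finally show ?thesis using N0 by (intro exI[of _ N]) simp
    qed
  qed
qed

lemma ZFact_carrier: "carrier (ZFact k) = range (ZMod k)"
  by (auto simp: ZFact_defs A_RCOSETS_def' ZMod_def int_carrier_eq)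

lemma card_ZFact:
  assumes "d \<ge> 1"
  shows "card (carrier (ZFact (int d))) = d"
proof -
  have "carrier (ZFact (int d)) = ZMod (int d) ` {0..<int d}"
  proof -
    have "ZMod (int d) r \<in> ZMod (int d) ` {0..<int d}" for r
      using assms by (intro image_eqI[of _ _ "r mod int d"] ZMod_mod) auto
    then show ?thesis unfolding ZFact_carrier by blast
  qed
  moreover have "inj_on (ZMod (int d)) {0..<int d}"
    by (auto intro!: inj_onI simp: ZMod_eq_mod)
  ultimately show ?thesis by (simp add: card_image)
qed

text \<open>
  The mean over all residue classes of the sums of the sequence is their sum divided by \<open>d\<close>. Since the sum over each
  class is close to \<open>y / (2 d)\<close>, it is also close to this mean.
\<close>

lemma thue_morse_sum_error:
  fixes x y :: real and d a N :: nat
  assumes "0 \<le> y" "y \<le> x" "d \<ge> 1" "N > 0"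
  shows "\<bar>(\<Sum>n | real n < y \<and> [n = a] (mod d). real (thue_morse n))
      - (\<Sum>n | real n < y. real (thue_morse n)) / d\<bar> \<le> 4 * (2 * real N + x * prog_disc N d / d)"
proof -
  define b where "b = 2 * real N + x * prog_disc N d / d"
  define P where "P a = (\<Sum>n | real n < y \<and> [n = a] (mod d). real (thue_morse n))" for a
  have x: "0 \<le> x" using assms by linarith
  have b1: "1 \<le> b"
  proof -
    have "0 \<le> x * prog_disc N d / d" using x prog_disc_bounds[OF assms(4), of d] by simp
    moreover have "1 \<le> real N" using assms(4) by simp
    ultimately show ?thesis by (simp add: b_def)
  qed
  have P: "\<bar>P a - y / (2 * d)\<bar> \<le> 1 + b" for a
  proof -
    let ?S = "{n. 0 \<le> real n \<and> real n < y \<and> [n = a] (mod d)}"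
    have e: "{n. real n < y \<and> [n = a] (mod d)} = ?S" by auto
    have yx: "y - 0 \<le> x" using assms(2) by simp
    note E = tm_count_error[OF order.refl assms(1) yx assms(3,4), of a]
    have "P a = (\<Sum>n\<in>?S. 1 - (if thue_morse n = 0 then 1 else 0))"
      unfolding P_def e by (intro sum.cong refl) (auto simp: thue_morse_def)
    also have "\<dots> = real (card ?S) - real (card {n\<in>?S. thue_morse n = 0})"
      using E(3) by (simp add: sum_subtractf sum.If_cases Int_def)
    also have "{n\<in>?S. thue_morse n = 0} = {m. 0 \<le> real m \<and> real m < y \<and> thue_morse m = 0 \<and> [m = a] (mod d)}"
      by auto
    finally have Pe: "P a = real (card ?S) - real (tm_count 0 y d a)" by (simp only: tm_count_def)
    have h: "(y - 0) / d = 2 * ((y - 0) / (2 * real d))" using assms(3) by simp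
    have gen: "\<bar>s - t - v\<bar> \<le> 1 + b" if "\<bar>s - 2 * v\<bar> \<le> 1" "\<bar>t - v\<bar> \<le> b" for s t v :: real
      using that by linarith
    show ?thesis
      unfolding Pe using gen[OF E(2)[unfolded h] E(1)[folded b_def]] by simp
  qed
  have fin: "finite {n. real n < y}"
    by (rule finite_subset[of _ "{..nat \<lceil>y\<rceil>}"]) (auto simp: nat_ceiling_le_eq le_nat_iff, linarith)
  have "(\<Sum>n | real n < y. real (thue_morse n)) = (\<Sum>a<d. \<Sum>n\<in>{n\<in>{n. real n < y}. n mod d = a}. real (thue_morse n))"
    using fin assms(3) by (intro sum.group[symmetric]) auto
  also have "\<dots> = (\<Sum>a<d. P a)"
    unfolding P_def by (intro sum.cong refl) (auto simp: cong_def)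
  finally have T: "(\<Sum>n | real n < y. real (thue_morse n)) / d = (\<Sum>a<d. P a) / d" by simp
  have "(\<Sum>a<d. P a) / d - y / (2 * d) = (\<Sum>a<d. P a - y / (2 * d)) / d"
    using assms(3) by (simp add: sum_subtractf diff_divide_distrib)
  then have "\<bar>(\<Sum>a<d. P a) / d - y / (2 * d)\<bar> = \<bar>\<Sum>a<d. P a - y / (2 * d)\<bar> / d"
    by (simp only: abs_divide abs_of_nat)
  also have "\<dots> \<le> (\<Sum>a<d. 1 + b) / d"
    by (intro divide_right_mono order.trans[OF sum_abs] sum_mono P) simp
  also have "\<dots> = 1 + b" using assms(3) by simp
  finally have avg: "\<bar>(\<Sum>a<d. P a) / d - y / (2 * d)\<bar> \<le> 1 + b" .
  have "\<bar>t - s\<bar> \<le> 2 * w" if "\<bar>s - v\<bar> \<le> w" "\<bar>t - v\<bar> \<le> w" for s t v w :: real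
    using that by linarith
  from this[OF avg P[of a]] have "\<bar>P a - (\<Sum>a<d. P a) / d\<bar> \<le> 2 * (1 + b)" .
  also have "\<dots> \<le> 4 * b" using b1 by simp
  finally show ?thesis unfolding T P_def b_def .
qed

text \<open>
  For \<open>x = 1\<close> the sum vanishes, so that the right-hand side in the definition of the level of distribution is zero there.
\<close>

lemma thue_morse_density:
  fixes x :: real
  assumes "x > 1"
  shows "x / 4 \<le> (\<Sum>n | real n < x. real (thue_morse n))"
proof -
  define h where "h = nat \<lceil>x\<rceil>"
  have S: "{n. real n < x} = {..<h}" 
    using nat_ceiling_le_eq[of x] by (auto simp: h_def not_le[symmetric])
  have hx: "x \<le> real h" using assms by (simp add: h_def)
  then have "real 1 < real h" using assms by simp
  then have "2 \<le> h" by (simp only: of_nat_less_iff)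
  then have "h \<le> 4 * (h div 2)" by presburger
  then have "real h \<le> real (4 * (h div 2))" by (simp only: of_nat_le_iff)
  then have "x / 4 \<le> real (h div 2)" using hx by simp
  also have "\<dots> = (\<Sum>n<2 * (h div 2). real (thue_morse n))" by (rule sum_thue_morse_pairs[symmetric])
  also have "\<dots> \<le> (\<Sum>n<h. real (thue_morse n))" by (rule sum_mono2) auto
  finally show ?thesis by (simp add: S)
qed

lemma moduli_mono: "x \<ge> 1 \<Longrightarrow> \<epsilon>' \<le> \<epsilon> \<Longrightarrow> moduli x \<epsilon> \<subseteq> moduli x \<epsilon>'"
  using powr_mono[of "1 - \<epsilon>" "1 - \<epsilon>'" x] by (auto simp: moduli_def)

text \<open>
  The form in which \<open>sum_moduli_bound\<close> serves both halves of the theorem: any family of extended reals that is dominated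
  termwise has a small sum. For \<open>\<epsilon> > 1 / 2\<close> the moduli are among those for \<open>\<epsilon> = 1 / 2\<close>.
\<close>

lemma sum_ennreal_moduli_le:
  fixes \<epsilon> :: real
  assumes "0 < \<epsilon>"
  obtains \<eta> C :: real where "0 < \<eta>" "0 \<le> C"
    "\<And>x. x \<ge> 1 \<Longrightarrow> \<exists>N>0. \<forall>F. (\<forall>d\<in>moduli x \<epsilon>. F d \<le> ennreal (4 * (2 * real N + x * prog_disc N d / d)))
        \<longrightarrow> (\<Sum>d\<in>moduli x \<epsilon>. F d) \<le> ennreal (C * x powr (1 - \<eta>))"
proof -
  have m: "0 < min \<epsilon> (1 / 2)" "min \<epsilon> (1 / 2) \<le> 1 / 2" using assms by simp_all
  obtain \<eta> C :: real where \<eta>: "0 < \<eta>" "0 \<le> C"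
    and bound: "\<And>x. x \<ge> 1 \<Longrightarrow> \<exists>N>0. (\<Sum>d\<in>moduli x (min \<epsilon> (1 / 2)). 2 * real N + x * prog_disc N d / d) \<le> C * x powr (1 - \<eta>)"
    by (rule sum_moduli_bound[OF m]) blast
  show ?thesis
  proof (rule that[of \<eta> "4 * C"])
    fix x :: real assume x: "x \<ge> 1"
    obtain N where N: "N > 0" "(\<Sum>d\<in>moduli x (min \<epsilon> (1 / 2)). 2 * real N + x * prog_disc N d / d) \<le> C * x powr (1 - \<eta>)"
      using bound[OF x] by blast
    have nn: "0 \<le> 4 * (2 * real N + x * prog_disc N d / d)" for d
      using x prog_disc_bounds[OF N(1), of d] by simp
    show "\<exists>N>0. \<forall>F. (\<forall>d\<in>moduli x \<epsilon>. F d \<le> ennreal (4 * (2 * real N + x * prog_disc N d / d)))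
        \<longrightarrow> (\<Sum>d\<in>moduli x \<epsilon>. F d) \<le> ennreal (4 * C * x powr (1 - \<eta>))"
    proof (intro exI[of _ N] conjI allI impI)
      fix F :: "nat \<Rightarrow> ennreal"
      assume F: "\<forall>d\<in>moduli x \<epsilon>. F d \<le> ennreal (4 * (2 * real N + x * prog_disc N d / d))"
      have "(\<Sum>d\<in>moduli x \<epsilon>. F d) \<le> (\<Sum>d\<in>moduli x \<epsilon>. ennreal (4 * (2 * real N + x * prog_disc N d / d)))"
        using F by (intro sum_mono) auto
      also have "\<dots> = ennreal (\<Sum>d\<in>moduli x \<epsilon>. 4 * (2 * real N + x * prog_disc N d / d))"
        using nn by (intro sum_ennreal) auto
      also have "\<dots> \<le> ennreal (\<Sum>d\<in>moduli x (min \<epsilon> (1 / 2)). 4 * (2 * real N + x * prog_disc N d / d))"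
        using moduli_mono[OF x, of "min \<epsilon> (1 / 2)" \<epsilon>] nn
        by (intro ennreal_leI sum_mono2 finite_moduli) auto
      also have "\<dots> \<le> ennreal (4 * C * x powr (1 - \<eta>))"
        unfolding sum_distrib_left[symmetric] mult.assoc
        using N(2) by (intro ennreal_leI mult_left_mono) auto
      finally show "(\<Sum>d\<in>moduli x \<epsilon>. F d) \<le> ennreal (4 * C * x powr (1 - \<eta>))" .
    qed (rule N(1))
  qed (use \<eta> in auto)
qed

text \<open>
  A power of \<open>x\<close> beats every power of the logarithm. The factor \<open>x / 4\<close> is separated out because it is the lower bound
  of \<open>thue_morse_density\<close>.
\<close>

lemma powr_le_log_saving:
  fixes x \<eta> A C :: real
  assumes "x \<ge> 1" "0 < \<eta>" "0 < A" "0 \<le> C"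
  shows "C * x powr (1 - \<eta>) \<le> 4 * C * 2 powr \<eta> / (\<eta> / A) powr A * (x / 4) * ln (2 * x) powr (- A)"
proof -
  define s where "s = \<eta> / A"
  have s: "0 < s" "s * A = \<eta>" using assms by (auto simp: s_def)
  have l0: "0 < ln (2 * x)" using assms(1) by simp
  have "ln (2 * x) \<le> (2 * x) powr s / s" using assms(1) s by (intro ln_powr_bound) auto
  then have "ln (2 * x) powr A \<le> ((2 * x) powr s / s) powr A" using l0 assms by (intro powr_mono2) auto
  also have "\<dots> = 2 powr \<eta> * x powr \<eta> / s powr A"
    using assms s by (simp add: powr_divide powr_powr powr_mult)
  finally have le: "ln (2 * x) powr A * s powr A \<le> 2 powr \<eta> * x powr \<eta>"
    using s by (simp add: field_simps)
  have "x powr (1 - \<eta>) * (ln (2 * x) powr A * s powr A) \<le> x powr (1 - \<eta>) * (2 powr \<eta> * x powr \<eta>)"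
    using le by (intro mult_left_mono) auto
  also have "\<dots> = 2 powr \<eta> * x" using assms by (simp add: powr_diff)
  finally have "x powr (1 - \<eta>) \<le> 2 powr \<eta> * x / (ln (2 * x) powr A * s powr A)"
    using l0 s by (simp add: le_divide_eq)
  also have "\<dots> = 2 powr \<eta> / s powr A * x * ln (2 * x) powr (- A)"
    by (simp add: powr_minus field_simps)
  finally have "C * x powr (1 - \<eta>) \<le> C * (2 powr \<eta> / s powr A * x * ln (2 * x) powr (- A))"
    using assms(4) by (intro mult_left_mono) auto
  then show ?thesis by (simp add: s_def)
qed

theorem theorem2p1:
  shows "has_level_of_distribution (\<lambda>n. of_nat (thue_morse n))
           (\<lambda>d. carrier (ZFact (int d))) (\<lambda>d. carrier (ZFact (int d))) 1
    \<and> (\<forall>\<epsilon>::real. \<epsilon> > 0 \<longrightarrow> (\<exists>\<eta>::real. \<eta> > 0 \<and> (\<exists>C::real. \<forall>x::real. x \<ge> 1 \<longrightarrow>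
         (\<Sum>d::nat | 1 \<le> d \<and> real d \<le> x powr (1 - \<epsilon>).
            SUP (y, z)\<in>{(y::real, z::real). 0 \<le> y \<and> y \<le> z \<and> z - y \<le> x}. SUP a\<in>{..<d}.
              ennreal \<bar>real (tm_count y z d a) - (z - y) / (2 * real d)\<bar>)
         \<le> ennreal (C * x powr (1 - \<eta>)))))"
proof (intro conjI allI impI)
  show "has_level_of_distribution (\<lambda>n. of_nat (thue_morse n))
           (\<lambda>d. carrier (ZFact (int d))) (\<lambda>d. carrier (ZFact (int d))) 1"
    unfolding has_level_of_distribution_def moduli_def[symmetric]
  proof (intro conjI allI impI)
    fix d :: nat
    show "carrier (ZFact (int d)) \<noteq> {}" by (simp add: ZFact_carrier)
  next
    fix \<epsilon> A :: real assume \<epsilon>: "\<epsilon> > 0" and A: "A > 0"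
    obtain \<eta> C :: real where \<eta>: "0 < \<eta>" "0 \<le> C"
      and bound: "\<And>x. x \<ge> 1 \<Longrightarrow> \<exists>N>0. \<forall>F. (\<forall>d\<in>moduli x \<epsilon>. F d \<le> ennreal (4 * (2 * real N + x * prog_disc N d / d)))
        \<longrightarrow> (\<Sum>d\<in>moduli x \<epsilon>. F d) \<le> ennreal (C * x powr (1 - \<eta>))"
      by (rule sum_ennreal_moduli_le[OF \<epsilon>]) blast
    define C' where "C' = 4 * C * 2 powr \<eta> / (\<eta> / A) powr A"
    have C': "0 \<le> C'" using \<eta> by (simp add: C'_def)
    define G where "G x d = (SUP y\<in>{0..x}. SUP a\<in>{a. a < d \<and> ZMod (int d) (int a) \<in> carrier (ZFact (int d))}.
             ennreal (cmod ((\<Sum>n | real n < y \<and> [n = a] (mod d). of_nat (thue_morse n))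
               - (\<Sum>n | real n < y \<and> ZMod (int d) (int n) \<in> carrier (ZFact (int d)). of_nat (thue_morse n))
                   / of_nat (card (carrier (ZFact (int d)))))))" for x :: real and d :: nat
    have cm: "cmod ((\<Sum>n | real n < y \<and> [n = a] (mod d). of_nat (thue_morse n))
               - (\<Sum>n | real n < y \<and> ZMod (int d) (int n) \<in> carrier (ZFact (int d)). of_nat (thue_morse n))
                   / of_nat (card (carrier (ZFact (int d)))))
      = \<bar>(\<Sum>n | real n < y \<and> [n = a] (mod d). real (thue_morse n))
          - (\<Sum>n | real n < y. real (thue_morse n)) / d\<bar>" if "d \<ge> 1" for y :: real and d a :: nat
    proof -
      have "(\<Sum>n | real n < y \<and> [n = a] (mod d). of_nat (thue_morse n))
          - (\<Sum>n | real n < y \<and> ZMod (int d) (int n) \<in> carrier (ZFact (int d)). of_nat (thue_morse n))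
              / of_nat (card (carrier (ZFact (int d))))
        = complex_of_real ((\<Sum>n | real n < y \<and> [n = a] (mod d). real (thue_morse n))
          - (\<Sum>n | real n < y. real (thue_morse n)) / d)"
        using card_ZFact[OF that] by (simp add: ZFact_carrier)
      then show ?thesis by (simp only: norm_of_real)
    qed
    show "\<exists>C'. \<forall>x\<ge>1. (\<Sum>d\<in>moduli x \<epsilon>. SUP y\<in>{0..x}.
            SUP a\<in>{a. a < d \<and> ZMod (int d) (int a) \<in> carrier (ZFact (int d))}.
             ennreal (cmod ((\<Sum>n | real n < y \<and> [n = a] (mod d). of_nat (thue_morse n))
               - (\<Sum>n | real n < y \<and> ZMod (int d) (int n) \<in> carrier (ZFact (int d)). of_nat (thue_morse n))
                   / of_nat (card (carrier (ZFact (int d)))))))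
        \<le> ennreal (C' * (\<Sum>n | real n < x. cmod (of_nat (thue_morse n))) * ln (2 * x) powr (- A))"
      unfolding G_def[symmetric]
    proof (intro exI[of _ C'] allI impI)
      fix x :: real assume x: "x \<ge> 1"
      show "(\<Sum>d\<in>moduli x \<epsilon>. G x d)
          \<le> ennreal (C' * (\<Sum>n | real n < x. cmod (of_nat (thue_morse n))) * ln (2 * x) powr (- A))"
      proof (cases "x = 1")
        case True
        \<comment> \<open>The right-hand side vanishes here. But the only modulus is \<open>1\<close>, with a single residue class.\<close>
        have "G x d = 0" if "d \<in> moduli x \<epsilon>" for d
        proof -
          have d: "d = 1" using that True by (simp add: moduli_def)
          have "G x d \<le> 0"
            unfolding G_def by (intro SUP_least) (subst cm, simp_all add: d)
          then show ?thesis by simp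
        qed
        then show ?thesis by simp
      next
        case False
        obtain N where N: "N > 0" "\<And>F. (\<forall>d\<in>moduli x \<epsilon>. F d \<le> ennreal (4 * (2 * real N + x * prog_disc N d / d)))
            \<Longrightarrow> (\<Sum>d\<in>moduli x \<epsilon>. F d) \<le> ennreal (C * x powr (1 - \<eta>))"
          using bound[OF x] by blast
        have "(\<Sum>d\<in>moduli x \<epsilon>. G x d) \<le> ennreal (C * x powr (1 - \<eta>))"
        proof (rule N(2), rule ballI)
          fix d assume "d \<in> moduli x \<epsilon>"
          then have d: "d \<ge> 1" by (simp add: moduli_def)
          show "G x d \<le> ennreal (4 * (2 * real N + x * prog_disc N d / d))"
            unfolding G_def
          proof (intro SUP_least)
            fix y a assume "y \<in> {0..x}"
            then show "ennreal (cmod ((\<Sum>n | real n < y \<and> [n = a] (mod d). of_nat (thue_morse n))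
               - (\<Sum>n | real n < y \<and> ZMod (int d) (int n) \<in> carrier (ZFact (int d)). of_nat (thue_morse n))
                   / of_nat (card (carrier (ZFact (int d))))))
               \<le> ennreal (4 * (2 * real N + x * prog_disc N d / d))"
              unfolding cm[OF d] using d N(1) by (intro ennreal_leI thue_morse_sum_error) auto
          qed
        qed
        also have "\<dots> \<le> ennreal (C' * (x / 4) * ln (2 * x) powr (- A))"
          unfolding C'_def using x \<eta> A by (intro ennreal_leI powr_le_log_saving) auto
        also have "\<dots> \<le> ennreal (C' * (\<Sum>n | real n < x. cmod (of_nat (thue_morse n))) * ln (2 * x) powr (- A))"
          using thue_morse_density[of x] x False C'
          by (intro ennreal_leI mult_right_mono mult_left_mono) auto
        finally show ?thesis .
      qed
    qed
  qed auto
next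
  fix \<epsilon> :: real assume \<epsilon>: "\<epsilon> > 0"
  obtain \<eta> C :: real where \<eta>: "0 < \<eta>" "0 \<le> C"
    and bound: "\<And>x. x \<ge> 1 \<Longrightarrow> \<exists>N>0. \<forall>F. (\<forall>d\<in>moduli x \<epsilon>. F d \<le> ennreal (4 * (2 * real N + x * prog_disc N d / d)))
      \<longrightarrow> (\<Sum>d\<in>moduli x \<epsilon>. F d) \<le> ennreal (C * x powr (1 - \<eta>))"
    by (rule sum_ennreal_moduli_le[OF \<epsilon>]) blast
  show "\<exists>\<eta>>0. \<exists>C. \<forall>x\<ge>1.
         (\<Sum>d::nat | 1 \<le> d \<and> real d \<le> x powr (1 - \<epsilon>).
            SUP (y, z)\<in>{(y::real, z::real). 0 \<le> y \<and> y \<le> z \<and> z - y \<le> x}. SUP a\<in>{..<d}.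
              ennreal \<bar>real (tm_count y z d a) - (z - y) / (2 * real d)\<bar>)
         \<le> ennreal (C * x powr (1 - \<eta>))"
    unfolding moduli_def[symmetric]
  proof (rule exI[of _ \<eta>], rule conjI[OF \<eta>(1)], rule exI[of _ C], intro allI impI)
    fix x :: real assume x: "x \<ge> 1"
    obtain N where N: "N > 0" "\<And>F. (\<forall>d\<in>moduli x \<epsilon>. F d \<le> ennreal (4 * (2 * real N + x * prog_disc N d / d)))
        \<Longrightarrow> (\<Sum>d\<in>moduli x \<epsilon>. F d) \<le> ennreal (C * x powr (1 - \<eta>))"
      using bound[OF x] by blast
    show "(\<Sum>d\<in>moduli x \<epsilon>.
            SUP (y, z)\<in>{(y::real, z::real). 0 \<le> y \<and> y \<le> z \<and> z - y \<le> x}. SUP a\<in>{..<d}.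
              ennreal \<bar>real (tm_count y z d a) - (z - y) / (2 * real d)\<bar>)
         \<le> ennreal (C * x powr (1 - \<eta>))"
    proof (rule N(2), rule ballI)
      fix d assume "d \<in> moduli x \<epsilon>"
      then have d: "d \<ge> 1" by (simp add: moduli_def)
      show "(SUP (y, z)\<in>{(y::real, z::real). 0 \<le> y \<and> y \<le> z \<and> z - y \<le> x}. SUP a\<in>{..<d}.
              ennreal \<bar>real (tm_count y z d a) - (z - y) / (2 * real d)\<bar>)
          \<le> ennreal (4 * (2 * real N + x * prog_disc N d / d))"
      proof (rule SUP_least)
        fix p :: "real \<times> real"
        assume "p \<in> {(y, z). 0 \<le> y \<and> y \<le> z \<and> z - y \<le> x}"
        then obtain y z where p: "p = (y, z)" and yz: "0 \<le> y" "y \<le> z" "z - y \<le> x" by auto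
        show "(case p of (y, z) \<Rightarrow> SUP a\<in>{..<d}.
              ennreal \<bar>real (tm_count y z d a) - (z - y) / (2 * real d)\<bar>)
          \<le> ennreal (4 * (2 * real N + x * prog_disc N d / d))"
          unfolding p prod.case
        proof (rule SUP_least)
          fix a
          have "\<bar>real (tm_count y z d a) - (z - y) / (2 * real d)\<bar> \<le> 2 * real N + x * prog_disc N d / d"
            by (rule tm_count_error(1)[OF yz d N(1)])
          also have "\<dots> \<le> 4 * (2 * real N + x * prog_disc N d / d)"
          proof -
            have "0 \<le> 2 * real N + x * prog_disc N d / d"
              using x prog_disc_bounds[OF N(1), of d] by simp
            from mult_right_mono[of 1 4, OF _ this] show ?thesis by simp
          qed
          finally show "ennreal \<bar>real (tm_count y z d a) - (z - y) / (2 * real d)\<bar>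
              \<le> ennreal (4 * (2 * real N + x * prog_disc N d / d))" by (rule ennreal_leI)
        qed
      qed
    qed
  qed
qed

end
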